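(* Consider finite subsets $\alpha\subseteq\widehat{\mathbb C}$ with $\mathcal A_\alpha\simeq D_n$, $n\ge2$, and with prescribed dihedral-$n$ component index. (a) Let $n\ge3$, $n\ne4$. Such $\alpha$ exists for index $(0,1,0)$, with $|\alpha|=n$; for index $(1,1,0)$, with $|\alpha|=n+2$; and for every index $(\nu,\epsilon,k)\in\{0,1\}\times\{0,1,2\}\times\mathbb N$ with $k\ge1$, with $|\alpha|=2\nu+n(\epsilon+2k)$. No such $\alpha$ exists for the indices $(0,2,0)$ and $(1,2,0)$. (b) Let $n=4$. Such $\alpha$ exists for index $(0,1,0)$, with $|\alpha|=4$, and for every index $(\nu,\epsilon,k)\in\{0,1\}\times\{0,1,2\}\times\mathbb N$ with $k\ge1$, with $|\alpha|=2\nu+4(\epsilon+2k)$. No such $\alpha$ exists for the indices $(1,1,0)$, $(0,2,0)$ and $(1,2,0)$. (c) Let $n=2$. Such $\alpha$ exists for every index $(\nu,k)\in\{0,1,2,3\}\times\mathbb N$ with $k\ge1$, with $|\alpha|=2\nu+4k$. No such $\alpha$ exists for the indices $(1,0)$, $(2,0)$ and $(3,0)$. Moreover, with $\alpha$ ranging over finite subsets of $\widehat{\mathbb C}$ and $k$ over integers, $$\{|\alpha| : \mathcal A_\alpha\simeq D_n\}=\{x+nk\mid x\in\{0,2\},\ k\ge1\}\quad\text{for } n\ge3,\ n\ne4,$$ $$\{|\alpha| : \mathcal A_\alpha\simeq D_4\}=\{x+4k\mid x\in\{0,2\},\ k\ge2\}\cup\{4\},$$ $$\{|\alpha| : \mathcal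 A_\alpha\simeq K_4\}=\{2k\mid k\ge2\}.$$
   Context: $\mathbb N=\{0,1,2,\dots\}$, $\widehat{\mathbb C}=\mathbb C\cup\{\infty\}$, $\mathbb C^*=\mathbb C\setminus\{0\}$. For $\alpha\subseteq\widehat{\mathbb C}$, $\mathcal A_\alpha$ is the group of all Möbius transformations $f\in\mathrm{PSL}(2,\mathbb C)$ with $f(\alpha)=\alpha$. $D_n$ is the dihedral group of order $2n$; $D_2=K_4$ is the Klein four-group. Let $G=\langle z\mapsto e^{2\pi i/n}z,\ z\mapsto 1/z\rangle\simeq D_n$. Its orbits are $V=\{0,\infty\}$, $A_n=\{e^{\frac{j}{n}2\pi i}\mid j\in\mathbb Z\}$, $B_n=\{e^{\frac{2j+1}{2n}2\pi i}\mid j\in\mathbb Z\}$, and $C_n(z)=\{ze^{\frac{j}{n}2\pi i}\mid j\in\mathbb Z\}\cup\{z^{-1}e^{\frac{j}{n}2\pi i}\mid j\in\mathbb Z\}$ for $z\in\mathbb C^*\setminus\{e^{\frac{l}{2n}2\pi i}\mid l\in\mathbb Z\}$. For a subset $\alpha\subseteq\widehat{\mathbb C}$ that is a finite union of $G$-orbits, its dihedral-$n$ component index is: for $n\ge3$, $(\nu,\epsilon,k)\in\{0,1\}\times\{0,1,2\}\times\mathbb N$, where $\nu$ is the number of orbits of type $V$, $\epsilon$ the number of orbits among $A_n,B_n$, and $k$ the number of orbits of type $C_n$ in $\alpha$; for $n=2$, $(\nu,k)\in\{0,1,2,3\}\times\mathbb N$, where $\nu$ is the number of orbits among $V,A_2,B_2$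 and $k$ the number of orbits of type $C_2$ in $\alpha$. *)

theory Defs
  imports Complex_Main "HOL-Algebra.Algebra"
begin

text \<open>The Riemann sphere; \<^term>\<open>None\<close> is the point at infinity.\<close>

type_synonym sphere = "complex option"

definition moebius :: "complex \<Rightarrow> complex \<Rightarrow> complex \<Rightarrow> complex \<Rightarrow> sphere \<Rightarrow> sphere" where
  "moebius a b c d p = (case p of
      None \<Rightarrow> if c = 0 then None else Some (a / c)
    | Some z \<Rightarrow> if c * z + d = 0 then None else Some ((a * z + b) / (c * z + d)))"

text \<open>$\mathrm{PSL}(2,\mathbb{C})$ in its faithful action on the sphere: matrices of determinant 1
  that differ by a sign give the same map.\<close>

definition moebius_group :: "(sphere \<Rightarrow> sphere) monoid" where
  "moebius_group =
     \<lparr>carrier = {moebius a b c d | a b c d. a * d - b * c = 1}, monoid.mult = (\<circ>), one = id\<rparr>"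

definition symmetry_group :: "sphere set \<Rightarrow> (sphere \<Rightarrow> sphere) monoid" where
  "symmetry_group \<alpha> = moebius_group\<lparr>carrier := {f \<in> carrier moebius_group. f ` \<alpha> = \<alpha>}\<rparr>"

text \<open>The abstract dihedral group of order $2n$ (for $n = 2$, the Klein four-group):
  \<^term>\<open>(a, s)\<close> stands for $r^a$ if \<^term>\<open>\<not> s\<close> and for $r^a t$ if \<^term>\<open>s\<close>,
  with $r^n = t^2 = 1$ and $t r t = r^{-1}$.\<close>

definition dihedral_group :: "nat \<Rightarrow> (int \<times> bool) monoid" where
  "dihedral_group n =
     \<lparr>carrier = {0..<int n} \<times> UNIV,
      monoid.mult = (\<lambda>(a, s) (b, t). ((if s then a - b else a + b) mod int n, s \<noteq> t)),
      one = (0, False)\<rparr>"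

definition rotation :: "nat \<Rightarrow> sphere \<Rightarrow> sphere" where
  "rotation n = moebius (cis (2 * pi / real n)) 0 0 1"

definition inversion :: "sphere \<Rightarrow> sphere" where
  "inversion = moebius 0 1 1 0"

text \<open>Neither matrix above has determinant 1, but both maps lie in \<^const>\<open>moebius_group\<close>: scale
  the first matrix by $e^{-\pi i/n}$ and the second by $i$. So \<^const>\<open>subgroup_generated\<close>, which
  discards generators outside the carrier, discards nothing.\<close>

definition G_group :: "nat \<Rightarrow> (sphere \<Rightarrow> sphere) monoid" where
  "G_group n = subgroup_generated moebius_group {rotation n, inversion}"

definition G_orbits :: "nat \<Rightarrow> sphere set set" where
  "G_orbits n = orbits (G_group n) UNIV (\<lambda>g. g)"

definition finite_union_of_orbits :: "nat \<Rightarrow> sphere set \<Rightarrow> bool" where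
  "finite_union_of_orbits n \<alpha> \<longleftrightarrow> (\<exists>\<O>. finite \<O> \<and> \<O> \<subseteq> G_orbits n \<and> \<alpha> = \<Union>\<O>)"

definition V_orbit :: "sphere set" where
  "V_orbit = {Some 0, None}"

definition A_orbit :: "nat \<Rightarrow> sphere set" where
  "A_orbit n = {Some (cis (real_of_int j / real n * (2 * pi))) | j :: int. True}"

definition B_orbit :: "nat \<Rightarrow> sphere set" where
  "B_orbit n = {Some (cis ((2 * real_of_int j + 1) / (2 * real n) * (2 * pi))) | j :: int. True}"

definition C_orbit :: "nat \<Rightarrow> complex \<Rightarrow> sphere set" where
  "C_orbit n z = {Some (z * cis (real_of_int j / real n * (2 * pi))) | j :: int. True}
               \<union> {Some (inverse z * cis (real_of_int j / real n * (2 * pi))) | j :: int. True}"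

definition C_orbits :: "nat \<Rightarrow> sphere set set" where
  "C_orbits n =
     {C_orbit n z | z. z \<noteq> 0 \<and> z \<notin> {cis (real_of_int l / (2 * real n) * (2 * pi)) | l :: int. True}}"

definition dihedral_index :: "nat \<Rightarrow> sphere set \<Rightarrow> nat \<times> nat \<times> nat" where
  "dihedral_index n \<alpha> =
     (card {\<omega> \<in> {V_orbit}. \<omega> \<subseteq> \<alpha>},
      card {\<omega> \<in> {A_orbit n, B_orbit n}. \<omega> \<subseteq> \<alpha>},
      card {\<omega> \<in> C_orbits n. \<omega> \<subseteq> \<alpha>})"

text \<open>The index for $n = 2$, where $V$, $A_2$ and $B_2$ are counted together.\<close>

definition dihedral_index_2 :: "sphere set \<Rightarrow> nat \<times> nat" where
  "dihedral_index_2 \<alpha> =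
     (card {\<omega> \<in> {V_orbit, A_orbit 2, B_orbit 2}. \<omega> \<subseteq> \<alpha>},
      card {\<omega> \<in> C_orbits 2. \<omega> \<subseteq> \<alpha>})"

definition dihedral_sets :: "nat \<Rightarrow> nat \<times> nat \<times> nat \<Rightarrow> sphere set set" where
  "dihedral_sets n i =
     {\<alpha>. finite \<alpha> \<and> symmetry_group \<alpha> \<cong> dihedral_group n \<and>
         finite_union_of_orbits n \<alpha> \<and> dihedral_index n \<alpha> = i}"

definition dihedral_sets_2 :: "nat \<times> nat \<Rightarrow> sphere set set" where
  "dihedral_sets_2 i =
     {\<alpha>. finite \<alpha> \<and> symmetry_group \<alpha> \<cong> dihedral_group 2 \<and>
         finite_union_of_orbits 2 \<alpha> \<and> dihedral_index_2 \<alpha> = i}"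

end

theory Submission
  imports Defs "HOL-Computational_Algebra.Polynomial"
begin

text \<open>
  The group \<open>G\<close> consists of the maps \<open>z \<mapsto> wz\<close> and \<open>z \<mapsto> w/z\<close> with \<open>w\<^sup>n = 1\<close>. Its orbits other than
  \<open>V\<close> are the sets where \<open>z\<^sup>n\<close> is \<open>u\<close> or \<open>1/u\<close>: they have \<open>n\<close> points for \<open>u = 1\<close> and \<open>u = -1\<close>, and \<open>2n\<close> points
  otherwise. So a union of orbits has \<open>2\<nu> + n(\<epsilon> + 2k)\<close> points, and the question is which unions have no
  symmetries besides \<open>G\<close>.

  Too many symmetries. In \<open>D\<^sub>n\<close> every element satisfies \<open>g\<^sup>2 = 1\<close> or \<open>g\<^sup>n = 1\<close>. For each of the excluded
  indices some symmetry satisfies neither: a rotation by half a step if both polygons \<open>A\<^sub>n\<close> and \<open>B\<^sub>n\<close> are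
  present, a rotation of order 3 for the octahedra \<open>V \<union> A\<^sub>4\<close> and \<open>V \<union> B\<^sub>4\<close>, and a quarter turn of a square or a map of
  infinite order for the small sets with \<open>n = 2\<close> (\<open>no_generic_orbit_dihedral\<close>).

  Polygons and bipyramids. Let \<open>z \<mapsto> (az+b)/(cz+d)\<close> permute the zeros of \<open>z\<^sup>n - 1\<close>, or of \<open>z\<^sup>n\<^sup>+\<^sup>1 - z\<close>
  together with infinity. Substituting the map into this form reproduces it up to a factor; the
  coefficients that have to vanish show that the matrix is diagonal or antidiagonal, except for the
  octahedron (\<open>symmetry_A_orbit\<close>, \<open>symmetry_bipyramid\<close>).

  Sets with a generic orbit. One of the orbits of type \<open>C\<^sub>n\<close> is chosen as \<open>z\<^sup>n = t\<^sup>n\<close>, \<open>z\<^sup>n = t\<^sup>-\<^sup>n\<close> with tiny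
  \<open>t\<close>. The set then has a cluster at 0 and a cluster at infinity, and its other points stay apart.
  Cross-ratios of two points in one cluster with two points in the other are of order \<open>t\<^sup>2\<close>, all others
  are much larger, and a Moebius map preserves cross-ratios; so a symmetry permutes the two clusters
  (\<open>clusters_permuted\<close>). A map that preserves both clusters is a rotation in \<open>G\<close>: if the clusters are
  bare polygons, by comparing coefficients for the two polygons at once, and if they contain their centres
  0 and infinity, because the centre is the mean of its cluster and the map is nearly affine there
  (\<open>cluster_preserving_in_dihedral_maps\<close>). This gives every index with \<open>k \<ge> 1\<close>
  (\<open>exists_exactly_dihedral\<close>).

  Cardinalities. If the symmetry group of a finite set is isomorphic to \<open>D\<^sub>n\<close>, then a Moebius map moves
  the fixed points of an element of order \<open>n\<close> to 0 and infinity and makes a reflection the inversion.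
  The set becomes a union of \<open>G\<close>-orbits of the same cardinality (\<open>dihedral_normal_form\<close>), so the possible
  cardinalities are the values of \<open>2\<nu> + n(\<epsilon> + 2k)\<close> on the indices that occur.
\<close>

section \<open>Moebius maps in homogeneous coordinates\<close>

text \<open>In homogeneous coordinates a Moebius map is multiplication by a matrix, so the case distinctions at
  infinity disappear from compositions.\<close>

definition from_homogeneous :: "complex \<Rightarrow> complex \<Rightarrow> sphere" where
  "from_homogeneous x y = (if y = 0 then None else Some (x / y))"

definition hom_x :: "sphere \<Rightarrow> complex" where
  "hom_x p = (case p of None \<Rightarrow> 1 | Some z \<Rightarrow> z)"

definition hom_y :: "sphere \<Rightarrow> complex" where
  "hom_y p = (case p of None \<Rightarrow> 0 | Some z \<Rightarrow> 1)"

lemma hom_simps [simp]: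
  "hom_x None = 1" "hom_y None = 0" "hom_x (Some z) = z" "hom_y (Some z) = 1"
  by (simp_all add: hom_x_def hom_y_def)

lemma hom_nonzero: "hom_x p \<noteq> 0 \<or> hom_y p \<noteq> 0"
  by (cases p) auto

lemma from_homogeneous_eq_iff:
  assumes "x \<noteq> 0 \<or> y \<noteq> 0" "x' \<noteq> 0 \<or> y' \<noteq> 0"
  shows "from_homogeneous x y = from_homogeneous x' y' \<longleftrightarrow> x * y' = x' * y"
  using assms by (auto simp: from_homogeneous_def field_simps)

lemma nonsingular_apply:
  fixes a b c d x y :: complex
  assumes "a * d - b * c \<noteq> 0" "x \<noteq> 0 \<or> y \<noteq> 0"
  shows "a * x + b * y \<noteq> 0 \<or> c * x + d * y \<noteq> 0"
proof (rule ccontr)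
  assume "\<not> ?thesis"
  then have z: "a * x + b * y = 0" "c * x + d * y = 0" by auto
  have "(a * d - b * c) * x = d * (a * x + b * y) - b * (c * x + d * y)"
    and "(a * d - b * c) * y = a * (c * x + d * y) - c * (a * x + b * y)"
    by (auto simp: algebra_simps)
  with z assms show False by simp
qed

lemma moebius_eq:
  assumes "a * d - b * c \<noteq> 0"
  shows "moebius a b c d p
    = from_homogeneous (a * hom_x p + b * hom_y p) (c * hom_x p + d * hom_y p)"
  by (cases p) (auto simp: moebius_def from_homogeneous_def)

lemma moebius_from_homogeneous:
  assumes "a * d - b * c \<noteq> 0" "x \<noteq> 0 \<or> y \<noteq> 0"
  shows "moebius a b c d (from_homogeneous x y) = from_homogeneous (a * x + b * y) (c * x + d * y)"
proof -
  let ?p = "from_homogeneous x y"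
  have e: "x * hom_y ?p = hom_x ?p * y"
    by (auto simp: from_homogeneous_def)
  have "moebius a b c d ?p
    = from_homogeneous (a * hom_x ?p + b * hom_y ?p) (c * hom_x ?p + d * hom_y ?p)"
    by (rule moebius_eq) fact
  also have "\<dots> = from_homogeneous (a * x + b * y) (c * x + d * y)"
  proof (subst from_homogeneous_eq_iff)
    show "a * hom_x ?p + b * hom_y ?p \<noteq> 0 \<or> c * hom_x ?p + d * hom_y ?p \<noteq> 0"
      by (rule nonsingular_apply[OF assms(1) hom_nonzero])
    show "a * x + b * y \<noteq> 0 \<or> c * x + d * y \<noteq> 0"
      by (rule nonsingular_apply[OF assms])
    have "(a * hom_x ?p + b * hom_y ?p) * (c * x + d * y)
        - (a * x + b * y) * (c * hom_x ?p + d * hom_y ?p)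
        = (a * d - b * c) * (hom_x ?p * y - x * hom_y ?p)"
      by (simp add: algebra_simps)
    also have "\<dots> = 0" using e by simp
    finally show "(a * hom_x ?p + b * hom_y ?p) * (c * x + d * y)
        = (a * x + b * y) * (c * hom_x ?p + d * hom_y ?p)" by simp
  qed
  finally show ?thesis .
qed

lemma det_mult:
  fixes a b c d e f g h :: complex
  shows "(a * e + b * g) * (c * f + d * h) - (a * f + b * h) * (c * e + d * g) = (a * d - b * c) * (e * h - f * g)"
  by (simp add: algebra_simps)

lemma moebius_comp:
  assumes "a * d - b * c \<noteq> 0" "e * h - f * g \<noteq> 0"
  shows "moebius a b c d \<circ> moebius e f g h = moebius (a * e + b * g) (a * f + b * h) (c * e + d * g) (c * f + d * h)"
proof
  fix p
  have n: "(a * e + b * g) * (c * f + d * h) - (a * f + b * h) * (c * e + d * g) \<noteq> 0"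
    using assms by (simp add: det_mult)
  show "(moebius a b c d \<circ> moebius e f g h) p
      = moebius (a * e + b * g) (a * f + b * h) (c * e + d * g) (c * f + d * h) p"
    unfolding o_def moebius_eq[OF assms(2)]
    by (subst moebius_from_homogeneous[OF assms(1) nonsingular_apply[OF assms(2) hom_nonzero]],
        subst moebius_eq[OF n]) (simp add: algebra_simps)
qed

lemma moebius_scale:
  assumes "l \<noteq> 0"
  shows "moebius (l * a) (l * b) (l * c) (l * d) = moebius a b c d"
proof
  fix p
  have *: "l * a * z + l * b = l * (a * z + b)" for a b z by (simp add: algebra_simps)
  show "moebius (l * a) (l * b) (l * c) (l * d) p = moebius a b c d p"
    using assms by (cases p) (auto simp: moebius_def *)
qed

lemma moebius_one: "moebius 1 0 0 1 = id"
  by (rule ext) (auto simp: moebius_def split: option.split)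

lemma moebius_diag: "k \<noteq> 0 \<Longrightarrow> moebius k 0 0 k = id"
  using moebius_scale[of k 1 0 0 1] by (simp add: moebius_one)

lemma moebius_inverse:
  assumes "a * d - b * c \<noteq> 0"
  shows "moebius d (-b) (-c) a \<circ> moebius a b c d = id"
    and "moebius a b c d \<circ> moebius d (-b) (-c) a = id"
proof -
  have n: "d * a - (-b) * (-c) \<noteq> 0" using assms by (simp add: algebra_simps)
  show "moebius d (-b) (-c) a \<circ> moebius a b c d = id"
    using moebius_comp[OF n assms] moebius_diag[OF assms] by (simp add: algebra_simps)
  show "moebius a b c d \<circ> moebius d (-b) (-c) a = id"
    using moebius_comp[OF assms n] moebius_diag[OF assms] by (simp add: algebra_simps)
qed

abbreviation is_moebius :: "(sphere \<Rightarrow> sphere) \<Rightarrow> bool" where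
  "is_moebius f \<equiv> f \<in> carrier moebius_group"

text \<open>Every invertible matrix can be rescaled to determinant 1, so concrete maps may be given by any
  invertible matrix.\<close>

lemma is_moebiusI:
  assumes "a * d - b * c \<noteq> 0"
  shows "is_moebius (moebius a b c d)"
proof -
  define s where "s = csqrt (a * d - b * c)"
  have s: "s \<noteq> 0" "s * s = a * d - b * c"
    using assms by (auto simp: s_def simp flip: power2_eq_square)
  have "moebius a b c d = moebius (inverse s * a) (inverse s * b) (inverse s * c) (inverse s * d)"
    using s by (subst moebius_scale) auto
  moreover have "inverse s * a * (inverse s * d) - inverse s * b * (inverse s * c) = 1"
  proof -
    have "inverse s * a * (inverse s * d) - inverse s * b * (inverse s * c)
        = (a * d - b * c) / (s * s)"
      by (simp add: field_simps diff_divide_distrib)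
    then show ?thesis using s assms by simp
  qed
  ultimately show ?thesis unfolding moebius_group_def by fastforce
qed

lemma is_moebiusE:
  assumes "is_moebius f"
  obtains a b c d where "f = moebius a b c d" "a * d - b * c = 1"
  using assms unfolding moebius_group_def by auto

lemma moebius_group_sel [simp]:
  "monoid.mult moebius_group = (\<circ>)" "one moebius_group = id"
  by (simp_all add: moebius_group_def)

lemma is_moebius_id [simp]: "is_moebius id"
  using is_moebiusI[of 1 1 0 0] by (simp add: moebius_one)

lemma is_moebius_comp:
  assumes "is_moebius f" "is_moebius g"
  shows "is_moebius (f \<circ> g)"
proof -
  obtain a b c d where f: "f = moebius a b c d" "a * d - b * c = 1"
    using assms(1) by (rule is_moebiusE)
  obtain a' b' c' d' where g: "g = moebius a' b' c' d'" "a' * d' - b' * c' = 1"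
    using assms(2) by (rule is_moebiusE)
  have "f \<circ> g = moebius (a * a' + b * c') (a * b' + b * d') (c * a' + d * c') (c * b' + d * d')"
    unfolding f(1) g(1) by (rule moebius_comp) (use f g in auto)
  moreover have "(a * a' + b * c') * (c * b' + d * d') - (a * b' + b * d') * (c * a' + d * c') \<noteq> 0"
    using f(2) g(2) by (simp add: det_mult)
  ultimately show ?thesis by (simp add: is_moebiusI)
qed

lemma is_moebius_inverse:
  assumes "is_moebius f"
  obtains g where "is_moebius g" "g \<circ> f = id" "f \<circ> g = id"
proof -
  obtain a b c d where f: "f = moebius a b c d" "a * d - b * c = 1"
    using assms by (rule is_moebiusE)
  have n: "a * d - b * c \<noteq> 0" using f by simp
  have "is_moebius (moebius d (-b) (-c) a)"
    by (rule is_moebiusI) (use f in \<open>simp add: algebra_simps\<close>)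
  then show ?thesis using that moebius_inverse[OF n] f(1) by blast
qed

lemma group_moebius: "group moebius_group"
proof (rule groupI)
  show "\<exists>y\<in>carrier moebius_group. y \<otimes>\<^bsub>moebius_group\<^esub> x = \<one>\<^bsub>moebius_group\<^esub>"
    if "x \<in> carrier moebius_group" for x
    using is_moebius_inverse[OF that] by (metis moebius_group_sel)
qed (simp_all add: is_moebius_comp comp_assoc)

lemma is_moebius_bij: "is_moebius f \<Longrightarrow> bij f"
  using is_moebius_inverse by (metis o_bij)

lemma is_moebius_inj: "is_moebius f \<Longrightarrow> inj f"
  by (simp add: is_moebius_bij bij_is_inj)

lemma carrier_symmetry_group:
  "f \<in> carrier (symmetry_group \<alpha>) \<longleftrightarrow> is_moebius f \<and> f ` \<alpha> = \<alpha>"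
  by (simp add: symmetry_group_def)

lemma symmetry_group_sel [simp]:
  "monoid.mult (symmetry_group \<alpha>) = (\<circ>)" "one (symmetry_group \<alpha>) = id"
  by (simp_all add: symmetry_group_def moebius_group_def)

lemma group_symmetry: "group (symmetry_group \<alpha>)"
proof (rule groupI)
  show "\<exists>y\<in>carrier (symmetry_group \<alpha>). y \<otimes>\<^bsub>symmetry_group \<alpha>\<^esub> x = \<one>\<^bsub>symmetry_group \<alpha>\<^esub>"
    if "x \<in> carrier (symmetry_group \<alpha>)" for x
  proof -
    have x: "is_moebius x" "x ` \<alpha> = \<alpha>" using that by (auto simp: carrier_symmetry_group)
    obtain y where y: "is_moebius y" "y \<circ> x = id" using is_moebius_inverse[OF x(1)] by blast
    have "y ` \<alpha> = (y \<circ> x) ` \<alpha>" using x(2) by (metis image_comp)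
    then show ?thesis using y by (auto simp: carrier_symmetry_group)
  qed
qed (auto simp: carrier_symmetry_group is_moebius_comp comp_assoc image_comp[symmetric] simp del: o_apply)

text \<open>On a finite set, an injective map into the set is onto; this is how concrete symmetries are
  checked.\<close>

lemma symmetryI:
  assumes "is_moebius f" "finite \<alpha>" "f ` \<alpha> \<subseteq> \<alpha>"
  shows "f \<in> carrier (symmetry_group \<alpha>)"
  using assms endo_inj_surj[OF assms(2,3)] is_moebius_inj[OF assms(1)]
  by (auto simp: carrier_symmetry_group inj_on_subset)

section \<open>The dihedral group and its action on the sphere\<close>

lemma dihedral_group_sel:
  "(a, s) \<otimes>\<^bsub>dihedral_group n\<^esub> (b, t) = ((if s then a - b else a + b) mod int n, s \<noteq> t)"
  "\<one>\<^bsub>dihedral_group n\<^esub> = (0, False)"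
  "(a, s) \<in> carrier (dihedral_group n) \<longleftrightarrow> 0 \<le> a \<and> a < int n"
  by (auto simp: dihedral_group_def)

lemma group_dihedral:
  assumes "n \<ge> 1"
  shows "group (dihedral_group n)"
proof (rule groupI)
  fix x y z
  show "x \<otimes>\<^bsub>dihedral_group n\<^esub> y \<in> carrier (dihedral_group n)"
    by (cases x; cases y) (use assms in \<open>auto simp: dihedral_group_sel\<close>)
  show "x \<otimes>\<^bsub>dihedral_group n\<^esub> y \<otimes>\<^bsub>dihedral_group n\<^esub> z
      = x \<otimes>\<^bsub>dihedral_group n\<^esub> (y \<otimes>\<^bsub>dihedral_group n\<^esub> z)"
    by (cases x; cases y; cases z) (auto simp: dihedral_group_sel mod_simps algebra_simps)
next
  fix x assume x: "x \<in> carrier (dihedral_group n)"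
  obtain a s where as: "x = (a, s)" by (cases x)
  show "\<one>\<^bsub>dihedral_group n\<^esub> \<otimes>\<^bsub>dihedral_group n\<^esub> x = x"
    using x by (auto simp: as dihedral_group_sel)
  have "(if s then a else (- a) mod int n, s) \<in> carrier (dihedral_group n)"
    using x assms by (auto simp: as dihedral_group_sel)
  moreover have "(if s then a else (- a) mod int n, s) \<otimes>\<^bsub>dihedral_group n\<^esub> x = \<one>\<^bsub>dihedral_group n\<^esub>"
    by (auto simp: as dihedral_group_sel mod_simps)
  ultimately show "\<exists>y\<in>carrier (dihedral_group n). y \<otimes>\<^bsub>dihedral_group n\<^esub> x = \<one>\<^bsub>dihedral_group n\<^esub>"
    by blast
qed (use assms in \<open>auto simp: dihedral_group_sel\<close>)

lemma dihedral_rotation_power: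
  "(a, False) [^]\<^bsub>dihedral_group n\<^esub> (k::nat) = ((int k * a) mod int n, False)"
  by (induction k) (auto simp: dihedral_group_sel mod_simps algebra_simps nat_pow_def)

lemma funpow_nat_pow: "f [^]\<^bsub>symmetry_group \<alpha>\<^esub> (k::nat) = f ^^ k"
  by (induction k) (auto simp: nat_pow_def funpow_swap1)

lemma funpow_symmetry:
  "f \<in> carrier (symmetry_group \<alpha>) \<Longrightarrow> f ^^ k \<in> carrier (symmetry_group \<alpha>)"
  using monoid.nat_pow_closed[OF group.is_monoid[OF group_symmetry], of f \<alpha> k]
  by (simp add: funpow_nat_pow)

text \<open>In \<open>D\<^sub>n\<close> a reflection has order 2 and a rotation has order dividing \<open>n\<close>. All non-existence
  results come from a symmetry that satisfies neither equation.\<close>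

lemma dihedral_symmetry_exponent:
  assumes "n \<ge> 1" "symmetry_group \<alpha> \<cong> dihedral_group n" "f \<in> carrier (symmetry_group \<alpha>)"
  shows "f \<circ> f = id \<or> f ^^ n = id"
proof -
  let ?S = "symmetry_group \<alpha>" and ?D = "dihedral_group n"
  interpret S: group ?S by (rule group_symmetry)
  interpret D: group ?D by (rule group_dihedral) fact
  obtain h where h: "h \<in> iso ?S ?D" using assms(2) by (auto simp: is_iso_def)
  have hom: "h \<in> hom ?S ?D" and inj: "inj_on h (carrier ?S)"
    using h by (auto simp: iso_def bij_betw_def)
  interpret hom: group_hom ?S ?D h
    by unfold_locales (rule hom)
  obtain a s where hf: "h f = (a, s)" by (cases "h f")
  have "h (f \<circ> f) = h id \<or> h (f ^^ n) = h id"
  proof (cases s)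
    case True
    have "h (f \<circ> f) = h f \<otimes>\<^bsub>?D\<^esub> h f"
      using hom.hom_mult[OF assms(3) assms(3)] by simp
    also have "\<dots> = h id" using hom.hom_one True by (simp add: hf dihedral_group_sel)
    finally show ?thesis ..
  next
    case False
    have "h (f ^^ n) = h f [^]\<^bsub>?D\<^esub> n"
      using hom.hom_nat_pow[OF assms(3)] by (simp add: funpow_nat_pow)
    also have "\<dots> = h id"
      using hom.hom_one False by (simp add: hf dihedral_rotation_power dihedral_group_sel)
    finally show ?thesis ..
  qed
  moreover have "f \<circ> f \<in> carrier ?S" "f ^^ n \<in> carrier ?S" "id \<in> carrier ?S"
    using S.m_closed[OF assms(3) assms(3)] funpow_symmetry[OF assms(3)] S.one_closed by simp_all
  ultimately show ?thesis using inj by (auto dest: inj_onD)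
qed

abbreviation rot :: "complex \<Rightarrow> sphere \<Rightarrow> sphere" where
  "rot w \<equiv> moebius w 0 0 1"

abbreviation flip :: "complex \<Rightarrow> sphere \<Rightarrow> sphere" where
  "flip w \<equiv> moebius 0 w 1 0"

lemma flip_apply:
  "flip w None = Some 0" "flip w (Some z) = (if z = 0 then None else Some (w / z))"
  by (auto simp: moebius_def)

lemma rot_Some: "rot w (Some z) = Some (w * z)" and rot_None: "rot w None = None"
  by (auto simp: moebius_def)

lemmas rot_flip_apply = rot_Some rot_None flip_apply

lemma rot_flip_comp:
  assumes "w \<noteq> 0" "v \<noteq> 0"
  shows "rot w \<circ> rot v = rot (w * v)" "rot w \<circ> flip v = flip (w * v)"
    "flip w \<circ> rot v = flip (w / v)" "flip w \<circ> flip v = rot (w / v)"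
  using assms by (auto simp: fun_eq_iff rot_flip_apply split_option_all field_simps)

lemma rot_one: "rot 1 = id"
  by (rule moebius_one)

lemma rot_flip_eq_iff:
  "rot w = rot v \<longleftrightarrow> w = v" "flip w = flip v \<longleftrightarrow> w = v" "rot w \<noteq> flip v"
proof -
  have *: "rot w (Some 1) = Some w" "flip w (Some 1) = Some w" for w
    by (auto simp: rot_flip_apply)
  show "rot w = rot v \<longleftrightarrow> w = v" "flip w = flip v \<longleftrightarrow> w = v"
    using * by (metis option.inject)+
  have "rot w None = None" "flip v None = Some 0" by (simp_all add: rot_flip_apply)
  then show "rot w \<noteq> flip v" by (metis option.distinct(1))
qed

lemma is_moebius_rot_flip: "w \<noteq> 0 \<Longrightarrow> is_moebius (rot w)" "w \<noteq> 0 \<Longrightarrow> is_moebius (flip w)"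
  by (auto intro: is_moebiusI)

lemma rotation_eq: "rotation n = rot (cis (2 * pi / real n))"
  by (simp add: rotation_def)

lemma inversion_eq: "inversion = flip 1"
  by (simp add: inversion_def)

text \<open>The group \<open>G\<close> written out; roots of unity are described by \<open>w\<^sup>n = 1\<close> instead of by angles, which
  turns statements about orbits into statements about \<open>n\<close>-th powers.\<close>

definition dihedral_maps :: "nat \<Rightarrow> (sphere \<Rightarrow> sphere) set" where
  "dihedral_maps n = {rot w | w. w ^ n = 1} \<union> {flip w | w. w ^ n = 1}"

lemma root_of_unity_nonzero: "n \<ge> 1 \<Longrightarrow> w ^ n = 1 \<Longrightarrow> w \<noteq> (0::complex)"
  by (auto simp: power_0_left)

text \<open>The number on the left is the multiplier of the generating rotation; its first \<open>n\<close> powers run once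
  through the \<open>n\<close>-th roots of unity.\<close>

lemma primitive_root:
  assumes "n \<ge> 1"
  shows "cis (2 * pi / real n) ^ n = 1"
    and "w ^ n = 1 \<Longrightarrow> \<exists>k<n. w = cis (2 * pi / real n) ^ k"
    and "inj_on ((^) (cis (2 * pi / real n))) {..<n}"
proof -
  have e: "cis (2 * pi * real k / real n) = cis (2 * pi / real n) ^ k" for k
    by (simp add: DeMoivre mult_ac)
  have b: "bij_betw ((^) (cis (2 * pi / real n))) {..<n} {z::complex. z ^ n = 1}"
    using bij_betw_roots_unity[of n] assms by (simp add: e)
  show "cis (2 * pi / real n) ^ n = 1" using assms by (simp add: DeMoivre)
  show "\<exists>k<n. w = cis (2 * pi / real n) ^ k" if "w ^ n = 1"
    using b that unfolding bij_betw_def by (metis (mono_tags, lifting) imageE lessThan_iff mem_Collect_eq)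
  show "inj_on ((^) (cis (2 * pi / real n))) {..<n}"
    using b by (simp add: bij_betw_def)
qed

lemma dihedral_maps_comp:
  assumes "n \<ge> 1" "f \<in> dihedral_maps n" "g \<in> dihedral_maps n"
  shows "f \<circ> g \<in> dihedral_maps n"
  using assms root_of_unity_nonzero[OF assms(1)]
  by (auto simp: dihedral_maps_def rot_flip_comp power_mult_distrib power_divide)

lemma dihedral_maps_inv:
  assumes "n \<ge> 1" "f \<in> dihedral_maps n"
  obtains g where "g \<in> dihedral_maps n" "g \<circ> f = id" "f \<circ> g = id"
proof -
  have "\<exists>g\<in>dihedral_maps n. g \<circ> f = id \<and> f \<circ> g = id"
    using assms(2) unfolding dihedral_maps_def
  proof (elim UnE; clarify)
    fix w :: complex assume w: "w ^ n = 1"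
    then have "w \<noteq> 0" by (rule root_of_unity_nonzero[OF assms(1)])
    then show "\<exists>g\<in>{rot w |w. w ^ n = 1} \<union> {flip w |w. w ^ n = 1}.
        g \<circ> rot w = id \<and> rot w \<circ> g = id"
      by (intro bexI[of _ "rot (inverse w)"]) (auto simp: rot_flip_comp rot_one w power_inverse)
    show "\<exists>g\<in>{rot w |w. w ^ n = 1} \<union> {flip w |w. w ^ n = 1}.
        g \<circ> flip w = id \<and> flip w \<circ> g = id"
      using w \<open>w \<noteq> 0\<close> by (intro bexI[of _ "flip w"]) (auto simp: rot_flip_comp rot_one)
  qed
  then show ?thesis using that by blast
qed

lemma dihedral_maps_moebius: "n \<ge> 1 \<Longrightarrow> f \<in> dihedral_maps n \<Longrightarrow> is_moebius f"
  using root_of_unity_nonzero by (auto simp: dihedral_maps_def intro!: is_moebius_rot_flip)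

lemma generators_in_dihedral_maps:
  "n \<ge> 1 \<Longrightarrow> rotation n \<in> dihedral_maps n" "inversion \<in> dihedral_maps n"
  using primitive_root(1)[of n] by (auto simp: dihedral_maps_def rotation_eq inversion_eq)

lemma carrier_G_group:
  assumes n: "n \<ge> 1"
  shows "carrier (G_group n) = dihedral_maps n"
proof -
  interpret group moebius_group by (rule group_moebius)
  let ?gen = "generate moebius_group {rotation n, inversion}"
  let ?w = "cis (2 * pi / real n)"
  have carrier: "carrier (G_group n) = ?gen"
    using generators_in_dihedral_maps dihedral_maps_moebius n
    by (simp add: G_group_def carrier_subgroup_generated Int_absorb1)
  have "f \<in> dihedral_maps n" if "f \<in> ?gen" for f
    using that
  proof induction
    case one
    show ?case using rot_one by (auto simp: dihedral_maps_def intro!: exI[of _ 1])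
  next
    case (incl h)
    then show ?case using generators_in_dihedral_maps[of n] n by auto
  next
    case (inv h)
    then have h: "h \<in> dihedral_maps n" using generators_in_dihedral_maps[of n] n by auto
    obtain g where g: "g \<in> dihedral_maps n" "g \<circ> h = id"
      using dihedral_maps_inv[OF n h] by blast
    have "inv\<^bsub>moebius_group\<^esub> h = g"
      by (rule inv_equality) (use g h dihedral_maps_moebius[OF n] in auto)
    then show ?case using g by simp
  next
    case (eng h1 h2)
    then show ?case using dihedral_maps_comp[OF n] by (simp only: moebius_group_sel)
  qed
  moreover have "f \<in> ?gen" if "f \<in> dihedral_maps n" for f
  proof -
    have rotation: "rot (?w ^ k) \<in> ?gen" for k
    proof (induction k)
      case 0
      show ?case using generate.one[of moebius_group] by (simp only: moebius_group_sel power_0 rot_one)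
    next
      case (Suc k)
      have "rotation n \<circ> rot (?w ^ k) \<in> ?gen"
        using generate.eng[OF generate.incl Suc, of "rotation n"] by simp
      then show ?case by (simp add: rotation_eq rot_flip_comp)
    qed
    have flips: "flip (?w ^ k) \<in> ?gen" for k
    proof -
      have "rot (?w ^ k) \<circ> inversion \<in> ?gen"
        using generate.eng[OF rotation generate.incl, of inversion] by simp
      then show ?thesis by (simp add: inversion_eq rot_flip_comp)
    qed
    show ?thesis
      using that unfolding dihedral_maps_def
      by (elim UnE CollectE exE conjE) (metis rotation flips primitive_root(2)[OF n])+
  qed
  ultimately show ?thesis using carrier by auto
qed

lemma symmetry_group_dihedralI:
  assumes n: "n \<ge> 1" and eq: "carrier (symmetry_group \<alpha>) = dihedral_maps n"
  shows "symmetry_group \<alpha> \<cong> dihedral_group n"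
proof -
  let ?D = "dihedral_group n" and ?S = "symmetry_group \<alpha>"
  define w where "w = cis (2 * pi / real n)"
  have w0: "w \<noteq> 0" by (simp add: w_def)
  have wn: "w ^ n = 1" using primitive_root(1)[OF n] by (simp add: w_def)
  have mod: "w powi (a mod int n) = w powi a" for a
  proof -
    have "w powi a = w powi (int n * (a div int n) + a mod int n)" by simp
    also have "\<dots> = (w powi int n) powi (a div int n) * w powi (a mod int n)"
      by (subst power_int_add) (use w0 in \<open>auto simp only: power_int_mult\<close>)
    also have "w powi int n = 1" using wn by simp
    finally show ?thesis by simp
  qed
  define h where "h = (\<lambda>(a::int, s). if s then flip (w powi a) else rot (w powi a))"
  have wa: "w powi a \<noteq> 0" "(w powi a) ^ n = 1" for a
  proof -
    show "w powi a \<noteq> 0" using w0 by simp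
    have "(w powi a) ^ n = (w powi int n) powi a"
      by (metis mult.commute power_int_mult power_int_of_nat)
    then show "(w powi a) ^ n = 1" using wn by simp
  qed
  have h_maps: "h x \<in> dihedral_maps n" for x
    using wa by (cases x) (auto simp: h_def dihedral_maps_def)
  have "h \<in> hom ?D ?S"
  proof (rule homI)
    fix x y assume "x \<in> carrier ?D" "y \<in> carrier ?D"
    show "h x \<in> carrier ?S"
      unfolding eq by (rule h_maps)
    show "h (x \<otimes>\<^bsub>?D\<^esub> y) = h x \<otimes>\<^bsub>?S\<^esub> h y"
      by (cases x; cases y)
         (auto simp: h_def dihedral_group_sel mod rot_flip_comp w0 power_int_add power_int_diff)
  qed
  moreover have "bij_betw h (carrier ?D) (carrier ?S)"
    unfolding bij_betw_def
  proof
    have inj: "a = b" if "w powi a = w powi b" "0 \<le> a" "a < int n" "0 \<le> b" "b < int n" for a b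
    proof -
      have "w ^ nat a = w ^ nat b" using that by (simp add: power_int_def)
      then have "nat a = nat b"
        using primitive_root(3)[OF n] that by (auto simp: w_def inj_on_def)
      then show ?thesis using that by simp
    qed
    show "inj_on h (carrier ?D)"
      by (rule inj_onI)
         (auto simp: h_def dihedral_group_sel rot_flip_eq_iff rot_flip_eq_iff(3)[symmetric] inj
               split: if_splits)
    have "f \<in> h ` carrier ?D" if "f \<in> dihedral_maps n" for f
    proof -
      obtain v s where v: "v ^ n = 1" "f = (if s then flip v else rot v)"
      proof -
        consider v where "v ^ n = 1" "f = rot v" | v where "v ^ n = 1" "f = flip v"
          using that \<open>f \<in> dihedral_maps n\<close> by (auto simp: dihedral_maps_def)
        then show ?thesis using that[of _ True] that[of _ False] by cases auto
      qed
      obtain k where "k < n" "v = w ^ k" using primitive_root(2)[OF n v(1)] by (auto simp: w_def)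
      then have "f = h (int k, s)" "(int k, s) \<in> carrier ?D"
        by (auto simp: h_def v dihedral_group_sel)
      then show ?thesis by blast
    qed
    moreover have "h ` carrier ?D \<subseteq> dihedral_maps n"
      using h_maps by blast
    ultimately show "h ` carrier ?D = carrier ?S" unfolding eq by blast
  qed
  ultimately have "?D \<cong> ?S" by (auto simp: is_iso_def iso_def)
  then show ?thesis using group.iso_sym[OF group_dihedral[OF n]] by blast
qed

section \<open>Orbits\<close>

text \<open>The map \<open>z \<mapsto> z\<^sup>n\<close> identifies the orbits of the rotations in \<open>G\<close>, and the flips exchange the levels
  \<open>u\<close> and \<open>1/u\<close>. The orbits outside \<open>{0, \<infinity>}\<close> are therefore these sets with \<open>u \<noteq> 0\<close>; the two fixed levels
  \<open>u = 1\<close> and \<open>u = -1\<close> give the short orbits \<open>A\<^sub>n\<close> and \<open>B\<^sub>n\<close>.\<close>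

definition level_set :: "nat \<Rightarrow> complex \<Rightarrow> sphere set" where
  "level_set n u = Some ` {w. w ^ n = u \<or> w ^ n = inverse u}"

lemma cis_multiples_eq_roots_of_unity:
  assumes "m \<ge> 1"
  shows "{cis (real_of_int j / real m * (2 * pi)) | j :: int. True} = {w. w ^ m = 1}"
proof (intro equalityI subsetI)
  fix w assume "w \<in> {cis (real_of_int j / real m * (2 * pi)) | j :: int. True}"
  then obtain j :: int where "w = cis (real_of_int j / real m * (2 * pi))" by blast
  then have "w ^ m = cis (2 * pi * real_of_int j)"
    using assms by (simp add: DeMoivre mult_ac)
  then show "w \<in> {w. w ^ m = 1}" by (simp add: cis_multiple_2pi)
next
  fix w :: complex assume "w \<in> {w. w ^ m = 1}"
  then obtain k where "w = cis (2 * pi / real m) ^ k" using primitive_root(2)[OF assms] by blast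
  then have "w = cis (real_of_int (int k) / real m * (2 * pi))"
    by (simp add: DeMoivre mult_ac)
  then show "w \<in> {cis (real_of_int j / real m * (2 * pi)) | j :: int. True}" by blast
qed

lemma A_orbit_eq: "n \<ge> 1 \<Longrightarrow> A_orbit n = level_set n 1"
  using cis_multiples_eq_roots_of_unity[of n]
  unfolding A_orbit_def level_set_def by (auto simp: set_eq_iff image_iff)

lemma B_orbit_eq:
  assumes "n \<ge> 1"
  shows "B_orbit n = level_set n (-1)"
proof -
  have power: "cis (real_of_int l / real (2 * n) * (2 * pi)) ^ n = cis (pi * real_of_int l)" for l
    using assms by (simp add: DeMoivre field_simps)
  have odd: "cis (pi * real_of_int l) = -1 \<longleftrightarrow> odd l" for l
    by (simp add: complex_eq_iff cos_npi_int sin_npi_int)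
  have "w ^ n = -1 \<longleftrightarrow> (\<exists>j::int. w = cis ((2 * real_of_int j + 1) / (2 * real n) * (2 * pi)))" for w
  proof
    assume w: "w ^ n = -1"
    then have "w ^ (2 * n) = 1" by (simp add: power_mult power2_eq_square mult.commute[of 2])
    moreover have "1 \<le> 2 * n" using assms by simp
    ultimately have "w \<in> {cis (real_of_int l / real (2 * n) * (2 * pi)) | l :: int. True}"
      by (simp only: cis_multiples_eq_roots_of_unity mem_Collect_eq)
    then obtain l :: int where l: "w = cis (real_of_int l / real (2 * n) * (2 * pi))" by blast
    then have "odd l" using w power odd by metis
    then obtain j where "l = 2 * j + 1" by (rule oddE)
    then show "\<exists>j::int. w = cis ((2 * real_of_int j + 1) / (2 * real n) * (2 * pi))"
      using l by (intro exI[of _ j]) simp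
  next
    assume "\<exists>j::int. w = cis ((2 * real_of_int j + 1) / (2 * real n) * (2 * pi))"
    then obtain j :: int where "w = cis ((2 * real_of_int j + 1) / (2 * real n) * (2 * pi))" by blast
    then show "w ^ n = -1" using power[of "2 * j + 1"] odd[of "2 * j + 1"] by simp
  qed
  then have "{w. w ^ n = -1 \<or> w ^ n = inverse (-1)}
      = {cis ((2 * real_of_int j + 1) / (2 * real n) * (2 * pi)) | j :: int. True}"
    by simp
  then show ?thesis unfolding B_orbit_def level_set_def by blast
qed

lemma level_set_eq_translates:
  assumes "n \<ge> 1" "z \<noteq> 0"
  shows "level_set n (z ^ n) = {Some (w * z) | w. w ^ n = 1} \<union> {Some (w / z) | w. w ^ n = 1}"
proof (intro equalityI subsetI)
  fix p assume "p \<in> level_set n (z ^ n)"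
  then obtain y where y: "p = Some y" "y ^ n = z ^ n \<or> y ^ n = inverse (z ^ n)"
    by (auto simp: level_set_def)
  from y(2) show "p \<in> {Some (w * z) | w. w ^ n = 1} \<union> {Some (w / z) | w. w ^ n = 1}"
  proof
    assume "y ^ n = z ^ n"
    then have "(y / z) ^ n = 1" "p = Some (y / z * z)"
      using assms(2) y(1) by (auto simp: power_divide)
    then show ?thesis by blast
  next
    assume "y ^ n = inverse (z ^ n)"
    then have "(y * z) ^ n = 1" "p = Some (y * z / z)"
      using assms(2) y(1) by (auto simp: power_mult_distrib)
    then show ?thesis by blast
  qed
next
  fix p assume "p \<in> {Some (w * z) | w. w ^ n = 1} \<union> {Some (w / z) | w. w ^ n = 1}"
  then show "p \<in> level_set n (z ^ n)"
    by (auto simp: level_set_def power_divide power_mult_distrib inverse_eq_divide)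
qed

lemma C_orbit_eq:
  assumes "n \<ge> 1" "z \<noteq> 0"
  shows "C_orbit n z = level_set n (z ^ n)"
proof -
  let ?R = "{cis (real_of_int j / real n * (2 * pi)) | j :: int. True}"
  have "C_orbit n z = {Some (z * w) | w. w \<in> ?R} \<union> {Some (inverse z * w) | w. w \<in> ?R}"
    unfolding C_orbit_def by blast
  then show ?thesis
    unfolding cis_multiples_eq_roots_of_unity[OF assms(1)] level_set_eq_translates[OF assms]
    by (simp add: divide_inverse mult.commute)
qed

lemma exists_nth_root:
  assumes "n \<ge> 1"
  shows "\<exists>z::complex. z ^ n = u"
proof (cases "u = 0")
  case True
  then show ?thesis using assms by (intro exI[of _ 0]) auto
next
  case False
  then have "card {z. z ^ n = u} \<noteq> 0" using card_nth_roots[of u n] assms by simp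
  then have "{z. z ^ n = u} \<noteq> {}" by force
  then show ?thesis by blast
qed

lemma C_orbits_eq:
  assumes "n \<ge> 1"
  shows "C_orbits n = level_set n ` {u. u \<noteq> 0 \<and> u\<^sup>2 \<noteq> 1}"
proof -
  have c: "{cis (real_of_int l / (2 * real n) * (2 * pi)) | l :: int. True} = {w. (w ^ n)\<^sup>2 = 1}"
    using cis_multiples_eq_roots_of_unity[of "2 * n"] assms by (simp add: mult.commute flip: power_mult)
  show ?thesis
  proof (intro equalityI subsetI)
    fix O' assume "O' \<in> C_orbits n"
    then obtain z where "O' = C_orbit n z" "z \<noteq> 0" "(z ^ n)\<^sup>2 \<noteq> 1"
      unfolding C_orbits_def c by auto
    then show "O' \<in> level_set n ` {u. u \<noteq> 0 \<and> u\<^sup>2 \<noteq> 1}" using C_orbit_eq[OF assms] by auto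
  next
    fix O' assume "O' \<in> level_set n ` {u. u \<noteq> 0 \<and> u\<^sup>2 \<noteq> 1}"
    then obtain u where u: "O' = level_set n u" "u \<noteq> 0" "u\<^sup>2 \<noteq> 1" by auto
    obtain z where z: "z ^ n = u" using exists_nth_root[OF assms] by blast
    then have "z \<noteq> 0" using u assms by (auto simp: power_0_left)
    then show "O' \<in> C_orbits n"
      unfolding C_orbits_def c using u z C_orbit_eq[OF assms] by auto
  qed
qed

lemma G_orbits_eq:
  assumes "n \<ge> 1"
  shows "G_orbits n = insert V_orbit (level_set n ` (- {0}))"
proof -
  define O' where "O' = orbit (G_group n) (\<lambda>g. g)"
  have orbit: "O' p = {g p | g. g \<in> dihedral_maps n}" for p
    by (simp add: O'_def orbit_def carrier_G_group[OF assms])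
  have V: "O' p = V_orbit" if "p = None \<or> p = Some 0" for p
  proof -
    have "rot 1 \<in> dihedral_maps n" "flip 1 \<in> dihedral_maps n" by (auto simp: dihedral_maps_def)
    then have "rot 1 p \<in> O' p" "flip 1 p \<in> O' p" unfolding orbit by blast+
    then have "V_orbit \<subseteq> O' p" using that by (auto simp: rot_flip_apply V_orbit_def)
    moreover have "O' p \<subseteq> V_orbit"
      unfolding orbit using that by (auto simp: dihedral_maps_def rot_flip_apply V_orbit_def)
    ultimately show ?thesis by blast
  qed
  have L: "O' (Some z) = level_set n (z ^ n)" if "z \<noteq> 0" for z
  proof -
    have "O' (Some z) = {rot w (Some z) | w. w ^ n = 1} \<union> {flip w (Some z) | w. w ^ n = 1}"
      unfolding orbit dihedral_maps_def by blast
    also have "\<dots> = level_set n (z ^ n)"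
      using that by (simp add: level_set_eq_translates[OF assms] rot_flip_apply)
    finally show ?thesis .
  qed
  have "G_orbits n = range O'" by (auto simp: G_orbits_def orbits_def O'_def)
  also have "\<dots> = insert V_orbit (level_set n ` (- {0}))"
  proof (intro equalityI subsetI)
    fix W assume "W \<in> range O'"
    then obtain p where p: "W = O' p" by blast
    show "W \<in> insert V_orbit (level_set n ` (- {0}))"
      proof (cases "p = None \<or> p = Some 0")
      case True
      then show ?thesis using p V by simp
    next
      case False
      then obtain z where "p = Some z" "z \<noteq> 0" by (cases p) auto
      then show ?thesis using p L by simp
    qed
  next
    fix W assume "W \<in> insert V_orbit (level_set n ` (- {0}))"
    moreover have "W \<in> range O'" if "W = level_set n u" "u \<noteq> 0" for u
    proof -
      obtain z where z: "z ^ n = u" using exists_nth_root[OF assms] by blast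
      then have "z \<noteq> 0" using that assms by (auto simp: power_0_left)
      then have "W = O' (Some z)" using L z that by simp
      then show ?thesis by blast
    qed
    ultimately show "W \<in> range O'" using V[of None] by auto
  qed
  finally show ?thesis .
qed

lemma G_orbits_split:
  assumes "n \<ge> 1"
  shows "G_orbits n = {V_orbit, A_orbit n, B_orbit n} \<union> C_orbits n"
proof -
  have "- {0} = {1, -1} \<union> {u::complex. u \<noteq> 0 \<and> u\<^sup>2 \<noteq> 1}"
    by (auto simp: power2_eq_1_iff)
  then show ?thesis
    unfolding G_orbits_eq[OF assms] C_orbits_eq[OF assms] A_orbit_eq[OF assms] B_orbit_eq[OF assms]
    by (simp add: image_Un)
qed

lemma finite_level_set: "n \<ge> 1 \<Longrightarrow> finite (level_set n u)"
  unfolding level_set_def by (simp add: finite_nth_roots Collect_disj_eq)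

lemma card_level_set:
  assumes "n \<ge> 1" "u \<noteq> 0"
  shows "card (level_set n u) = (if u\<^sup>2 = 1 then n else 2 * n)"
proof -
  have "card (level_set n u) = card {w. w ^ n = u \<or> w ^ n = inverse u}"
    unfolding level_set_def by (simp add: card_image)
  also have "\<dots> = card ({w. w ^ n = u} \<union> {w. w ^ n = inverse u})"
    by (simp add: Collect_disj_eq)
  also have "\<dots> = (if u\<^sup>2 = 1 then n else 2 * n)"
  proof (cases "u\<^sup>2 = 1")
    case True
    then have "inverse u = u" by (auto simp: power2_eq_1_iff)
    then show ?thesis using True assms by (simp add: card_nth_roots)
  next
    case False
    then have "{w. w ^ n = u} \<inter> {w. w ^ n = inverse u} = {}"
      using assms by (auto simp: power2_eq_square field_simps)
    then show ?thesis
      using False assms by (subst card_Un_disjoint) (auto simp: card_nth_roots)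
  qed
  finally show ?thesis .
qed

lemma level_set_eq_iff:
  assumes "n \<ge> 1" "u \<noteq> 0" "v \<noteq> 0"
  shows "level_set n u = level_set n v \<longleftrightarrow> v = u \<or> v = inverse u"
    and "level_set n u \<inter> level_set n v = {} \<or> level_set n u = level_set n v"
proof -
  have meet: "v = u \<or> v = inverse u" if "p \<in> level_set n u" "p \<in> level_set n v" for p
    using that assms by (auto simp: level_set_def)
  have eq: "level_set n u = level_set n v" if "v = u \<or> v = inverse u"
    using that by (auto simp: level_set_def)
  obtain z where "z ^ n = u" using exists_nth_root[OF assms(1)] by blast
  then have "Some z \<in> level_set n u" by (simp add: level_set_def)
  then show "level_set n u = level_set n v \<longleftrightarrow> v = u \<or> v = inverse u"
    using meet eq by blast
  show "level_set n u \<inter> level_set n v = {} \<or> level_set n u = level_set n v"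
    using meet eq by blast
qed

lemma V_orbit_disjoint: "n \<ge> 1 \<Longrightarrow> u \<noteq> 0 \<Longrightarrow> V_orbit \<inter> level_set n u = {}"
  by (auto simp: V_orbit_def level_set_def power_0_left)

lemma card_V_orbit: "card V_orbit = 2"
  by (simp add: V_orbit_def)

lemma orbits_distinct:
  assumes "n \<ge> 1"
  shows "A_orbit n \<noteq> B_orbit n" "V_orbit \<noteq> A_orbit n" "V_orbit \<noteq> B_orbit n"
    "V_orbit \<notin> C_orbits n" "A_orbit n \<notin> C_orbits n" "B_orbit n \<notin> C_orbits n"
proof -
  show "A_orbit n \<noteq> B_orbit n"
    using level_set_eq_iff[OF assms, of 1 "-1"] by (simp add: A_orbit_eq[OF assms] B_orbit_eq[OF assms])
  have V: "V_orbit \<noteq> level_set n u" for u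
    by (auto simp: V_orbit_def level_set_def)
  then show "V_orbit \<noteq> A_orbit n" "V_orbit \<noteq> B_orbit n" "V_orbit \<notin> C_orbits n"
    by (auto simp: A_orbit_eq[OF assms] B_orbit_eq[OF assms] C_orbits_eq[OF assms])
  have "level_set n u \<noteq> level_set n v" if "u\<^sup>2 = 1" "v \<noteq> 0" "v\<^sup>2 \<noteq> 1" for u v
    using that level_set_eq_iff(1)[OF assms, of u v] by (auto simp: power2_eq_1_iff)
  then show "A_orbit n \<notin> C_orbits n" "B_orbit n \<notin> C_orbits n"
    by (auto simp: A_orbit_eq[OF assms] B_orbit_eq[OF assms] C_orbits_eq[OF assms])
qed

lemma card_orbit:
  assumes "n \<ge> 1"
  shows "card (A_orbit n) = n" "card (B_orbit n) = n" "W \<in> C_orbits n \<Longrightarrow> card W = 2 * n"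
  using assms by (auto simp: A_orbit_eq[OF assms] B_orbit_eq[OF assms] C_orbits_eq[OF assms] card_level_set)

lemma finite_orbit: "n \<ge> 1 \<Longrightarrow> W \<in> G_orbits n \<Longrightarrow> finite W"
  using finite_level_set by (auto simp: G_orbits_eq V_orbit_def)

lemma orbit_nonempty:
  assumes "n \<ge> 1" "W \<in> G_orbits n"
  shows "W \<noteq> {}"
proof -
  have "level_set n u \<noteq> {}" for u
    using exists_nth_root[OF assms(1), of u] by (auto simp: level_set_def)
  then show ?thesis using assms by (auto simp: G_orbits_eq V_orbit_def)
qed

lemma G_orbits_disjoint:
  assumes "n \<ge> 1" "W \<in> G_orbits n" "W' \<in> G_orbits n" "W \<noteq> W'"
  shows "W \<inter> W' = {}"
  using assms level_set_eq_iff(2)[OF assms(1)] V_orbit_disjoint[OF assms(1)]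
  unfolding G_orbits_eq[OF assms(1)] by blast

text \<open>Orbits are disjoint and nonempty, so a union of orbits contains no others. Hence the index of a
  set can be read off from any presentation of the set as a union of orbits.\<close>

lemma orbits_in_union:
  assumes "n \<ge> 1" "\<O> \<subseteq> G_orbits n"
  shows "{W \<in> G_orbits n. W \<subseteq> \<Union>\<O>} = \<O>"
proof (intro equalityI subsetI)
  fix W assume "W \<in> {W \<in> G_orbits n. W \<subseteq> \<Union>\<O>}"
  then have W: "W \<in> G_orbits n" "W \<subseteq> \<Union>\<O>" by auto
  then obtain p where "p \<in> W" using orbit_nonempty[OF assms(1)] by blast
  then obtain W' where "W' \<in> \<O>" "p \<in> W'" using W by blast
  then have "W = W'" using G_orbits_disjoint[OF assms(1) W(1), of W'] \<open>p \<in> W\<close> assms(2) by blast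
  then show "W \<in> \<O>" using \<open>W' \<in> \<O>\<close> by simp
qed (use assms(2) in auto)

lemma orbits_of_type_in_union:
  assumes "n \<ge> 1" "\<B> \<subseteq> {V_orbit, A_orbit n, B_orbit n}" "\<C> \<subseteq> C_orbits n" "T \<subseteq> G_orbits n"
  shows "{W \<in> T. W \<subseteq> \<Union>(\<B> \<union> \<C>)} = T \<inter> (\<B> \<union> \<C>)"
proof -
  have "\<B> \<union> \<C> \<subseteq> G_orbits n" using assms G_orbits_split[OF assms(1)] by blast
  from orbits_in_union[OF assms(1) this] assms(4) show ?thesis by blast
qed

lemma dihedral_index_union:
  assumes "n \<ge> 1" "\<B> \<subseteq> {V_orbit, A_orbit n, B_orbit n}" "\<C> \<subseteq> C_orbits n"
  shows "dihedral_index n (\<Union>(\<B> \<union> \<C>)) = (card (\<B> \<inter> {V_orbit}), card (\<B> \<inter> {A_orbit n, B_orbit n}), card \<C>)"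
proof -
  note * = orbits_of_type_in_union[OF assms]
  have sub: "{V_orbit} \<subseteq> G_orbits n" "{A_orbit n, B_orbit n} \<subseteq> G_orbits n" "C_orbits n \<subseteq> G_orbits n"
    using G_orbits_split[OF assms(1)] by auto
  have "{V_orbit} \<inter> (\<B> \<union> \<C>) = \<B> \<inter> {V_orbit}"
    "{A_orbit n, B_orbit n} \<inter> (\<B> \<union> \<C>) = \<B> \<inter> {A_orbit n, B_orbit n}"
    "C_orbits n \<inter> (\<B> \<union> \<C>) = \<C>"
    using assms(2,3) orbits_distinct[OF assms(1)] by auto
  then show ?thesis unfolding dihedral_index_def using *[OF sub(1)] *[OF sub(2)] *[OF sub(3)] by simp
qed

lemma dihedral_index_2_union:
  assumes "\<B> \<subseteq> {V_orbit, A_orbit 2, B_orbit 2}" "\<C> \<subseteq> C_orbits 2"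
  shows "dihedral_index_2 (\<Union>(\<B> \<union> \<C>)) = (card \<B>, card \<C>)"
proof -
  note * = orbits_of_type_in_union[OF _ assms, simplified]
  have sub: "{V_orbit, A_orbit 2, B_orbit 2} \<subseteq> G_orbits 2" "C_orbits 2 \<subseteq> G_orbits 2"
    using G_orbits_split[of 2] by auto
  have "{V_orbit, A_orbit 2, B_orbit 2} \<inter> (\<B> \<union> \<C>) = \<B>" "C_orbits 2 \<inter> (\<B> \<union> \<C>) = \<C>"
    using assms orbits_distinct[of 2] by auto
  then show ?thesis unfolding dihedral_index_2_def using *[OF sub(1)] *[OF sub(2)] by simp
qed

lemma finite_union_of_orbitsE:
  assumes "n \<ge> 1" "finite_union_of_orbits n \<alpha>"
  obtains \<B> \<C> where "\<B> \<subseteq> {V_orbit, A_orbit n, B_orbit n}" "\<C> \<subseteq> C_orbits n" "finite \<C>"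
    "\<alpha> = \<Union>(\<B> \<union> \<C>)"
proof -
  obtain \<O> where O: "finite \<O>" "\<O> \<subseteq> G_orbits n" "\<alpha> = \<Union>\<O>"
    using assms(2) by (auto simp: finite_union_of_orbits_def)
  have "\<O> = \<O> \<inter> {V_orbit, A_orbit n, B_orbit n} \<union> \<O> \<inter> C_orbits n"
    using O(2) G_orbits_split[OF assms(1)] by blast
  then show ?thesis
    using that[of "\<O> \<inter> {V_orbit, A_orbit n, B_orbit n}" "\<O> \<inter> C_orbits n"] O by auto
qed

lemma card_union_of_orbits:
  assumes "n \<ge> 1" "\<B> \<subseteq> {V_orbit, A_orbit n, B_orbit n}" "\<C> \<subseteq> C_orbits n" "finite \<C>"
  shows "card (\<Union>(\<B> \<union> \<C>))
    = 2 * card (\<B> \<inter> {V_orbit}) + n * (card (\<B> \<inter> {A_orbit n, B_orbit n}) + 2 * card \<C>)"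
proof -
  have sub: "\<B> \<union> \<C> \<subseteq> G_orbits n" using assms G_orbits_split[OF assms(1)] by blast
  have finB: "finite \<B>" using assms(2) finite_subset by blast
  have disj: "\<B> \<inter> \<C> = {}" using assms(2,3) orbits_distinct[OF assms(1)] by blast
  have "card (\<Union>(\<B> \<union> \<C>)) = (\<Sum>W\<in>\<B> \<union> \<C>. card W)"
  proof (rule card_Union_disjoint)
    show "disjoint (\<B> \<union> \<C>)"
      unfolding disjoint_def disjnt_def using G_orbits_disjoint[OF assms(1)] sub by blast
  qed (use finite_orbit[OF assms(1)] sub in auto)
  also have "\<dots> = (\<Sum>W\<in>\<B>. card W) + (\<Sum>W\<in>\<C>. card W)"
    by (rule sum.union_disjoint) (use finB assms(4) disj in auto)
  also have "(\<Sum>W\<in>\<C>. card W) = (\<Sum>W\<in>\<C>. 2 * n)"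
    using assms(3) by (intro sum.cong) (auto simp: card_orbit[OF assms(1)])
  also have "(\<Sum>W\<in>\<B>. card W) = (\<Sum>W\<in>(\<B> \<inter> {V_orbit}) \<union> (\<B> \<inter> {A_orbit n, B_orbit n}). card W)"
    using assms(2) by (intro sum.cong) auto
  also have "\<dots> = (\<Sum>W\<in>\<B> \<inter> {V_orbit}. card W) + (\<Sum>W\<in>\<B> \<inter> {A_orbit n, B_orbit n}. card W)"
    by (rule sum.union_disjoint) (use orbits_distinct[OF assms(1)] in auto)
  also have "(\<Sum>W\<in>\<B> \<inter> {V_orbit}. card W) = (\<Sum>W\<in>\<B> \<inter> {V_orbit}. 2)"
    by (intro sum.cong) (auto simp: card_V_orbit)
  also have "(\<Sum>W\<in>\<B> \<inter> {A_orbit n, B_orbit n}. card W) = (\<Sum>W\<in>\<B> \<inter> {A_orbit n, B_orbit n}. n)"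
    by (intro sum.cong) (auto simp: card_orbit[OF assms(1)])
  finally show ?thesis by (simp add: algebra_simps)
qed

lemma union_of_orbits_invariant:
  assumes "n \<ge> 1" "\<O> \<subseteq> G_orbits n" "f \<in> dihedral_maps n"
  shows "f ` (\<Union>\<O>) = \<Union>\<O>"
proof -
  have sub: "f ` W \<subseteq> W" if "W \<in> G_orbits n" "f \<in> dihedral_maps n" for W f
  proof -
    have "f ` level_set n u \<subseteq> level_set n u" if "u \<noteq> 0" for u
      using \<open>f \<in> dihedral_maps n\<close> that assms(1)
      by (auto simp: dihedral_maps_def level_set_def rot_flip_apply power_mult_distrib power_divide
            inverse_eq_divide power_0_left split: if_splits)
    moreover have "f ` V_orbit \<subseteq> V_orbit"
      using \<open>f \<in> dihedral_maps n\<close> by (auto simp: dihedral_maps_def V_orbit_def rot_flip_apply)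
    ultimately show ?thesis using \<open>W \<in> G_orbits n\<close> by (auto simp: G_orbits_eq[OF assms(1)])
  qed
  obtain g where g: "g \<in> dihedral_maps n" "f \<circ> g = id" using dihedral_maps_inv[OF assms(1,3)] by blast
  have "f ` (\<Union>\<O>) \<subseteq> \<Union>\<O>" "g ` (\<Union>\<O>) \<subseteq> \<Union>\<O>"
    using sub assms g by blast+
  moreover have "p = f (g p)" for p using g(2) by (metis comp_apply id_apply)
  ultimately show ?thesis by (metis image_subset_iff imageI subset_antisym subsetI)
qed

lemma invariant_finite_union_of_orbits:
  assumes "n \<ge> 1" "finite \<alpha>" "\<And>f. f \<in> dihedral_maps n \<Longrightarrow> f ` \<alpha> \<subseteq> \<alpha>"
  shows "finite_union_of_orbits n \<alpha>"
proof -
  let ?O = "orbit (G_group n) (\<lambda>g. g)"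
  have orbit: "?O p = {g p | g. g \<in> dihedral_maps n}" for p
    by (simp add: orbit_def carrier_G_group[OF assms(1)])
  have "p \<in> ?O p" for p
    unfolding orbit using rot_one by (auto simp: dihedral_maps_def intro!: exI[of _ id] exI[of _ 1])
  moreover have "?O p \<subseteq> \<alpha>" if "p \<in> \<alpha>" for p
    unfolding orbit using assms(3) that by blast
  ultimately have "\<alpha> = \<Union>(?O ` \<alpha>)" by blast
  moreover have "?O ` \<alpha> \<subseteq> G_orbits n" by (auto simp: G_orbits_def orbits_def)
  ultimately show ?thesis unfolding finite_union_of_orbits_def using assms(2) by blast
qed

section \<open>Rigidity of the roots of unity and of the bipyramid\<close>

text \<open>If \<open>z \<mapsto> (az+b)/(cz+d)\<close> maps the \<open>n\<close> roots of \<open>z\<^sup>n = u\<close> to roots, then \<open>(az+b)\<^sup>n - u(cz+d)\<^sup>n\<close> vanishes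
  at all of them and, having degree at most \<open>n\<close>, is a multiple of \<open>z\<^sup>n - u\<close>. So its middle coefficients
  are zero.\<close>

lemma root_set_coefficients:
  assumes "n \<ge> 1" "u \<noteq> 0"
    and maps: "\<And>z. z ^ n = u \<Longrightarrow> moebius a b c d (Some z) \<in> Some ` {w. w ^ n = u}"
    and j: "0 < j" "j < n"
  shows "a ^ j * b ^ (n - j) = u * (c ^ j * d ^ (n - j))"
proof -
  define p where "p = [:b, a:] ^ n - smult u ([:d, c:] ^ n)"
  define K where "K = poly.coeff p n"
  define q where "q = smult K (Polynomial.monom 1 n - [:u:])"
  have deg1: "degree ([:x, y:] ^ n) \<le> n" for x y :: complex
    using degree_power_le[of "[:x, y:]" n] by (auto split: if_splits intro: order_trans)
  have "p = q"
  proof (rule poly_eqI_degree_lead_coeff)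
    show "poly.coeff p n = poly.coeff q n"
      using assms(1) by (simp add: q_def K_def coeff_pCons split: nat.split)
    show "card {z. z ^ n = u} \<ge> n" using assms by (simp add: card_nth_roots)
    show "degree p \<le> n"
      unfolding p_def by (intro degree_diff_le deg1 order_trans[OF degree_smult_le])
    show "degree q \<le> n"
      unfolding q_def by (intro degree_diff_le order_trans[OF degree_smult_le]) (auto simp: degree_monom_le)
    fix z assume z: "z \<in> {z. z ^ n = u}"
    then have "moebius a b c d (Some z) \<in> Some ` {w. w ^ n = u}" using maps by simp
    then have "c * z + d \<noteq> 0" "((a * z + b) / (c * z + d)) ^ n = u"
      by (auto simp: moebius_def split: if_splits)
    then have "(a * z + b) ^ n = u * (c * z + d) ^ n" by (simp add: power_divide field_simps)
    then have "poly p z = 0" by (simp add: p_def algebra_simps)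
    moreover have "poly q z = 0" using z by (simp add: q_def poly_monom)
    ultimately show "poly p z = poly q z" by simp
  qed
  then have "poly.coeff p j = poly.coeff q j" by simp
  moreover have "poly.coeff q j = 0" using j by (simp add: q_def coeff_pCons split: nat.split)
  moreover have "poly.coeff p j = of_nat (n choose j) * (a ^ j * b ^ (n - j) - u * (c ^ j * d ^ (n - j)))"
    using j by (simp add: p_def coeff_linear_poly_power algebra_simps)
  moreover have "of_nat (n choose j) \<noteq> (0::complex)" using j by simp
  ultimately show ?thesis by simp
qed

text \<open>A symmetry that respects \<open>{0, \<infinity>}\<close> has a diagonal or an antidiagonal matrix. Knowing the \<open>n\<close>-th powers
  of one point and of its image is then enough to see that it lies in \<open>G\<close>.\<close>

lemma diagonal_in_dihedral_maps:
  assumes "a \<noteq> 0" "d \<noteq> 0" "z ^ n = w ^ n" "w ^ n \<noteq> 0" "moebius a 0 0 d (Some z) = Some w"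
  shows "moebius a 0 0 d \<in> dihedral_maps n"
proof -
  have eq: "moebius a 0 0 d = rot (a / d)"
    using moebius_scale[of "inverse d" a 0 0 d] assms(2) by (simp add: field_simps)
  have "w = a / d * z" using assms(5) by (simp add: eq rot_Some)
  then have "w ^ n = (a / d) ^ n * w ^ n" using assms(3) by (metis power_mult_distrib)
  then have "(a / d) ^ n = 1" using assms(4) by (cases "n = 0") auto
  then show ?thesis unfolding eq by (auto simp: dihedral_maps_def)
qed

lemma antidiagonal_in_dihedral_maps:
  assumes "b \<noteq> 0" "c \<noteq> 0" "z ^ n * w ^ n = 1" "moebius 0 b c 0 (Some z) = Some w"
  shows "moebius 0 b c 0 \<in> dihedral_maps n"
proof -
  have eq: "moebius 0 b c 0 = flip (b / c)"
    using moebius_scale[of "inverse c" 0 b c 0] assms(2) by (simp add: field_simps)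
  have "w = b / c / z" "z \<noteq> 0" using assms(4) by (auto simp: eq rot_flip_apply split: if_splits)
  then have "z * w = b / c" by simp
  then have "(b / c) ^ n = 1" using assms(3) by (metis power_mult_distrib)
  then show ?thesis unfolding eq by (auto simp: dihedral_maps_def)
qed

lemma monomial_in_dihedral_maps:
  assumes "a * d - b * c \<noteq> 0" "b = 0 \<and> c = 0 \<or> a = 0 \<and> d = 0"
    and "z ^ n = 1" "w ^ n = 1" "moebius a b c d (Some z) = Some w"
  shows "moebius a b c d \<in> dihedral_maps n"
  using assms diagonal_in_dihedral_maps[of a d z n w] antidiagonal_in_dihedral_maps[of b c z n w]
  by auto

lemma symmetry_carrier_eqI:
  assumes "n \<ge> 1" "\<O> \<subseteq> G_orbits n"
    and "\<And>f. is_moebius f \<Longrightarrow> f ` \<Union>\<O> = \<Union>\<O> \<Longrightarrow> f \<in> dihedral_maps n"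
  shows "carrier (symmetry_group (\<Union>\<O>)) = dihedral_maps n"
  using assms union_of_orbits_invariant[OF assms(1,2)] dihedral_maps_moebius[OF assms(1)]
  by (auto simp: carrier_symmetry_group)

lemma level_set_one: "level_set n 1 = Some ` {w. w ^ n = 1}"
  by (simp add: level_set_def)

text \<open>For \<open>n \<ge> 3\<close> there are two middle coefficients. If \<open>a\<close> and \<open>b\<close> were both nonzero, their vanishing would
  make the vectors \<open>(a, b)\<close> and \<open>(c, d)\<close> proportional, against invertibility. So the matrix is diagonal
  or antidiagonal.\<close>

lemma symmetry_A_orbit:
  assumes "n \<ge> 3"
  shows "carrier (symmetry_group (\<Union>{A_orbit n})) = dihedral_maps n"
proof (rule symmetry_carrier_eqI)
  have n: "n \<ge> 1" using assms by simp
  show "n \<ge> 1" by (rule n)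
  show "{A_orbit n} \<subseteq> G_orbits n" using G_orbits_split[OF n] by simp
  fix f assume f: "is_moebius f" "f ` \<Union>{A_orbit n} = \<Union>{A_orbit n}"
  obtain a b c d where abcd: "f = moebius a b c d" "a * d - b * c = 1"
    using f(1) by (rule is_moebiusE)
  have maps: "moebius a b c d (Some z) \<in> Some ` {w. w ^ n = 1}" if "z ^ n = 1" for z
    using f(2) that by (auto simp: A_orbit_eq[OF n] level_set_one abcd(1) simp flip: image_subset_iff)
  have e: "a ^ j * b ^ (n - j) = c ^ j * d ^ (n - j)" if "0 < j" "j < n" for j
    using root_set_coefficients[OF n _ maps that] by simp
  have e1: "a * b ^ (n - 1) = c * d ^ (n - 1)" using e[of 1] assms by simp
  have e2: "a\<^sup>2 * b ^ (n - 2) = c\<^sup>2 * d ^ (n - 2)" using e[of 2] assms by simp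
  define p where "p = a * b ^ (n - 2)"
  define q where "q = c * d ^ (n - 2)"
  have "n - 1 = Suc (n - 2)" using assms by simp
  then have XY1: "p * b = q * d" using e1 by (simp add: p_def q_def mult_ac)
  have XY2: "p * a = q * c" using e2 by (simp add: p_def q_def power2_eq_square mult_ac)
  have "a = 0 \<or> b = 0"
  proof (rule ccontr)
    assume "\<not> (a = 0 \<or> b = 0)"
    then have p: "p \<noteq> 0" "p * b \<noteq> 0" by (auto simp: p_def)
    then have q: "q \<noteq> 0" using XY1 by auto
    have "p * q * (a * d - b * c) = (p * a) * (q * d) - (p * b) * (q * c)" by (simp add: algebra_simps)
    also have "\<dots> = 0" using XY1 XY2 by simp
    finally show False using p q abcd(2) by simp
  qed
  then have "b = 0 \<and> c = 0 \<or> a = 0 \<and> d = 0"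
    using e1 abcd(2) assms by (auto simp: power_0_left)
  moreover obtain w where "w ^ n = 1" "moebius a b c d (Some 1) = Some w"
    using maps[of 1] by auto
  ultimately show "f \<in> dihedral_maps n"
    unfolding abcd(1) using abcd(2) by (intro monomial_in_dihedral_maps[of _ _ _ _ 1 _ w]) auto
qed

lemma choose_3_eq_choose_2:
  assumes "N \<ge> 4" "N choose 3 = N choose 2"
  shows "N = 5"
proof -
  have "3 * (N choose 3) = (N - 2) * (N choose 2)"
    using binomial_absorption[of 2 N] binomial_absorb_comp[of N 2] by (simp add: eval_nat_numeral)
  moreover have "N choose 2 \<noteq> 0" using assms(1) by (simp add: binomial_eq_0_iff)
  ultimately show ?thesis using assms by auto
qed

text \<open>The map sends the apex 0 to the vertex 1, normalised by \<open>b = d = 1\<close>. It permutes the zeros of the form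
  \<open>xy(x\<^sup>n - y\<^sup>n)\<close>, so \<open>(az+1)(cz+1)((az+1)\<^sup>n - (cz+1)\<^sup>n)\<close> is a multiple of \<open>z\<^sup>n\<^sup>+\<^sup>1 - z\<close>. Its coefficient
  of \<open>z\<^sup>2\<close> gives \<open>c = -a\<close>, and that of \<open>z\<^sup>3\<close> then equates two binomial coefficients, which happens only
  for the octahedron.\<close>

lemma bipyramid_moves_apex:
  assumes n: "n \<ge> 3" and ac: "a \<noteq> c"
    and maps: "moebius a 1 c 1 ` (V_orbit \<union> A_orbit n) \<subseteq> V_orbit \<union> A_orbit n"
  shows "n = 4"
proof -
  define p where "p = [:1, c:] * [:1, a:] ^ Suc n - [:1, a:] * [:1, c:] ^ Suc n"
  define K where "K = poly.coeff p (Suc n)"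
  define q where "q = smult K (Polynomial.monom 1 (Suc n) - Polynomial.monom 1 1)"
  have \<alpha>: "V_orbit \<union> A_orbit n = {None, Some 0} \<union> Some ` {w. w ^ n = 1}"
    using n by (auto simp: V_orbit_def A_orbit_eq level_set_one)
  have deg1: "degree ([:1, y:] ^ Suc n) \<le> Suc n" for y :: complex
    using degree_power_le[of "[:1, y:]" "Suc n"] by (auto split: if_splits)
  have coeff_p: "poly.coeff p (Suc k)
      = of_nat (Suc n choose Suc k) * a ^ Suc k + c * (of_nat (Suc n choose k) * a ^ k)
        - of_nat (Suc n choose Suc k) * c ^ Suc k - a * (of_nat (Suc n choose k) * c ^ k)"
    if "k \<le> n" for k
  proof -
    have "poly.coeff ([:1, y:] * r) (Suc k) = poly.coeff r (Suc k) + y * poly.coeff r k"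
      for y :: complex and r by simp
    then show ?thesis
      using that unfolding p_def coeff_diff
      by (simp only: coeff_linear_poly_power Suc_le_mono le_SucI power_one mult_1_right)
         (simp add: algebra_simps)
  qed
  \<comment> \<open>the image of infinity is a zero of the form, so the coefficient of degree n + 2 vanishes\<close>
  have top: "a * c * (a ^ n - c ^ n) = 0"
  proof -
    have "moebius a 1 c 1 None \<in> V_orbit \<union> A_orbit n" using maps by (auto simp: V_orbit_def)
    then show ?thesis unfolding \<alpha> by (auto simp: moebius_def power_divide split: if_splits)
  qed
  have "degree p \<le> Suc n"
  proof (rule degree_le, intro allI impI)
    fix i assume i: "Suc n < i"
    have c1: "poly.coeff ([:1, y:] ^ Suc n) j = 0" if "j > Suc n" for j and y :: complex
      using deg1[of y] that by (intro coeff_eq_0) simp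
    obtain k where k: "i = Suc k" "k \<ge> Suc n" using i by (cases i) auto
    show "poly.coeff p i = 0"
    proof (cases "k = Suc n")
      case True
      have "poly.coeff p i = c * poly.coeff ([:1, a:] ^ Suc n) (Suc n) - a * poly.coeff ([:1, c:] ^ Suc n) (Suc n)"
        using c1[of "Suc (Suc n)"] unfolding p_def k(1) True by simp
      also have "\<dots> = c * a ^ Suc n - a * c ^ Suc n"
        by (simp only: coeff_linear_poly_power[OF order_refl]) simp
      also have "\<dots> = 0" using top by (simp add: algebra_simps)
      finally show ?thesis .
    next
      case False
      then show ?thesis using c1[of i] c1[of k] k unfolding p_def by (simp del: power_Suc)
    qed
  qed
  have "p = q"
  proof (rule poly_eqI_degree_lead_coeff)
    show "poly.coeff p (Suc n) = poly.coeff q (Suc n)" using n by (simp add: q_def K_def)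
    have "card (insert 0 {z::complex. z ^ n = 1}) = Suc n"
      using n by (subst card_insert_disjoint) (auto simp: card_nth_roots power_0_left)
    then show "card (insert 0 {z::complex. z ^ n = 1}) \<ge> Suc n" by simp
    show "degree p \<le> Suc n" by fact
    show "degree q \<le> Suc n"
      unfolding q_def by (intro degree_diff_le order_trans[OF degree_smult_le])
        (auto simp: degree_monom_le intro: order_trans[OF degree_monom_le])
    fix z assume z: "z \<in> insert 0 {z::complex. z ^ n = 1}"
    then have "moebius a 1 c 1 (Some z) \<in> V_orbit \<union> A_orbit n" using maps \<alpha> by blast
    then have "c * z + 1 = 0 \<or> a * z + 1 = 0 \<or> (a * z + 1) ^ n = (c * z + 1) ^ n"
      unfolding \<alpha> by (auto simp: moebius_def power_divide split: if_splits)
    moreover have "poly p z = (c * z + 1) * (a * z + 1) * ((a * z + 1) ^ n - (c * z + 1) ^ n)"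
      by (simp add: p_def algebra_simps)
    ultimately have "poly p z = 0" by auto
    moreover have "poly q z = 0" using z by (auto simp: q_def poly_monom)
    ultimately show "poly p z = poly q z" by simp
  qed
  then have zero: "poly.coeff p i = 0" if "1 < i" "i \<le> n" for i
    using that by (simp add: q_def)
  define N where "N = Suc n"
  have "of_nat (N choose 2) * (a\<^sup>2 - c\<^sup>2) = 0"
    using zero[of 2] coeff_p[of 1] n by (simp add: N_def algebra_simps power2_eq_square eval_nat_numeral)
  moreover have "N choose 2 \<noteq> 0" using n by (simp add: N_def binomial_eq_0_iff)
  ultimately have "a\<^sup>2 = c\<^sup>2" by simp
  then have c: "c = - a" using ac by (auto simp: power2_eq_iff)
  then have a0: "a \<noteq> 0" using ac by auto
  have "of_nat (N choose 3) * a ^ 3 + c * (of_nat (N choose 2) * a ^ 2)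
        - of_nat (N choose 3) * c ^ 3 - a * (of_nat (N choose 2) * c ^ 2) = 0"
    using zero[of 3] coeff_p[of 2] n by (simp add: N_def eval_nat_numeral)
  then have "2 * a ^ 3 * (of_nat (N choose 3) - of_nat (N choose 2)) = 0"
    unfolding c by (simp add: algebra_simps power2_eq_square power3_eq_cube)
  then have "(of_nat (N choose 3) :: complex) = of_nat (N choose 2)" using a0 by simp
  then have "N choose 3 = N choose 2" by (simp only: of_nat_eq_iff)
  then have "N = 5" using n by (intro choose_3_eq_choose_2) (auto simp: N_def)
  then show ?thesis by (simp add: N_def)
qed

lemma bipyramid_apex_to_apex:
  assumes n: "n \<ge> 3" "n \<noteq> 4"
    and f: "is_moebius f" "f ` (V_orbit \<union> A_orbit n) = V_orbit \<union> A_orbit n"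
  shows "f (Some 0) \<in> V_orbit"
proof (rule ccontr)
  let ?\<alpha> = "V_orbit \<union> A_orbit n"
  have n1: "n \<ge> 1" using n by simp
  assume "f (Some 0) \<notin> V_orbit"
  moreover have "f (Some 0) \<in> ?\<alpha>" using f(2) by (auto simp: V_orbit_def)
  ultimately obtain w where w: "f (Some 0) = Some w" "w ^ n = 1"
    by (auto simp: A_orbit_eq[OF n1] level_set_one)
  have w0: "w \<noteq> 0" using root_of_unity_nonzero[OF n1 w(2)] .
  \<comment> \<open>a rotation brings the image of the apex to 1\<close>
  define g where "g = rot (inverse w) \<circ> f"
  have "is_moebius g" unfolding g_def using w0 f(1) by (intro is_moebius_comp is_moebius_rot_flip) auto
  then obtain a b c d where abcd: "g = moebius a b c d" "a * d - b * c = 1" by (rule is_moebiusE)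
  have "rot (inverse w) \<in> dihedral_maps n" using w by (auto simp: dihedral_maps_def power_inverse)
  then have "rot (inverse w) ` ?\<alpha> = ?\<alpha>"
    using union_of_orbits_invariant[OF n1, of "{V_orbit, A_orbit n}"] G_orbits_split[OF n1] by simp
  then have g: "g ` ?\<alpha> = ?\<alpha>" unfolding g_def image_comp[symmetric] f(2) by simp
  have "g (Some 0) = Some 1" using w w0 by (simp add: g_def rot_Some)
  then have "d \<noteq> 0" "b = d" by (auto simp: abcd(1) moebius_def split: if_splits)
  then have eq: "g = moebius (a / d) 1 (c / d) 1"
    using moebius_scale[of "inverse d" a b c d] by (simp add: abcd(1) field_simps)
  have "a / d \<noteq> c / d" using \<open>b = d\<close> abcd(2) by auto
  then show False using bipyramid_moves_apex[OF n(1), of "a / d" "c / d"] g n(2) by (simp add: eq)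
qed

lemma symmetry_bipyramid:
  assumes n: "n \<ge> 3" "n \<noteq> 4"
  shows "carrier (symmetry_group (\<Union>{V_orbit, A_orbit n})) = dihedral_maps n"
proof (rule symmetry_carrier_eqI)
  have n1: "n \<ge> 1" using n by simp
  show "n \<ge> 1" by (rule n1)
  show sub: "{V_orbit, A_orbit n} \<subseteq> G_orbits n" using G_orbits_split[OF n1] by simp
  fix f assume f: "is_moebius f" "f ` \<Union>{V_orbit, A_orbit n} = \<Union>{V_orbit, A_orbit n}"
  obtain a b c d where abcd: "f = moebius a b c d" "a * d - b * c = 1"
    using f(1) by (rule is_moebiusE)
  have f0: "f (Some 0) \<in> V_orbit" by (rule bipyramid_apex_to_apex[OF n]) (use f in simp_all)
  \<comment> \<open>the same argument for the other apex, exchanged with 0 by the inversion\<close>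
  have "(f \<circ> inversion) (Some 0) \<in> V_orbit"
  proof (rule bipyramid_apex_to_apex[OF n])
    have inv: "inversion \<in> dihedral_maps n" by (rule generators_in_dihedral_maps)
    then show "is_moebius (f \<circ> inversion)" using f(1) dihedral_maps_moebius[OF n1] is_moebius_comp by blast
    show "(f \<circ> inversion) ` (V_orbit \<union> A_orbit n) = V_orbit \<union> A_orbit n"
      using union_of_orbits_invariant[OF n1 sub inv] f(2) unfolding image_comp[symmetric] by simp
  qed
  then have "f None \<in> V_orbit" by (simp add: inversion_eq rot_flip_apply)
  with f0 have bd: "b = 0 \<and> c = 0 \<or> a = 0 \<and> d = 0"
    using abcd(2) by (auto simp: abcd(1) moebius_def V_orbit_def split: if_splits)
  have "f (Some 1) \<in> V_orbit \<union> A_orbit n"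
    using f(2) by (auto simp: A_orbit_eq[OF n1] level_set_one)
  moreover have "f (Some 1) \<notin> V_orbit"
    using bd abcd(2) by (auto simp: abcd(1) moebius_def V_orbit_def split: if_splits)
  ultimately obtain w where "w ^ n = 1" "f (Some 1) = Some w"
    by (auto simp: A_orbit_eq[OF n1] level_set_one)
  then show "f \<in> dihedral_maps n"
    unfolding abcd(1) using abcd(2) bd by (intro monomial_in_dihedral_maps[of _ _ _ _ 1 _ w]) auto
qed

section \<open>Cross-ratios and clusters\<close>

text \<open>The determinant of homogeneous coordinates of the two points. A Moebius map multiplies it by a factor
  for each point, and these factors cancel in cross-ratios.\<close>

definition bracket :: "sphere \<Rightarrow> sphere \<Rightarrow> complex" where
  "bracket p q = hom_x p * hom_y q - hom_y p * hom_x q"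

text \<open>The maximum norm makes inversion, which exchanges the coordinates, an exact isometry of \<open>chord\<close>.\<close>

definition height :: "sphere \<Rightarrow> real" where
  "height p = max (cmod (hom_x p)) (cmod (hom_y p))"

definition chord :: "sphere \<Rightarrow> sphere \<Rightarrow> real" where
  "chord p q = cmod (bracket p q) / (height p * height q)"

lemma height_pos: "height p > 0"
  using hom_nonzero[of p] by (auto simp: height_def less_max_iff_disj)

lemma chord_sym: "chord p q = chord q p"
  by (simp add: chord_def bracket_def norm_minus_commute mult.commute)

lemma chord_self [simp]: "chord p p = 0"
  by (simp add: chord_def bracket_def)

lemma chord_le_2: "chord p q \<le> 2"
proof -
  have *: "cmod (hom_x r) \<le> height r" "cmod (hom_y r) \<le> height r" for r
    by (auto simp: height_def)
  have "cmod (bracket p q) \<le> cmod (hom_x p) * cmod (hom_y q) + cmod (hom_y p) * cmod (hom_x q)"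
    unfolding bracket_def by (metis norm_triangle_ineq4 norm_mult)
  also have "\<dots> \<le> height p * height q + height p * height q"
    by (intro add_mono mult_mono * ) (auto simp: less_imp_le height_pos)
  finally show ?thesis using height_pos[of p] height_pos[of q] by (simp add: chord_def divide_le_eq)
qed

lemma chord_pos: "p \<noteq> q \<Longrightarrow> chord p q > 0"
  using height_pos[of p] height_pos[of q]
  by (cases p; cases q) (auto simp: chord_def bracket_def)

lemma chord_Some: "cmod z \<le> 1 \<Longrightarrow> chord (Some z) (Some w) = cmod (z - w) / max (cmod w) 1"
  by (simp add: chord_def bracket_def height_def max_def)

lemma chord_from_homogeneous:
  assumes "x \<noteq> 0 \<or> y \<noteq> 0" "x' \<noteq> 0 \<or> y' \<noteq> 0"
  shows "chord (from_homogeneous x y) (from_homogeneous x' y')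
    = cmod (x * y' - y * x') / (max (cmod x) (cmod y) * max (cmod x') (cmod y'))"
proof -
  have hom: "\<exists>l. l \<noteq> 0 \<and> x = l * hom_x (from_homogeneous x y) \<and> y = l * hom_y (from_homogeneous x y)"
    if "x \<noteq> 0 \<or> y \<noteq> 0" for x y
    by (rule exI[of _ "if y = 0 then x else y"]) (use that in \<open>auto simp: from_homogeneous_def\<close>)
  define p q where "p = from_homogeneous x y" and "q = from_homogeneous x' y'"
  obtain l where l: "l \<noteq> 0" "x = l * hom_x p" "y = l * hom_y p" using hom[OF assms(1)] p_def by blast
  obtain m where m: "m \<noteq> 0" "x' = m * hom_x q" "y' = m * hom_y q" using hom[OF assms(2)] q_def by blast
  have h: "max (cmod (k * u)) (cmod (k * v)) = cmod k * max (cmod u) (cmod v)" for k u v :: complex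
    by (simp add: norm_mult max_mult_distrib_left)
  have "x * y' - y * x' = l * m * bracket p q"
    by (simp add: l m bracket_def algebra_simps)
  moreover have "max (cmod x) (cmod y) = cmod l * height p" "max (cmod x') (cmod y') = cmod m * height q"
    by (simp_all only: l(2,3) m(2,3) h height_def)
  ultimately show ?thesis using l(1) m(1) by (simp add: chord_def p_def q_def norm_mult)
qed

lemma inversion_hom: "inversion p = from_homogeneous (hom_y p) (hom_x p)"
  unfolding inversion_def by (subst moebius_eq) auto

lemma chord_inversion: "chord (inversion p) (inversion q) = chord p q"
  unfolding inversion_hom
  using hom_nonzero[of p] hom_nonzero[of q]
  by (subst chord_from_homogeneous)
     (auto simp: chord_def bracket_def height_def max.commute norm_minus_commute)

lemma inversion_inversion [simp]: "inversion (inversion p) = p"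
  unfolding inversion_eq by (cases p) (auto simp: rot_flip_apply)

text \<open>Moebius maps are conformal for this distance: the bracket picks up one factor for each point, and so
  does the normalisation. Every cross-ratio of chords is therefore invariant.\<close>

lemma chord_conformal:
  assumes "is_moebius f"
  obtains g where "\<And>p. g p > 0" "\<And>p q. chord (f p) (f q) = g p * g q * chord p q"
proof -
  obtain a b c d where f: "f = moebius a b c d" "a * d - b * c = 1"
    using assms by (rule is_moebiusE)
  define x y where "x p = a * hom_x p + b * hom_y p" and "y p = c * hom_x p + d * hom_y p" for p
  have nz: "x p \<noteq> 0 \<or> y p \<noteq> 0" for p
    unfolding x_def y_def by (rule nonsingular_apply[OF _ hom_nonzero]) (simp add: f)
  define m where "m p = max (cmod (x p)) (cmod (y p))" for p
  have m: "m p > 0" for p using nz[of p] by (auto simp: m_def less_max_iff_disj)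
  have "chord (f p) (f q) = (height p / m p) * (height q / m q) * chord p q" for p q
  proof -
    have "chord (f p) (f q) = cmod (x p * y q - y p * x q) / (m p * m q)"
      unfolding f(1) by (subst (1 2) moebius_eq) (use f(2) nz in \<open>simp_all add: x_def y_def m_def chord_from_homogeneous\<close>)
    also have "x p * y q - y p * x q = (a * d - b * c) * bracket p q"
      by (simp add: x_def y_def bracket_def algebra_simps)
    also have "\<dots> = bracket p q" using f(2) by simp
    finally show ?thesis using height_pos[of p] height_pos[of q] by (simp add: chord_def)
  qed
  then show ?thesis using that[of "\<lambda>p. height p / m p"] m height_pos by simp
qed

text \<open>Let \<open>N\<close> and \<open>M\<close> be clusters with mutual distances of order \<open>t\<close> in a set whose points are otherwise at
  distance at least \<open>\<kappa>\<close>. For \<open>a, b\<close> in one cluster and \<open>c, d\<close> in the other, the cross-ratio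
  \<open>\<chi> a b \<cdot> \<chi> c d / (\<chi> a c \<cdot> \<chi> b d)\<close> is of order \<open>t\<^sup>2\<close>. In every other position it is at least of order
  \<open>t\<close>: a factor of the numerator is bounded below, or else all four points lie in one cluster and the
  small factors cancel. A map preserving cross-ratios thus recognises the pair of clusters.\<close>

lemma clusters_permuted:
  fixes \<chi> :: "'a \<Rightarrow> 'a \<Rightarrow> real"
  assumes const: "0 < t" "0 < s" "s \<le> 1" "0 < \<kappa>" "\<kappa> \<le> 1" "16 * t < s * \<kappa> ^ 4"
    and sub: "N \<subseteq> \<alpha>" "M \<subseteq> \<alpha>" "N \<inter> M = {}"
    and bound: "\<And>p q. p \<in> \<alpha> \<Longrightarrow> q \<in> \<alpha> \<Longrightarrow> 0 \<le> \<chi> p q \<and> \<chi> p q \<le> 2"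
    and near: "\<And>p q. p \<in> N \<and> q \<in> N \<or> p \<in> M \<and> q \<in> M \<Longrightarrow> \<chi> p q \<le> 2 * t \<and> (p \<noteq> q \<longrightarrow> s * t \<le> \<chi> p q)"
    and far: "\<And>p q. p \<in> \<alpha> \<Longrightarrow> q \<in> \<alpha> \<Longrightarrow> p \<noteq> q \<Longrightarrow> \<not> (p \<in> N \<and> q \<in> N) \<Longrightarrow> \<not> (p \<in> M \<and> q \<in> M) \<Longrightarrow> \<kappa> \<le> \<chi> p q"
    and two: "x1 \<in> N" "x2 \<in> N" "x1 \<noteq> x2" "y1 \<in> M" "y2 \<in> M" "y1 \<noteq> y2"
    and f: "f ` \<alpha> \<subseteq> \<alpha>" "inj_on f \<alpha>"
    and g: "\<And>p. g p > 0" "\<And>p q. \<chi> (f p) (f q) = g p * g q * \<chi> p q"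
  shows "f ` N \<subseteq> N \<and> f ` M \<subseteq> M \<or> f ` N \<subseteq> M \<and> f ` M \<subseteq> N"
proof -
  have sk: "s * \<kappa> ^ 4 \<le> s * \<kappa>" "s * \<kappa> \<le> 1"
    using const by (auto intro!: mult_left_mono mult_le_one power_decreasing[of 1 4 \<kappa>, simplified])
  have t1: "t < 1" using sk const by linarith
  \<comment> \<open>a lower bound for any two points, in a common cluster or not\<close>
  have low: "s * \<kappa> * t \<le> \<chi> p q" if "p \<in> \<alpha>" "q \<in> \<alpha>" "p \<noteq> q" for p q
  proof (cases "p \<in> N \<and> q \<in> N \<or> p \<in> M \<and> q \<in> M")
    case True
    have "s * \<kappa> * t \<le> s * t" using const by (simp add: mult_le_cancel_right1 mult_le_cancel_left1)
    then show ?thesis using near[OF True] that(3) by linarith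
  next
    case False
    have "s * \<kappa> * t = \<kappa> * (s * t)" by simp
    also have "\<dots> \<le> \<kappa> * 1" using const t1 by (intro mult_left_mono mult_le_one) auto
    finally show ?thesis using far[OF that] False by auto
  qed
  have key: "f a \<in> N \<and> f b \<in> N \<and> f c \<in> M \<and> f d \<in> M \<or> f a \<in> M \<and> f b \<in> M \<and> f c \<in> N \<and> f d \<in> N"
    if abcd: "a \<in> N" "b \<in> N" "a \<noteq> b" "c \<in> M" "d \<in> M" "c \<noteq> d" for a b c d
  proof -
    have in\<alpha>: "a \<in> \<alpha>" "b \<in> \<alpha>" "c \<in> \<alpha>" "d \<in> \<alpha>" using abcd sub by auto
    then have F\<alpha>: "f a \<in> \<alpha>" "f b \<in> \<alpha>" "f c \<in> \<alpha>" "f d \<in> \<alpha>" using f(1) by auto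
    have neq: "f a \<noteq> f b" "f c \<noteq> f d" using abcd in\<alpha> f(2) by (auto dest: inj_onD)
    let ?AB = "\<chi> (f a) (f b)" and ?CD = "\<chi> (f c) (f d)" and ?AC = "\<chi> (f a) (f c)" and ?BD = "\<chi> (f b) (f d)"
    have "?AB * ?CD * (\<chi> a c * \<chi> b d) = \<chi> a b * \<chi> c d * (?AC * ?BD)"
      unfolding g(2) by (simp add: algebra_simps)
    moreover have "?AB * ?CD * (\<kappa> * \<kappa>) \<le> ?AB * ?CD * (\<chi> a c * \<chi> b d)"
      using bound F\<alpha> const abcd sub(3) in\<alpha>
      by (intro mult_left_mono mult_mono far) auto
    moreover have "\<chi> a b * \<chi> c d * (?AC * ?BD) \<le> (2 * t) * (2 * t) * (?AC * ?BD)"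
      using bound F\<alpha> in\<alpha> const near abcd by (intro mult_right_mono mult_mono) auto
    ultimately have *: "?AB * ?CD * (\<kappa> * \<kappa>) \<le> 4 * t * t * (?AC * ?BD)" by simp
    \<comment> \<open>a numerator of order t, not t squared, would make the image cross-ratio too large\<close>
    have spread: False if "\<kappa> * (s * \<kappa> * t) \<le> ?AB * ?CD"
    proof -
      have "\<kappa> * (s * \<kappa> * t) * (\<kappa> * \<kappa>) \<le> ?AB * ?CD * (\<kappa> * \<kappa>)"
        using that const by (intro mult_right_mono) auto
      also have "\<dots> \<le> 4 * t * t * (?AC * ?BD)" by (rule *)
      also have "\<dots> \<le> 4 * t * t * (2 * 2)"
        using bound F\<alpha> const by (intro mult_left_mono mult_mono) auto
      finally have "t * (s * \<kappa> ^ 4) \<le> t * (16 * t)" by (simp add: eval_nat_numeral mult_ac)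
      then show False using const by simp
    qed
    have ab: "f a \<in> N \<and> f b \<in> N \<or> f a \<in> M \<and> f b \<in> M"
    proof (rule ccontr)
      assume "\<not> ?thesis"
      then have "\<kappa> * (s * \<kappa> * t) \<le> ?AB * ?CD"
        using far[OF F\<alpha>(1,2) neq(1)] low[OF F\<alpha>(3,4) neq(2)] const bound F\<alpha> by (intro mult_mono) auto
      then show False by (rule spread)
    qed
    have cd: "f c \<in> N \<and> f d \<in> N \<or> f c \<in> M \<and> f d \<in> M"
    proof (rule ccontr)
      assume "\<not> ?thesis"
      then have "(s * \<kappa> * t) * \<kappa> \<le> ?AB * ?CD"
        using far[OF F\<alpha>(3,4) neq(2)] low[OF F\<alpha>(1,2) neq(1)] const bound F\<alpha> by (intro mult_mono) auto
      then show False using spread by (simp add: mult.commute)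
    qed
    have "\<not> (f a \<in> N \<and> f c \<in> N) \<and> \<not> (f a \<in> M \<and> f c \<in> M)"
    proof (rule ccontr)
      assume "\<not> ?thesis"
      then have same: "f a \<in> N \<and> f b \<in> N \<and> f c \<in> N \<and> f d \<in> N \<or> f a \<in> M \<and> f b \<in> M \<and> f c \<in> M \<and> f d \<in> M"
        using ab cd sub(3) by blast
      then have "s * t \<le> ?AB" "s * t \<le> ?CD" "?AC \<le> 2 * t" "?BD \<le> 2 * t"
        using near neq by blast+
      then have "(s * t) * (s * t) \<le> ?AB * ?CD" and "?AC * ?BD \<le> (2 * t) * (2 * t)"
        using const bound F\<alpha> by (intro mult_mono; simp)+
      then have "(s * t) * (s * t) * (\<kappa> * \<kappa>) \<le> ?AB * ?CD * (\<kappa> * \<kappa>)"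
        and "4 * t * t * (?AC * ?BD) \<le> 4 * t * t * ((2 * t) * (2 * t))"
        using const by (intro mult_right_mono mult_left_mono; simp)+
      with * have "(s * t) * (s * t) * (\<kappa> * \<kappa>) \<le> 4 * t * t * ((2 * t) * (2 * t))" by linarith
      then have "(t * (s * \<kappa>))\<^sup>2 \<le> (t * (4 * t))\<^sup>2" by (simp add: power2_eq_square mult_ac)
      then have "t * (s * \<kappa>) \<le> t * (4 * t)" by (rule power2_le_imp_le) (use const in simp)
      then have "s * \<kappa> \<le> 4 * t" using const by simp
      then show False using sk const by linarith
    qed
    then show ?thesis using ab cd by blast
  qed
  have N: "(f b \<in> N \<longleftrightarrow> f x1 \<in> N) \<and> (f b \<in> N \<or> f b \<in> M)" if "b \<in> N" for b
  proof (cases "b = x1")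
    case True
    then show ?thesis using key[OF two] by blast
  next
    case False
    then show ?thesis using key[OF two(1) that _ two(4,5,6)] sub(3) by blast
  qed
  have M: "(f c \<in> M \<longleftrightarrow> f x1 \<in> N) \<and> (f c \<in> N \<or> f c \<in> M)" if "c \<in> M" for c
  proof (cases "c = y1")
    case True
    then show ?thesis using key[OF two] sub(3) by blast
  next
    case False
    then show ?thesis using key[OF two(1,2,3) two(4) that] sub(3) by blast
  qed
  show ?thesis using N M by blast
qed

section \<open>Sets with exactly dihedral symmetry\<close>

text \<open>The cluster at 0 is a rescaling of a fixed finite set, so that its mutual distances are exactly
  proportional to \<open>t\<close>. The cluster at infinity is its image under inversion.\<close>

definition near_zero :: "real \<Rightarrow> complex set \<Rightarrow> sphere set" where
  "near_zero t R = (\<lambda>r. Some (complex_of_real t * r)) ` R"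

lemma near_zero_roots:
  assumes "n \<ge> 1" "t > 0"
  shows "near_zero t {r. r ^ n = 1} = Some ` {z. z ^ n = of_real t ^ n}"
    and "inversion ` near_zero t {r. r ^ n = 1} = Some ` {z. z ^ n = inverse (of_real t ^ n)}"
proof -
  have t: "complex_of_real t \<noteq> 0" using assms by simp
  have "z ^ n = of_real t ^ n \<longleftrightarrow> (\<exists>r. r ^ n = 1 \<and> z = of_real t * r)" for z :: complex
  proof
    assume "z ^ n = of_real t ^ n"
    then show "\<exists>r. r ^ n = 1 \<and> z = of_real t * r"
      using t by (intro exI[of _ "z / of_real t"]) (auto simp: power_divide)
  qed (auto simp: power_mult_distrib)
  then show 1: "near_zero t {r. r ^ n = 1} = Some ` {z. z ^ n = of_real t ^ n}"
    by (auto simp: near_zero_def)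
  have "inversion ` Some ` {z. z ^ n = of_real t ^ n} = Some ` {z. z ^ n = inverse (of_real t ^ n)}"
    (is "?L = ?R")
  proof (intro equalityI subsetI)
    fix p assume "p \<in> ?L"
    then obtain z where z: "p = inversion (Some z)" "z ^ n = of_real t ^ n" by auto
    then have "z \<noteq> 0" using t assms(1) by (auto simp: power_0_left)
    then have "p = Some (inverse z)" using z by (simp add: inversion_eq rot_flip_apply inverse_eq_divide)
    then show "p \<in> ?R" using z by (simp add: power_inverse)
  next
    fix p assume "p \<in> ?R"
    then obtain z where z: "p = Some z" "z ^ n = inverse (of_real t ^ n)" by auto
    then have "z \<noteq> 0" using t assms(1) by (auto simp: power_0_left)
    then have "p = inversion (Some (inverse z))"
      using z by (simp add: inversion_eq rot_flip_apply divide_inverse)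
    moreover have "inverse z ^ n = of_real t ^ n" using z by (simp add: power_inverse)
    ultimately show "p \<in> ?L" by blast
  qed
  then show "inversion ` near_zero t {r. r ^ n = 1} = Some ` {z. z ^ n = inverse (of_real t ^ n)}"
    unfolding 1 .
qed

lemma norm_root_of_unity:
  assumes "n \<ge> 1" "w ^ n = 1"
  shows "cmod w = 1"
proof -
  have "cmod w ^ n = 1 ^ n" using assms(2) by (metis norm_one norm_power power_one)
  then show ?thesis by (rule power_eq_imp_eq_base[of _ n]) (use assms in auto)
qed

text \<open>The sum over a cluster consisting of a regular polygon and its centre 0 is zero. Summing
  \<open>c z f(z) + d f(z) = a z + b\<close> over the cluster \<open>S\<close>, which \<open>f\<close> permutes, leaves
  \<open>c \<Sum> z f(z) = |S| b\<close> and so \<open>|b| \<le> |c| t\<^sup>2\<close>. On the other hand, if \<open>f\<close> moves 0, then \<open>|b/d| = t\<close>, while the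
  pole \<open>-d/c\<close> in the cluster at infinity has modulus \<open>1/t\<close>; this gives \<open>|b| = |c|\<close>.\<close>

lemma centred_cluster_fixes_zero:
  assumes n: "n \<ge> 2" and t: "0 < t" "t < 1" and det: "a * d - b * c = 1"
    and N: "N = near_zero t (insert 0 {r. r ^ n = 1})"
    and maps: "moebius a b c d ` N = N" "moebius a b c d ` (inversion ` N) = inversion ` N"
  shows "b = 0"
proof (rule ccontr)
  assume b: "b \<noteq> 0"
  define S where "S = (\<lambda>r. complex_of_real t * r) ` insert 0 {r. r ^ n = 1}"
  have NS: "N = Some ` S" by (simp add: N near_zero_def S_def image_image)
  have fin: "finite S" unfolding S_def using n by (auto intro!: finite_imageI finite_nth_roots)
  have "n \<noteq> 0" using n by simp
  have normS: "cmod z = t \<or> z = 0" if "z \<in> S" for z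
    using that t norm_root_of_unity[of n] n by (auto simp: S_def norm_mult)
  have sumS: "\<Sum>S = 0"
  proof -
    have "\<Sum>S = (\<Sum>r\<in>insert 0 {r. r ^ n = 1}. complex_of_real t * r)"
      unfolding S_def by (subst sum.reindex) (use t in \<open>auto simp: inj_on_def\<close>)
    also have "\<dots> = of_real t * \<Sum>(insert 0 {r. r ^ n = 1})"
      by (simp add: sum_distrib_left)
    also have "\<Sum>(insert 0 {r::complex. r ^ n = 1}) = \<Sum>{r. r ^ n = 1}"
      using n by (subst sum.insert_if) (auto intro: finite_nth_roots)
    also have "\<dots> = 0" using n by (intro sum_roots_unity) simp
    finally show ?thesis by simp
  qed
  define \<phi> where "\<phi> z = the (moebius a b c d (Some z))" for z
  have \<phi>: "moebius a b c d (Some z) = Some (\<phi> z)" "\<phi> z \<in> S" if "z \<in> S" for z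
  proof -
    have "moebius a b c d (Some z) \<in> Some ` S" using maps(1) that unfolding NS by blast
    then show "moebius a b c d (Some z) = Some (\<phi> z)" "\<phi> z \<in> S" by (auto simp: \<phi>_def)
  qed
  have inj: "inj (moebius a b c d)"
    using det by (intro is_moebius_inj is_moebiusI) simp
  have "inj_on \<phi> S"
  proof (rule inj_onI)
    fix z w assume "z \<in> S" "w \<in> S" "\<phi> z = \<phi> w"
    then have "moebius a b c d (Some z) = moebius a b c d (Some w)" using \<phi> by simp
    then show "z = w" using inj by (auto dest: injD)
  qed
  moreover have "\<phi> ` S \<subseteq> S" using \<phi> by blast
  ultimately have "bij_betw \<phi> S S" using endo_inj_surj[OF fin] by (simp add: bij_betw_def)
  then have sum\<phi>: "(\<Sum>z\<in>S. \<phi> z) = 0" using sumS sum.reindex_bij_betw[of \<phi> S S "\<lambda>z. z"] by simp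
  have eq: "c * (z * \<phi> z) + d * \<phi> z = a * z + b" if "z \<in> S" for z
    using \<phi>(1)[OF that] by (auto simp: moebius_def field_simps split: if_splits)
  have "c * (\<Sum>z\<in>S. z * \<phi> z) + d * (\<Sum>z\<in>S. \<phi> z) = (\<Sum>z\<in>S. c * (z * \<phi> z) + d * \<phi> z)"
    by (simp add: sum.distrib sum_distrib_left)
  also have "\<dots> = (\<Sum>z\<in>S. a * z + b)" using eq by (intro sum.cong) auto
  also have "\<dots> = a * \<Sum>S + of_nat (card S) * b" by (simp add: sum.distrib sum_distrib_left)
  finally have id: "c * (\<Sum>z\<in>S. z * \<phi> z) = of_nat (card S) * b" using sumS sum\<phi> by simp
  have "cmod (\<Sum>z\<in>S. z * \<phi> z) \<le> real (card S) * t\<^sup>2"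
  proof (rule order_trans[OF norm_sum sum_bounded_above[where K = "t\<^sup>2", simplified]])
    fix z assume "z \<in> S"
    then have "cmod z \<le> t" "cmod (\<phi> z) \<le> t" using normS[of z] normS[of "\<phi> z"] \<phi>(2) t by auto
    then show "cmod (z * \<phi> z) \<le> t\<^sup>2" using t by (auto simp: norm_mult power2_eq_square intro: mult_mono)
  qed
  then have "cmod c * cmod (\<Sum>z\<in>S. z * \<phi> z) \<le> cmod c * (real (card S) * t\<^sup>2)"
    by (intro mult_left_mono) auto
  then have "real (card S) * cmod b \<le> real (card S) * (cmod c * t\<^sup>2)"
    using arg_cong[OF id, of cmod] by (simp add: norm_mult mult_ac)
  moreover have "0 \<in> S" by (auto simp: S_def)
  then have "card S > 0" using fin by (auto simp: card_gt_0_iff)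
  ultimately have bc: "cmod b \<le> cmod c * t\<^sup>2" by simp
  then have c: "c \<noteq> 0" using b by auto
  have "None \<in> inversion ` N"
  proof
    show "None = inversion (Some 0)" by (simp add: inversion_eq rot_flip_apply)
    show "Some 0 \<in> N" using \<open>0 \<in> S\<close> NS by simp
  qed
  \<comment> \<open>the pole lies in the cluster at infinity, because the image of that cluster contains infinity\<close>
  then obtain p where p: "p \<in> N" "moebius a b c d (inversion p) = None" using maps(2) by force
  obtain z where z: "p = Some z" "z \<in> S" using p(1) NS by auto
  have "z \<noteq> 0" using p(2) c unfolding z(1) by (auto simp: inversion_eq rot_flip_apply moebius_def split: if_splits)
  then have "c / z + d = 0" "cmod z = t"
    using p(2) normS[OF z(2)] unfolding z(1) by (auto simp: inversion_eq rot_flip_apply moebius_def split: if_splits)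
  then have "d = - (c / z)" by (simp add: add_eq_0_iff)
  then have d: "cmod d = cmod c / t" using \<open>cmod z = t\<close> by (simp add: norm_divide)
  then have "d \<noteq> 0" using c t by auto
  have "\<phi> 0 = b / d" using \<phi>(1)[OF \<open>0 \<in> S\<close>] \<open>d \<noteq> 0\<close> by (simp add: moebius_def)
  then have "cmod (b / d) = t" using normS[OF \<phi>(2)[OF \<open>0 \<in> S\<close>]] b \<open>d \<noteq> 0\<close> by simp
  then have "cmod b = cmod c" using d t c \<open>d \<noteq> 0\<close> by (simp add: norm_divide field_simps)
  moreover have "cmod c * t\<^sup>2 < cmod c * 1" using c t by (intro mult_strict_left_mono) (auto simp: power_less_one_iff)
  ultimately show False using bc by simp
qed

text \<open>Without the centres, the coefficient of \<open>z\<close> is compared for the two polygons \<open>z\<^sup>n = u\<close> and \<open>z\<^sup>n = 1/u\<close>: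
  \<open>a b\<^sup>n\<^sup>-\<^sup>1\<close> equals both \<open>u c d\<^sup>n\<^sup>-\<^sup>1\<close> and \<open>u\<^sup>-\<^sup>1 c d\<^sup>n\<^sup>-\<^sup>1\<close>, hence vanishes, and the matrix is diagonal or
  antidiagonal. With the centres, the map fixes 0, and infinity as well after conjugation by the inversion.\<close>

lemma cluster_preserving_in_dihedral_maps:
  assumes n: "n \<ge> 2" and t: "0 < t" "t < 1" and f: "is_moebius f"
    and N: "N = near_zero t R" "R = {r. r ^ n = 1} \<or> R = insert 0 {r. r ^ n = 1}"
    and maps: "f ` N \<subseteq> N" "f ` (inversion ` N) \<subseteq> inversion ` N"
  shows "f \<in> dihedral_maps n"
proof -
  obtain a b c d where abcd: "f = moebius a b c d" "a * d - b * c = 1"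
    using f by (rule is_moebiusE)
  have n1: "n \<ge> 1" using n by simp
  let ?t = "complex_of_real t"
  define u where "u = ?t ^ n"
  have u0: "u \<noteq> 0" using t by (simp add: u_def)
  have normu: "cmod u < 1" using t n1 by (simp add: u_def norm_power power_less_one_iff)
  from N(2) show ?thesis
  proof
    assume R: "R = {r. r ^ n = 1}"
    have NM: "N = Some ` {z. z ^ n = u}" "inversion ` N = Some ` {z. z ^ n = inverse u}"
      unfolding N R u_def using near_zero_roots[OF n1 t(1)] by simp_all
    have m1: "moebius a b c d (Some z) \<in> Some ` {w. w ^ n = u}" if "z ^ n = u" for z
      using subsetD[OF maps(1) imageI, of "Some z"] that unfolding NM(1) abcd(1) by simp
    have m2: "moebius a b c d (Some z) \<in> Some ` {w. w ^ n = inverse u}" if "z ^ n = inverse u" for z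
      using subsetD[OF maps(2) imageI, of "Some z"] that unfolding NM(2) abcd(1) by simp
    have e1: "a * b ^ (n - 1) = u * (c * d ^ (n - 1))"
      using root_set_coefficients[OF n1 u0 m1, of 1] n by simp
    have e2: "a * b ^ (n - 1) = inverse u * (c * d ^ (n - 1))"
      using root_set_coefficients[OF n1 _ m2, of 1] n u0 by simp
    have "cmod u * cmod u \<le> cmod u * 1" using normu by (intro mult_left_mono) auto
    then have uu: "cmod u * cmod u < 1" using normu by simp
    then have "u * u \<noteq> 1" by (metis norm_mult norm_one less_irrefl)
    then have "u \<noteq> inverse u" using u0 by (auto simp: field_simps)
    then have "c * d ^ (n - 1) = 0" using e1 e2 by simp
    then have cd: "c = 0 \<or> d = 0" by auto
    have "a * b ^ (n - 1) = 0" unfolding e1 \<open>c * d ^ (n - 1) = 0\<close> by simp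
    then have ab: "a = 0 \<or> b = 0" by auto
    obtain w where w: "w ^ n = u" "moebius a b c d (Some ?t) = Some w" using m1[of ?t] by (auto simp: u_def)
    show ?thesis
    proof (cases "b = 0")
      case True
      then have "c = 0" "a \<noteq> 0" "d \<noteq> 0" using abcd(2) cd by auto
      then show ?thesis
        unfolding abcd(1) using True w u0 by (auto intro!: diagonal_in_dihedral_maps[of _ _ ?t _ w] simp: u_def)
    next
      case False
      then have 0: "a = 0" "d = 0" "c \<noteq> 0" using abcd(2) ab cd by auto
      have "inverse ?t ^ n = inverse u" by (simp add: u_def power_inverse)
      from m2[OF this] obtain w' where w': "w' ^ n = inverse u" "moebius a b c d (Some (inverse ?t)) = Some w'" by auto
      have "w = b / c / ?t" "w' = b / c * ?t" using w(2) w'(2) 0 t by (auto simp: moebius_def field_simps split: if_splits)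
      then have "w * ?t = w' * inverse ?t" using t by (simp add: field_simps)
      then have "u * u = inverse u * inverse u"
        using w(1) w'(1) by (metis power_mult_distrib u_def power_inverse)
      then have "(u * u) * (u * u) = 1" using u0 by (simp add: field_simps)
      then have "(cmod u * cmod u) * (cmod u * cmod u) = 1" by (metis norm_mult norm_one)
      moreover have "(cmod u * cmod u) * (cmod u * cmod u) \<le> (cmod u * cmod u) * 1"
        using uu by (intro mult_left_mono) auto
      ultimately show ?thesis using uu by simp
    qed
  next
    assume R: "R = insert 0 {r. r ^ n = 1}"
    have fin: "finite N" unfolding N R near_zero_def using n1 by (auto intro!: finite_imageI finite_nth_roots)
    have inj: "inj f" by (rule is_moebius_inj[OF f])
    have fN: "f ` N = N" "f ` (inversion ` N) = inversion ` N"
      using endo_inj_surj[OF fin maps(1)] endo_inj_surj[OF finite_imageI[OF fin] maps(2)] inj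
      by (auto simp: inj_on_subset)
    have N': "N = near_zero t (insert 0 {r. r ^ n = 1})" by (simp add: N R)
    have "b = 0"
      by (rule centred_cluster_fixes_zero[OF n t abcd(2) N']) (use fN in \<open>simp_all add: abcd(1)\<close>)
    moreover have "c = 0"
    proof (rule centred_cluster_fixes_zero[OF n t _ N'])
      show "d * a - c * b = 1" using abcd(2) by (simp add: algebra_simps)
      have "c * b - d * a = - (a * d - b * c)" by (simp add: algebra_simps)
      then have det: "c * b - d * a \<noteq> 0" using abcd(2) by simp
      have "inversion \<circ> f = moebius c d a b"
        unfolding inversion_def abcd(1) by (subst moebius_comp) (use abcd(2) in auto)
      then have conj: "moebius d c b a = inversion \<circ> f \<circ> inversion"
        unfolding inversion_def using det by (simp add: moebius_comp)
      have inv2: "inversion ` inversion ` N = N" by (simp add: image_comp o_def)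
      show "moebius d c b a ` N = N"
        unfolding conj image_comp[symmetric] using fN(2) inv2 by simp
      show "moebius d c b a ` (inversion ` N) = inversion ` N"
        unfolding conj image_comp[symmetric] using fN(1) inv2 by simp
    qed
    ultimately have ad: "a \<noteq> 0" "d \<noteq> 0" "f = moebius a 0 0 d" using abcd by auto
    have "Some ?t \<in> N" unfolding N R near_zero_def by (rule image_eqI[of _ _ 1]) auto
    then have "f (Some ?t) \<in> N" using maps(1) by blast
    then obtain r where r: "f (Some ?t) = Some (?t * r)" "r \<in> R"
      unfolding N near_zero_def by blast
    have "r \<noteq> 0" using r(1) ad t by (auto simp: moebius_def)
    then have "r ^ n = 1" using r(2) R by simp
    then show ?thesis
      using r(1) ad t unfolding ad(3)
      by (intro diagonal_in_dihedral_maps[of _ _ ?t _ "?t * r"]) (auto simp: power_mult_distrib)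
  qed
qed

lemma finite_positive_lower_bound:
  fixes h :: "'a \<Rightarrow> real"
  assumes "finite Y" "\<And>x. x \<in> Y \<Longrightarrow> h x > 0"
  obtains e where "0 < e" "e \<le> 1" "\<And>x. x \<in> Y \<Longrightarrow> e \<le> h x"
proof -
  have "0 < Min (insert 1 (h ` Y))" using assms by (subst Min_gr_iff) auto
  moreover have "Min (insert 1 (h ` Y)) \<le> y" if "y \<in> insert 1 (h ` Y)" for y
    using assms(1) that by (intro Min_le) auto
  ultimately show ?thesis using that[of "Min (insert 1 (h ` Y))"] by auto
qed

text \<open>The three estimates that follow are the hypotheses of the cluster lemma: distances inside the cluster at
  0, between the two clusters, and from the cluster at 0 to the remaining points.\<close>

lemma chord_near_zero:
  assumes n: "n \<ge> 1" and t: "0 < t" "t < 1"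
    and R: "R = {r. r ^ n = 1} \<or> R = insert 0 {r. r ^ n = 1}"
    and s: "\<And>r r'. r \<in> R \<Longrightarrow> r' \<in> R \<Longrightarrow> r \<noteq> r' \<Longrightarrow> s \<le> cmod (r - r')"
    and pq: "p \<in> near_zero t R" "q \<in> near_zero t R"
  shows "chord p q \<le> 2 * t \<and> (p \<noteq> q \<longrightarrow> s * t \<le> chord p q)"
proof -
  obtain r r' where r: "p = Some (of_real t * r)" "r \<in> R" "q = Some (of_real t * r')" "r' \<in> R"
    using pq by (auto simp: near_zero_def)
  have norm: "cmod r \<le> 1" if "r \<in> R" for r
    using that R norm_root_of_unity[OF n] by auto
  have small: "cmod (of_real t * r) \<le> 1" if "r \<in> R" for r
    using norm[OF that] t by (simp add: norm_mult mult_le_one)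
  have "chord p q = cmod (of_real t * r - of_real t * r')"
    using small[OF r(2)] small[OF r(4)] unfolding r by (subst chord_Some) auto
  also have "\<dots> = t * cmod (r - r')"
    using t by (simp add: norm_mult flip: right_diff_distrib)
  finally have eq: "chord p q = t * cmod (r - r')" .
  have "cmod (r - r') \<le> 2" using norm[OF r(2)] norm[OF r(4)] norm_triangle_ineq4[of r r'] by linarith
  moreover have "s \<le> cmod (r - r')" if "p \<noteq> q" using s r that by auto
  ultimately show ?thesis unfolding eq using t by (simp add: mult.commute[of s t])
qed

lemma chord_zero_infinity:
  assumes "cmod z \<le> t" "cmod y \<le> t" "t \<le> 1 / 2"
  shows "1 / 2 \<le> chord (Some z) (inversion (Some y))"
proof -
  have "chord (Some z) (inversion (Some y)) = chord (from_homogeneous z 1) (from_homogeneous 1 y)"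
    unfolding inversion_hom by (simp add: from_homogeneous_def)
  also have "\<dots> = cmod (z * y - 1) / (max (cmod z) 1 * max 1 (cmod y))"
    by (subst chord_from_homogeneous) auto
  also have "\<dots> = cmod (1 - z * y)" using assms by (simp add: max_def norm_minus_commute)
  finally have eq: "chord (Some z) (inversion (Some y)) = cmod (1 - z * y)" .
  have "cmod (z * y) \<le> (1 / 2) * 1" unfolding norm_mult using assms by (intro mult_mono) auto
  then show ?thesis unfolding eq using norm_triangle_ineq2[of 1 "z * y"] by simp
qed

lemma chord_zero_middle:
  assumes "cmod z \<le> t" "t \<le> \<kappa>" "2 * \<kappa> \<le> cmod w" "\<kappa> \<le> 1 / 2"
  shows "\<kappa> \<le> chord (Some z) (Some w)"
proof -
  have eq: "chord (Some z) (Some w) = cmod (z - w) / max (cmod w) 1"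
    using assms by (intro chord_Some) simp
  have "cmod w - \<kappa> \<le> cmod (z - w)" using assms norm_triangle_ineq3[of w z] by (simp add: norm_minus_commute abs_le_iff)
  moreover have "\<kappa> * max (cmod w) 1 \<le> cmod w - \<kappa>"
  proof (cases "cmod w \<ge> 1")
    case True
    have "\<kappa> * cmod w \<le> (1 / 2) * cmod w" using assms by (intro mult_right_mono) auto
    then show ?thesis using True assms by (simp add: max_def)
  next
    case False
    then show ?thesis using assms by (simp add: max_def)
  qed
  ultimately show ?thesis unfolding eq by (simp add: pos_le_divide_eq)
qed

text \<open>The minimal distances \<open>s\<close> in \<open>R\<close> and \<open>\<kappa>\<close> outside the clusters do not depend on \<open>t\<close>, so every small enough
  \<open>t\<close> separates the orders \<open>t\<^sup>2\<close> and \<open>t\<close> of the cross-ratios.\<close>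

lemma small_orbit_forces_dihedral:
  assumes n: "n \<ge> 2" and F: "finite F" "0 \<notin> F" "\<And>w. w \<in> F \<Longrightarrow> inverse w \<in> F"
    and R: "R = {r. r ^ n = 1} \<or> R = insert 0 {r. r ^ n = 1}"
  obtains t0 where "0 < t0"
    "\<And>t f \<alpha>. 0 < t \<Longrightarrow> t < t0 \<Longrightarrow> \<alpha> = Some ` F \<union> near_zero t R \<union> inversion ` near_zero t R
       \<Longrightarrow> is_moebius f \<Longrightarrow> f ` \<alpha> = \<alpha> \<Longrightarrow> f \<in> dihedral_maps n"
proof -
  have n1: "n \<ge> 1" using n by simp
  have finR: "finite R" using R n1 by (auto intro: finite_nth_roots)
  obtain s where s: "0 < s" "s \<le> 1" "\<And>x. x \<in> {(r, r') \<in> R \<times> R. r \<noteq> r'} \<Longrightarrow> s \<le> cmod (fst x - snd x)"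
    by (rule finite_positive_lower_bound[of "{(r, r') \<in> R \<times> R. r \<noteq> r'}" "\<lambda>x. cmod (fst x - snd x)"])
       (use finR in \<open>auto intro: finite_subset[of _ "R \<times> R"]\<close>)
  obtain k where k: "0 < k" "k \<le> 1"
      "\<And>x. x \<in> {(w, w') \<in> F \<times> F. w \<noteq> w'} \<Longrightarrow> k \<le> chord (Some (fst x)) (Some (snd x))"
    by (rule finite_positive_lower_bound[of "{(w, w') \<in> F \<times> F. w \<noteq> w'}" "\<lambda>x. chord (Some (fst x)) (Some (snd x))"])
       (use F(1) in \<open>auto intro: chord_pos finite_subset[of _ "F \<times> F"]\<close>)
  obtain \<delta> where \<delta>: "0 < \<delta>" "\<delta> \<le> 1" "\<And>w. w \<in> F \<Longrightarrow> \<delta> \<le> cmod w"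
    by (rule finite_positive_lower_bound[of F cmod]) (use F in auto)
  define \<kappa> where "\<kappa> = min k (\<delta> / 2)"
  have \<kappa>: "0 < \<kappa>" "\<kappa> \<le> 1 / 2" "\<kappa> \<le> k" "2 * \<kappa> \<le> \<delta>" using k \<delta> by (auto simp: \<kappa>_def)
  show ?thesis
  proof (rule that[of "s * \<kappa> ^ 4 / 16"])
    show "0 < s * \<kappa> ^ 4 / 16" using s \<kappa> by simp
    fix t f \<alpha>
    assume t: "0 < t" "t < s * \<kappa> ^ 4 / 16"
      and \<alpha>: "\<alpha> = Some ` F \<union> near_zero t R \<union> inversion ` near_zero t R"
      and f: "is_moebius f" "f ` \<alpha> = \<alpha>"
    define N M where "N = near_zero t R" and "M = inversion ` N"
    have \<alpha>': "\<alpha> = Some ` F \<union> N \<union> M" by (simp add: \<alpha> N_def M_def)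
    have "\<kappa> ^ 4 \<le> \<kappa>" using \<kappa> power_decreasing[of 1 4 \<kappa>] by simp
    then have "s * \<kappa> ^ 4 \<le> 1 * \<kappa>" using s \<kappa> by (intro mult_mono) auto
    then have t\<kappa>: "t \<le> \<kappa>" "t \<le> 1 / 2" "t < 1" using t \<kappa> by auto
    have MN: "inversion ` M = N" by (simp add: M_def image_comp o_def)
    have inv\<alpha>: "inversion p \<in> \<alpha>" if "p \<in> \<alpha>" for p
    proof -
      have "inversion (Some w) \<in> Some ` F" if "w \<in> F" for w
        using F(2) F(3)[OF that] that by (auto simp: inversion_eq rot_flip_apply simp flip: inverse_eq_divide)
      then show ?thesis using that MN unfolding \<alpha>' M_def by auto
    qed
    have N_norm: "\<exists>z. p = Some z \<and> cmod z \<le> t" if "p \<in> N" for p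
      using that R norm_root_of_unity[OF n1] t by (auto simp: N_def near_zero_def norm_mult)
    have farNM: "\<kappa> \<le> chord p q" if pq: "p \<in> N" "q \<in> M" for p q
    proof -
      obtain z where z: "p = Some z" "cmod z \<le> t" using N_norm[OF pq(1)] by blast
      obtain p' where "q = inversion p'" "p' \<in> N" using pq(2) by (auto simp: M_def)
      then obtain y where y: "q = inversion (Some y)" "cmod y \<le> t" using N_norm by blast
      show ?thesis using chord_zero_infinity[OF z(2) y(2) t\<kappa>(2)] \<kappa>(2) unfolding z(1) y(1) by simp
    qed
    have farN: "\<kappa> \<le> chord p q" if pq: "p \<in> N" "q \<in> \<alpha>" "q \<notin> N" for p q
    proof (cases "q \<in> M")
      case True
      then show ?thesis by (rule farNM[OF pq(1)])
    next
      case False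
      then obtain w where w: "q = Some w" "w \<in> F" using pq unfolding \<alpha>' by auto
      obtain z where z: "p = Some z" "cmod z \<le> t" using N_norm[OF pq(1)] by blast
      have "2 * \<kappa> \<le> cmod w" using \<delta>(3)[OF w(2)] \<kappa>(4) by simp
      then show ?thesis unfolding z(1) w(1) by (intro chord_zero_middle[OF z(2) t\<kappa>(1) _ \<kappa>(2)])
    qed
    have farM: "\<kappa> \<le> chord p q" if "p \<in> M" "q \<in> \<alpha>" "q \<notin> M" for p q
    proof -
      have "inversion p \<in> N" using that(1) MN by blast
      moreover have "inversion q \<notin> N" using that(3) unfolding M_def by (metis image_eqI inversion_inversion)
      ultimately have "\<kappa> \<le> chord (inversion p) (inversion q)" using farN inv\<alpha>[OF that(2)] by blast
      then show ?thesis by (simp add: chord_inversion)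
    qed
    have disj: "N \<inter> M = {}"
    proof (rule ccontr)
      assume "N \<inter> M \<noteq> {}"
      then obtain p where "p \<in> N" "p \<in> M" by blast
      from farNM[OF this] show False using \<kappa> by simp
    qed
    have near: "chord p q \<le> 2 * t \<and> (p \<noteq> q \<longrightarrow> s * t \<le> chord p q)" if "p \<in> N" "q \<in> N" for p q
      by (rule chord_near_zero[OF n1 t(1) t\<kappa>(3) R]) (use that s(3) in \<open>auto simp: N_def\<close>)
    define w where "w = cis (2 * pi / real n)"
    have w: "w ^ n = 1" "w \<noteq> 1"
      using primitive_root(1)[OF n1] inj_onD[OF primitive_root(3)[OF n1], of 1 0] n
      by (auto simp: w_def)
    \<comment> \<open>two points in each cluster, available because n is at least 2\<close>
    define x1 x2 where "x1 = Some (complex_of_real t)" and "x2 = Some (complex_of_real t * w)"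
    have x: "x1 \<in> N" "x2 \<in> N" "x1 \<noteq> x2"
    proof -
      have "1 \<in> R" "w \<in> R" using R w by auto
      then show "x1 \<in> N" "x2 \<in> N"
        unfolding x1_def x2_def N_def near_zero_def by (auto intro: image_eqI[of _ _ 1])
      show "x1 \<noteq> x2" using w t by (simp add: x1_def x2_def)
    qed
    have y: "inversion x1 \<in> M" "inversion x2 \<in> M" "inversion x1 \<noteq> inversion x2"
      using x inversion_inversion unfolding M_def by (blast, blast, metis)
    obtain g where g: "\<And>p. g p > 0" "\<And>p q. chord (f p) (f q) = g p * g q * chord p q"
      using chord_conformal[OF f(1)] by blast
    have "f ` N \<subseteq> N \<and> f ` M \<subseteq> M \<or> f ` N \<subseteq> M \<and> f ` M \<subseteq> N"
    proof (rule clusters_permuted[where \<chi> = chord and \<alpha> = \<alpha> and s = s and \<kappa> = \<kappa> and t = t and g = g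
          and ?x1.0 = x1 and ?x2.0 = x2 and ?y1.0 = "inversion x1" and ?y2.0 = "inversion x2"])
      show "16 * t < s * \<kappa> ^ 4" using t by simp
      show "0 \<le> chord p q \<and> chord p q \<le> 2" for p q
        using chord_le_2[of p q] chord_pos[of p q] by (cases "p = q") auto
      show "chord p q \<le> 2 * t \<and> (p \<noteq> q \<longrightarrow> s * t \<le> chord p q)" if "p \<in> N \<and> q \<in> N \<or> p \<in> M \<and> q \<in> M" for p q
        using that
      proof
        assume "p \<in> M \<and> q \<in> M"
        then have "inversion p \<in> N" "inversion q \<in> N" using MN by blast+
        moreover have "inversion p \<noteq> inversion q" if "p \<noteq> q" using that by (metis inversion_inversion)
        ultimately show ?thesis using near[of "inversion p" "inversion q"] by (auto simp: chord_inversion)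
      qed (use near in blast)
      show "\<kappa> \<le> chord p q"
        if pq: "p \<in> \<alpha>" "q \<in> \<alpha>" "p \<noteq> q" "\<not> (p \<in> N \<and> q \<in> N)" "\<not> (p \<in> M \<and> q \<in> M)" for p q
      proof -
        consider "p \<in> N" | "p \<in> M" | "q \<in> N" | "q \<in> M" | "p \<in> Some ` F" "q \<in> Some ` F"
          using pq(1,2) unfolding \<alpha>' by blast
        then show ?thesis
        proof cases
          case 1
          then show ?thesis using farN pq by blast
        next
          case 2
          then show ?thesis using farM pq by blast
        next
          case 3
          then show ?thesis using farN[of q p] pq by (simp add: chord_sym)
        next
          case 4
          then show ?thesis using farM[of q p] pq by (simp add: chord_sym)
        next
          case 5
          moreover have "p \<noteq> q" by fact
          ultimately obtain w w' where "p = Some w" "q = Some w'" "(w, w') \<in> {(w, w') \<in> F \<times> F. w \<noteq> w'}"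
            by auto
          then show ?thesis using k(3)[of "(w, w')"] \<kappa>(3) by simp
        qed
      qed
      show "inj_on f \<alpha>" using is_moebius_inj[OF f(1)] by (rule inj_on_subset) simp
    qed (use s t \<kappa> x y disj f(2) g \<alpha>' in auto)
    then show "f \<in> dihedral_maps n"
    proof
      assume "f ` N \<subseteq> N \<and> f ` M \<subseteq> M"
      then show ?thesis
        by (intro cluster_preserving_in_dihedral_maps[OF n t(1) t\<kappa>(3) f(1) N_def R]) (auto simp: M_def)
    next
      assume swap: "f ` N \<subseteq> M \<and> f ` M \<subseteq> N"
      have inv: "inversion \<in> dihedral_maps n" by (rule generators_in_dihedral_maps)
      have "inversion \<circ> f \<in> dihedral_maps n"
      proof (rule cluster_preserving_in_dihedral_maps[OF n t(1) t\<kappa>(3) _ N_def R])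
        show "is_moebius (inversion \<circ> f)"
          using inv f(1) dihedral_maps_moebius[OF n1] is_moebius_comp by blast
        show "(inversion \<circ> f) ` N \<subseteq> N"
          unfolding image_comp[symmetric] using swap MN by blast
        show "(inversion \<circ> f) ` (inversion ` N) \<subseteq> inversion ` N"
          unfolding image_comp[symmetric] using swap M_def by blast
      qed
      then have "inversion \<circ> (inversion \<circ> f) \<in> dihedral_maps n" by (rule dihedral_maps_comp[OF n1 inv])
      moreover have "inversion \<circ> (inversion \<circ> f) = f" by (simp add: fun_eq_iff)
      ultimately show ?thesis by simp
    qed
  qed
qed

text \<open>All but one of the generic orbits are placed at the fixed levels \<open>1/2, 1/3, \<dots>\<close>; the last one is
  shrunk until the clusters it forms at 0 and infinity determine the symmetries.\<close>

lemma exists_exactly_dihedral: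
  assumes n: "n \<ge> 2" and B: "\<B> \<subseteq> {V_orbit, A_orbit n, B_orbit n}" and k: "k \<ge> 1"
  obtains \<C> where "\<C> \<subseteq> C_orbits n" "finite \<C>" "card \<C> = k"
    "carrier (symmetry_group (\<Union>(\<B> \<union> \<C>))) = dihedral_maps n"
proof -
  have n1: "n \<ge> 1" using n by simp
  define u where "u i = complex_of_real (1 / (real i + 2))" for i :: nat
  define \<C>0 where "\<C>0 = (\<lambda>i. level_set n (u i)) ` {..<k - 1}"
  have levels: "\<exists>v. v \<noteq> 0 \<and> W = level_set n v" if W: "W \<in> (\<B> - {V_orbit}) \<union> \<C>0" for W
  proof -
    consider "W = level_set n 1" | "W = level_set n (-1)" | i where "W = level_set n (u i)"
      using W[unfolded \<C>0_def] B unfolding A_orbit_eq[OF n1] B_orbit_eq[OF n1] by blast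
    moreover have "u i \<noteq> 0" for i by (simp add: u_def del: of_real_divide)
    ultimately show ?thesis by cases (metis one_neq_zero, metis neg_equal_0_iff_equal one_neq_zero, metis)
  qed
  define F where "F = {w. Some w \<in> \<Union>((\<B> - {V_orbit}) \<union> \<C>0)}"
  have "finite (\<Union>((\<B> - {V_orbit}) \<union> \<C>0))"
  proof (rule finite_Union)
    show "finite ((\<B> - {V_orbit}) \<union> \<C>0)"
      using B by (auto simp: \<C>0_def intro: finite_subset[of _ "{V_orbit, A_orbit n, B_orbit n}"])
    show "finite W" if "W \<in> (\<B> - {V_orbit}) \<union> \<C>0" for W
      using levels[OF that] finite_level_set[OF n1] by auto
  qed
  moreover have SF: "\<Union>((\<B> - {V_orbit}) \<union> \<C>0) = Some ` F"
  proof -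
    have "None \<notin> W" if "W \<in> (\<B> - {V_orbit}) \<union> \<C>0" for W
      using levels[OF that] by (auto simp: level_set_def)
    then have "None \<notin> \<Union>((\<B> - {V_orbit}) \<union> \<C>0)" by blast
    then have "p \<in> \<Union>((\<B> - {V_orbit}) \<union> \<C>0) \<longleftrightarrow> p \<in> Some ` F" for p
      unfolding F_def by (cases p) auto
    then show ?thesis by blast
  qed
  ultimately have finF: "finite F" by (simp only: finite_image_iff inj_Some)
  have F: "w \<noteq> 0 \<and> inverse w \<in> F" if w: "w \<in> F" for w
  proof -
    obtain W where W: "W \<in> (\<B> - {V_orbit}) \<union> \<C>0" "Some w \<in> W" using w by (auto simp: F_def)
    then obtain v where v: "v \<noteq> 0" "W = level_set n v" using levels by blast
    then have "w \<noteq> 0" "Some (inverse w) \<in> W"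
      using W(2) n1 by (auto simp: level_set_def power_inverse power_0_left)
    then show ?thesis using W(1) by (auto simp: F_def)
  qed
  define R where "R = (if V_orbit \<in> \<B> then insert 0 {r. r ^ n = 1} else {r::complex. r ^ n = 1})"
  have R: "R = {r. r ^ n = 1} \<or> R = insert 0 {r. r ^ n = 1}" by (simp add: R_def)
  obtain t0 where t0: "0 < t0"
    "\<And>t f \<alpha>. 0 < t \<Longrightarrow> t < t0 \<Longrightarrow> \<alpha> = Some ` F \<union> near_zero t R \<union> inversion ` near_zero t R
       \<Longrightarrow> is_moebius f \<Longrightarrow> f ` \<alpha> = \<alpha> \<Longrightarrow> f \<in> dihedral_maps n"
  proof (rule small_orbit_forces_dihedral[OF n finF _ _ R])
    show "0 \<notin> F" "\<And>w. w \<in> F \<Longrightarrow> inverse w \<in> F" using F by auto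
  qed blast
  define t where "t = min t0 (1 / (real k + 2)) / 2"
  have t: "0 < t" "t < t0" "t < 1 / (real k + 2)" using t0(1) by (auto simp: t_def min_def field_simps)
  have "1 / (real k + 2) \<le> 1" by simp
  then have t1: "t < 1" using t by linarith
  have "t ^ n \<le> t ^ 1" using n1 t t1 by (intro power_decreasing) auto
  then have tn: "t ^ n < 1 / (real k + 2)" "0 < t ^ n" using t by auto
  define W0 where "W0 = level_set n (complex_of_real (t ^ n))"
  define \<C> where "\<C> = insert W0 \<C>0"
  \<comment> \<open>the levels are distinct numbers in the open unit interval, so no two of them are inverse\<close>
  have eqD: "x = y" if "level_set n (of_real x) = level_set n (of_real y)" "0 < x" "x < 1" "0 < y" "y < 1" for x y :: real
  proof -
    have "complex_of_real y = of_real x \<or> complex_of_real y = inverse (of_real x)"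
      using that level_set_eq_iff(1)[OF n1, of "of_real x" "of_real y"] by simp
    then have "y = x \<or> y = inverse x" by (simp only: of_real_inverse[symmetric] of_real_eq_iff)
    then show ?thesis using that one_less_inverse_iff[of x] by auto
  qed
  have ui: "0 < 1 / (real i + 2)" "1 / (real i + 2) < 1" for i by auto
  have "inj_on (\<lambda>i. level_set n (u i)) {..<k - 1}"
    by (rule inj_onI) (use eqD[OF _ ui ui] in \<open>simp add: u_def\<close>)
  then have cardC0: "card \<C>0 = k - 1" "finite \<C>0" by (auto simp: \<C>0_def card_image)
  have "W0 \<notin> \<C>0"
  proof
    assume "W0 \<in> \<C>0"
    then obtain i where i: "i < k - 1" "level_set n (of_real (t ^ n)) = level_set n (of_real (1 / (real i + 2)))"
      by (auto simp: \<C>0_def W0_def u_def)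
    have "t ^ n < 1" using tn by (smt (verit) \<open>1 / (real k + 2) \<le> 1\<close>)
    then have "t ^ n = 1 / (real i + 2)" using eqD[OF i(2) tn(2) _ ui] by blast
    moreover have "1 / (real k + 2) \<le> 1 / (real i + 2)" using i(1) by (intro divide_left_mono) auto
    ultimately show False using tn by linarith
  qed
  then have "card \<C> = k" "finite \<C>" using cardC0 k by (auto simp: \<C>_def)
  moreover have sub: "\<C> \<subseteq> C_orbits n"
  proof -
    have "level_set n (of_real x) \<in> C_orbits n" if "0 < x" "x < 1" for x :: real
    proof -
      have "x\<^sup>2 \<noteq> 1" using that by (auto simp: power2_eq_1_iff)
      then have "complex_of_real x \<noteq> 0 \<and> (complex_of_real x)\<^sup>2 \<noteq> 1"
        using that by (simp flip: of_real_power)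
      then show ?thesis unfolding C_orbits_eq[OF n1] by blast
    qed
    moreover have "t ^ n < 1" using tn by (smt (verit) \<open>1 / (real k + 2) \<le> 1\<close>)
    ultimately show ?thesis using tn ui by (auto simp: \<C>_def W0_def \<C>0_def u_def simp del: of_real_power of_real_divide)
  qed
  moreover have "carrier (symmetry_group (\<Union>(\<B> \<union> \<C>))) = dihedral_maps n"
  proof (rule symmetry_carrier_eqI[OF n1])
    show "\<B> \<union> \<C> \<subseteq> G_orbits n" using B sub G_orbits_split[OF n1] by blast
    have N0: "near_zero t (insert 0 Q) = insert (Some 0) (near_zero t Q)" for Q by (simp add: near_zero_def)
    have inv0: "inversion (Some 0) = None" by (simp add: inversion_eq rot_flip_apply)
    have W0: "near_zero t {r. r ^ n = 1} \<union> inversion ` near_zero t {r. r ^ n = 1} = W0"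
      by (subst near_zero_roots(2)[OF n1 t(1)], subst near_zero_roots(1)[OF n1 t(1)])
         (auto simp: W0_def level_set_def)
    have NM: "near_zero t R \<union> inversion ` near_zero t R = W0 \<union> (if V_orbit \<in> \<B> then V_orbit else {})"
      unfolding R_def W0[symmetric] by (auto simp: N0 inv0 V_orbit_def)
    have "\<Union>(\<B> \<union> \<C>) = \<Union>((\<B> - {V_orbit}) \<union> \<C>0) \<union> (W0 \<union> (if V_orbit \<in> \<B> then V_orbit else {}))"
      unfolding \<C>_def by auto
    then have \<alpha>: "\<Union>(\<B> \<union> \<C>) = Some ` F \<union> near_zero t R \<union> inversion ` near_zero t R"
      unfolding SF NM[symmetric] by blast
    show "f \<in> dihedral_maps n" if "is_moebius f" "f ` \<Union>(\<B> \<union> \<C>) = \<Union>(\<B> \<union> \<C>)" for f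
      by (rule t0(2)[OF t(1,2) \<alpha> that])
  qed
  ultimately show ?thesis using that by blast
qed

section \<open>Sets with more than dihedral symmetry\<close>

lemma not_dihedralI:
  assumes "n \<ge> 1" "is_moebius f" "finite \<alpha>" "f ` \<alpha> \<subseteq> \<alpha>" "f \<circ> f \<noteq> id" "f ^^ n \<noteq> id"
  shows "\<not> symmetry_group \<alpha> \<cong> dihedral_group n"
  using dihedral_symmetry_exponent[OF assms(1) _ symmetryI[OF assms(2,3,4)]] assms(5,6) by blast

lemma rot_funpow: "w \<noteq> 0 \<Longrightarrow> rot w ^^ k = rot (w ^ k)"
  by (induction k) (auto simp: rot_one rot_flip_comp simp flip: id_def)

lemma finite_V_orbit: "finite V_orbit"
  by (simp add: V_orbit_def)

lemma level_set_square_one: "u\<^sup>2 = 1 \<Longrightarrow> level_set n u = Some ` {w. w ^ n = u}"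
  by (auto simp: level_set_def power2_eq_1_iff)

text \<open>Scaling by 2 is a symmetry of infinite order.\<close>

lemma apexes_not_dihedral:
  assumes "n \<ge> 1" "\<B> \<subseteq> {V_orbit}"
  shows "\<not> symmetry_group (\<Union>\<B>) \<cong> dihedral_group n"
proof (rule not_dihedralI[OF assms(1)])
  have "finite \<B>" using assms(2) finite_subset by blast
  then show "finite (\<Union>\<B>)" using assms(2) finite_V_orbit by auto
  show "is_moebius (rot 2)" by (intro is_moebius_rot_flip) simp
  have "rot 2 ` V_orbit \<subseteq> V_orbit" by (simp add: V_orbit_def rot_flip_apply)
  then show "rot 2 ` \<Union>\<B> \<subseteq> \<Union>\<B>" using assms(2) by blast
  have "rot (2 ^ k) \<noteq> id" if "k \<ge> 1" for k
  proof -
    have "(2::complex) ^ k = of_nat (2 ^ k)" by simp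
    also have "\<dots> \<noteq> of_nat 1" unfolding of_nat_eq_iff using that by simp
    finally show ?thesis unfolding rot_one[symmetric] rot_flip_eq_iff by simp
  qed
  from this[of 2] this[OF assms(1)] show "rot 2 \<circ> rot 2 \<noteq> id" "rot 2 ^^ n \<noteq> id"
    by (simp_all add: rot_flip_comp rot_funpow power2_eq_square)
qed

text \<open>The two polygons together are the \<open>2n\<close>-th roots of unity, which admit a rotation of order \<open>2n\<close>.\<close>

lemma double_polygon_not_dihedral:
  assumes n: "n \<ge> 2" and B: "\<B> \<subseteq> {V_orbit, A_orbit n, B_orbit n}" "A_orbit n \<in> \<B>" "B_orbit n \<in> \<B>"
  shows "\<not> symmetry_group (\<Union>\<B>) \<cong> dihedral_group n"
proof -
  have n1: "n \<ge> 1" using n by simp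
  let ?w = "cis (pi / real n)"
  have wn: "?w ^ n = -1" using n by (simp add: DeMoivre)
  show ?thesis
  proof (rule not_dihedralI[OF n1])
    have "finite \<B>" using B(1) finite_subset by blast
    then show "finite (\<Union>\<B>)"
      using B(1) finite_orbit[OF n1] G_orbits_split[OF n1] by auto
    show "is_moebius (rot ?w)" by (intro is_moebius_rot_flip) simp
    have "rot ?w ` A_orbit n \<subseteq> B_orbit n" "rot ?w ` B_orbit n \<subseteq> A_orbit n" "rot ?w ` V_orbit \<subseteq> V_orbit"
      using wn by (auto simp: A_orbit_eq[OF n1] B_orbit_eq[OF n1] level_set_square_one V_orbit_def
          rot_flip_apply power_mult_distrib)
    then show "rot ?w ` \<Union>\<B> \<subseteq> \<Union>\<B>" using B by blast
    have "?w ^ 2 \<noteq> 1"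
    proof
      assume 1: "?w ^ 2 = 1"
      then have "cis (2 * pi / real n) ^ 1 = cis (2 * pi / real n) ^ 0" by (simp add: DeMoivre)
      then show False using inj_onD[OF primitive_root(3)[OF n1], of 1 0] n by auto
    qed
    then show "rot ?w \<circ> rot ?w \<noteq> id" "rot ?w ^^ n \<noteq> id"
      using wn unfolding rot_one[symmetric]
      by (auto simp: rot_flip_comp rot_funpow rot_flip_eq_iff power2_eq_square simp del: cis_mult)
  qed
qed

text \<open>A square together with 0 and infinity is a regular octahedron, which has a symmetry of order 3.\<close>

lemma octahedron_not_dihedral:
  assumes u: "u\<^sup>2 = 1"
  shows "\<not> symmetry_group (V_orbit \<union> level_set 4 u) \<cong> dihedral_group 4"
proof -
  obtain x where x: "x ^ 4 = u" using exists_nth_root[of 4 u] by auto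
  have x0: "x \<noteq> 0" using x u by auto
  have roots: "w ^ 4 = u \<longleftrightarrow> w \<in> {x, - x, \<i> * x, - (\<i> * x)}" for w
  proof -
    have "w ^ 4 - u = (w - x) * (w + x) * (w - \<i> * x) * (w + \<i> * x)"
      by (simp add: x[symmetric] eval_nat_numeral algebra_simps)
    then have "w ^ 4 = u \<longleftrightarrow> (w - x) * (w + x) * (w - \<i> * x) * (w + \<i> * x) = 0" by (metis right_minus_eq)
    then show ?thesis by (auto simp: eq_neg_iff_add_eq_0)
  qed
  \<comment> \<open>the rotation of the octahedron by a third of a turn about the centre of the face 0, x, ix\<close>
  define g where "g = moebius (- x) (\<i> * x\<^sup>2) 1 (\<i> * x)"
  have i1: "1 + \<i> \<noteq> 0" "1 - \<i> \<noteq> 0" "\<i> - 1 \<noteq> 0" by (auto simp: complex_eq_iff)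
  have den: "x + \<i> * x \<noteq> 0" "- x + \<i> * x \<noteq> 0" "\<i> * x + \<i> * x \<noteq> 0"
    using x0 i1 by (auto simp: complex_eq_iff)
  have g_pts: "g (Some 0) = Some x" "g (Some x) = Some (\<i> * x)" "g (Some (\<i> * x)) = Some 0"
    "g None = Some (- x)" "g (Some (- x)) = Some (- (\<i> * x))" "g (Some (- (\<i> * x))) = None"
    using x0 den by (auto simp: g_def moebius_def divide_eq_eq algebra_simps power2_eq_square)
  have \<alpha>: "V_orbit \<union> level_set 4 u = {Some 0, None, Some x, Some (- x), Some (\<i> * x), Some (- (\<i> * x))}"
    unfolding level_set_square_one[OF u] roots by (auto simp: V_orbit_def)
  show ?thesis
  proof (rule not_dihedralI)
    show "is_moebius g" unfolding g_def using x0 by (intro is_moebiusI) (simp add: power2_eq_square)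
    show "finite (V_orbit \<union> level_set 4 u)" unfolding \<alpha> by simp
    show "g ` (V_orbit \<union> level_set 4 u) \<subseteq> V_orbit \<union> level_set 4 u" unfolding \<alpha> by (simp add: g_pts)
    have "(g \<circ> g) (Some 0) \<noteq> Some 0" "(g ^^ 4) (Some 0) \<noteq> Some 0"
      using x0 by (simp_all add: g_pts eval_nat_numeral)
    then show "g \<circ> g \<noteq> id" "g ^^ 4 \<noteq> id" by (metis id_apply)+
  qed simp
qed

text \<open>A pair of points is preserved by maps of infinite order, and two harmonic pairs form a square, which has
  a symmetry of order 4.\<close>

lemma few_points_not_klein:
  assumes u: "u\<^sup>2 = 1"
  shows "\<not> symmetry_group (level_set 2 u) \<cong> dihedral_group 2"
    and "\<not> symmetry_group (V_orbit \<union> level_set 2 u) \<cong> dihedral_group 2"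
proof -
  obtain x where x: "x\<^sup>2 = u" using exists_nth_root[of 2 u] by auto
  have x0: "x \<noteq> 0" using x u by auto
  have \<alpha>: "level_set 2 u = {Some x, Some (- x)}"
    unfolding level_set_square_one[OF u] by (auto simp: x[symmetric] power2_eq_iff)
  show "\<not> symmetry_group (level_set 2 u) \<cong> dihedral_group 2"
  proof (rule not_dihedralI)
    \<comment> \<open>a hyperbolic map with fixed points x and -x\<close>
    let ?g = "moebius (5 * x) (4 * x\<^sup>2) 4 (5 * x)"
    have g: "?g (Some x) = Some x" "?g (Some (- x)) = Some (- x)" "?g (Some 0) = Some (4 / 5 * x)"
      "?g (Some (4 / 5 * x)) = Some (40 / 41 * x)"
      using x0 by (auto simp: moebius_def divide_simps power2_eq_square)
    show "is_moebius ?g" using x0 by (intro is_moebiusI) (simp add: power2_eq_square)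
    show "finite (level_set 2 u)" unfolding \<alpha> by simp
    show "?g ` level_set 2 u \<subseteq> level_set 2 u" unfolding \<alpha> by (simp add: g)
    have "(?g \<circ> ?g) (Some 0) \<noteq> Some 0" using x0 by (simp add: g del: times_divide_eq_left)
    then show "?g \<circ> ?g \<noteq> id" "?g ^^ 2 \<noteq> id" by (auto simp: fun_eq_iff numeral_2_eq_2)
  qed simp
  show "\<not> symmetry_group (V_orbit \<union> level_set 2 u) \<cong> dihedral_group 2"
  proof (rule not_dihedralI)
    \<comment> \<open>the quarter turn of the square with consecutive vertices 0, x, infinity and -x\<close>
    let ?g = "moebius x (x\<^sup>2) (- 1) x"
    have g: "?g (Some 0) = Some x" "?g (Some x) = None" "?g None = Some (- x)" "?g (Some (- x)) = Some 0"
      using x0 by (auto simp: moebius_def divide_simps power2_eq_square)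
    show "is_moebius ?g" using x0 by (intro is_moebiusI) (simp add: power2_eq_square)
    show "finite (V_orbit \<union> level_set 2 u)" unfolding \<alpha> by (simp add: V_orbit_def)
    show "?g ` (V_orbit \<union> level_set 2 u) \<subseteq> V_orbit \<union> level_set 2 u"
      unfolding \<alpha> by (simp add: g V_orbit_def)
    have "(?g \<circ> ?g) (Some 0) \<noteq> Some 0" by (simp add: g)
    then show "?g \<circ> ?g \<noteq> id" "?g ^^ 2 \<noteq> id" by (auto simp: fun_eq_iff numeral_2_eq_2)
  qed simp
qed

text \<open>Without a generic orbit, dihedral symmetry requires exactly one of the two polygons: with none, the
  symmetries are infinite in number, and with both, there is a finer rotation.
  The exceptional sets for \<open>n = 2\<close> and \<open>n = 4\<close> are the square, the pair of points and the octahedron.\<close>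

lemma no_generic_orbit_dihedral:
  assumes n: "n \<ge> 2" and B: "\<B> \<subseteq> {V_orbit, A_orbit n, B_orbit n}"
    and dihedral: "symmetry_group (\<Union>\<B>) \<cong> dihedral_group n"
  shows "card (\<B> \<inter> {A_orbit n, B_orbit n}) = 1" and "n \<noteq> 2" and "n = 4 \<Longrightarrow> V_orbit \<notin> \<B>"
proof -
  have n1: "n \<ge> 1" using n by simp
  have "\<not> \<B> \<subseteq> {V_orbit}" using apexes_not_dihedral[OF n1] dihedral by blast
  moreover have "\<not> (A_orbit n \<in> \<B> \<and> B_orbit n \<in> \<B>)"
    using double_polygon_not_dihedral[OF n B] dihedral by blast
  ultimately obtain W where W: "\<B> \<inter> {A_orbit n, B_orbit n} = {W}" "W = A_orbit n \<or> W = B_orbit n"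
    using B by blast
  then show "card (\<B> \<inter> {A_orbit n, B_orbit n}) = 1" by simp
  obtain u where u: "u\<^sup>2 = 1" "W = level_set n u"
    using W(2) A_orbit_eq[OF n1] B_orbit_eq[OF n1] by (metis power2_minus power_one)
  have union: "\<Union>\<B> = (if V_orbit \<in> \<B> then V_orbit \<union> level_set n u else level_set n u)"
  proof -
    have "\<B> = (if V_orbit \<in> \<B> then {V_orbit, W} else {W})" using B W by auto
    then have "\<Union>\<B> = \<Union>(if V_orbit \<in> \<B> then {V_orbit, W} else {W})" by simp
    then show ?thesis unfolding u(2) by simp
  qed
  show "n \<noteq> 2" using few_points_not_klein[OF u(1)] dihedral union by (auto split: if_splits)
  show "V_orbit \<notin> \<B>" if "n = 4"
    using octahedron_not_dihedral[OF u(1)] dihedral union that by (auto split: if_splits)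
qed

section \<open>Conjugating dihedral symmetry into standard position\<close>

text \<open>The standard generators and relations of \<open>D\<^sub>n\<close> inside the Moebius group. Requiring the exact order of
  \<open>r\<close> and that \<open>t\<close> is no power of \<open>r\<close> excludes proper quotients.\<close>

definition dihedral_pair :: "nat \<Rightarrow> (sphere \<Rightarrow> sphere) \<Rightarrow> (sphere \<Rightarrow> sphere) \<Rightarrow> bool" where
  "dihedral_pair n r t \<longleftrightarrow> is_moebius r \<and> is_moebius t \<and>
     r ^^ n = id \<and> (\<forall>j. 0 < j \<and> j < n \<longrightarrow> r ^^ j \<noteq> id) \<and>
     t \<circ> t = id \<and> (\<forall>j. t \<noteq> r ^^ j) \<and> r \<circ> t \<circ> r = t"

lemma dihedral_group_generators:
  assumes n: "n \<ge> 2" and dihedral: "symmetry_group \<alpha> \<cong> dihedral_group n"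
  obtains r t where "r \<in> carrier (symmetry_group \<alpha>)" "t \<in> carrier (symmetry_group \<alpha>)" "dihedral_pair n r t"
proof -
  let ?S = "symmetry_group \<alpha>" and ?D = "dihedral_group n"
  have gD: "group ?D" using n by (intro group_dihedral) simp
  obtain h where h: "h \<in> iso ?D ?S"
    using group.iso_sym[OF group_symmetry dihedral] unfolding is_iso_def by blast
  have hom: "h \<in> hom ?D ?S" and bij: "bij_betw h (carrier ?D) (carrier ?S)"
    using h by (auto simp: iso_def)
  interpret D: group ?D by (rule gD)
  interpret S: group ?S by (rule group_symmetry)
  interpret hom: group_hom ?D ?S h by unfold_locales (rule hom)
  define r t where "r = h (1, False)" and "t = h (0, True)"
  have D: "(1, False) \<in> carrier ?D" "(0, True) \<in> carrier ?D" using n by (auto simp: dihedral_group_sel)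
  have S: "r \<in> carrier ?S" "t \<in> carrier ?S" using D by (auto simp: r_def t_def)
  have rj: "r ^^ j = h (int j mod int n, False)" for j
    using hom.hom_nat_pow[OF D(1), of j] by (simp add: funpow_nat_pow r_def dihedral_rotation_power)
  have Dj: "(int j mod int n, False) \<in> carrier ?D" for j using n by (simp add: dihedral_group_sel)
  have inj: "x = y" if "h x = h y" "x \<in> carrier ?D" "y \<in> carrier ?D" for x y
    using bij that by (auto simp: bij_betw_def dest: inj_onD)
  have one: "h (0, False) = id" using hom.hom_one by (simp add: dihedral_group_sel)
  have "dihedral_pair n r t"
    unfolding dihedral_pair_def
  proof (intro conjI allI impI)
    show "is_moebius r" "is_moebius t" using S by (auto simp: carrier_symmetry_group)
    show "r ^^ n = id" by (simp add: rj one)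
    show "r ^^ j \<noteq> id" if "0 < j \<and> j < n" for j
      using inj[of "(int j mod int n, False)" "(0, False)"] Dj[of j] Dj[of 0] that by (auto simp: rj one)
    show "t \<noteq> r ^^ j" for j
      using inj[OF _ D(2) Dj[of j]] by (auto simp: rj t_def)
    have "t \<circ> t = h ((0, True) \<otimes>\<^bsub>?D\<^esub> (0, True))" using hom.hom_mult[OF D(2) D(2)] by (simp add: t_def)
    then show "t \<circ> t = id" by (simp add: dihedral_group_sel one)
    have "r \<circ> t \<circ> r = h ((1, False) \<otimes>\<^bsub>?D\<^esub> (0, True) \<otimes>\<^bsub>?D\<^esub> (1, False))"
      using hom.hom_mult[OF D.m_closed[OF D(1,2)] D(1)] hom.hom_mult[OF D(1,2)] by (simp add: t_def r_def)
    then show "r \<circ> t \<circ> r = t" using n by (simp add: dihedral_group_sel t_def)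
  qed
  then show ?thesis using that S by blast
qed

definition moebius_conjugate :: "(sphere \<Rightarrow> sphere) \<Rightarrow> (sphere \<Rightarrow> sphere) \<Rightarrow> bool" where
  "moebius_conjugate m m' \<longleftrightarrow> is_moebius m \<and> is_moebius m' \<and> m \<circ> m' = id \<and> m' \<circ> m = id"

lemma moebius_conjugateI: "is_moebius m \<Longrightarrow> \<exists>m'. moebius_conjugate m m'"
  using is_moebius_inverse unfolding moebius_conjugate_def by metis

lemma moebius_conjugate_apply:
  assumes "moebius_conjugate m m'"
  shows "m (m' p) = p" "m' (m p) = p"
  using assms by (auto simp: moebius_conjugate_def fun_eq_iff)

lemma moebius_conjugate_comp:
  assumes "moebius_conjugate m m'" "moebius_conjugate k k'"
  shows "moebius_conjugate (k \<circ> m) (m' \<circ> k')"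
  using assms moebius_conjugate_apply[OF assms(1)] moebius_conjugate_apply[OF assms(2)]
  by (auto simp: moebius_conjugate_def fun_eq_iff intro: is_moebius_comp)

lemma funpow_conjugate:
  assumes "moebius_conjugate m m'"
  shows "(m \<circ> r \<circ> m') ^^ j = m \<circ> r ^^ j \<circ> m'"
  by (induction j) (auto simp: fun_eq_iff moebius_conjugate_apply[OF assms])

lemma conjugate_eq_iff:
  assumes "moebius_conjugate m m'"
  shows "m \<circ> f \<circ> m' = m \<circ> g \<circ> m' \<longleftrightarrow> f = g"
proof
  assume "m \<circ> f \<circ> m' = m \<circ> g \<circ> m'"
  then have "m' ((m \<circ> f \<circ> m') (m p)) = m' ((m \<circ> g \<circ> m') (m p))" for p by simp
  then show "f = g" by (simp add: moebius_conjugate_apply[OF assms] fun_eq_iff)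
qed simp

lemma dihedral_pair_conjugate:
  assumes "moebius_conjugate m m'" "dihedral_pair n r t"
  shows "dihedral_pair n (m \<circ> r \<circ> m') (m \<circ> t \<circ> m')"
proof -
  have id: "id = m \<circ> id \<circ> m'" using assms(1) by (simp add: moebius_conjugate_def)
  have comp: "(m \<circ> f \<circ> m') \<circ> (m \<circ> g \<circ> m') = m \<circ> (f \<circ> g) \<circ> m'" for f g
    by (simp add: fun_eq_iff moebius_conjugate_apply[OF assms(1)])
  have moeb: "is_moebius (m \<circ> f \<circ> m')" if "is_moebius f" for f
    using that assms(1) by (auto simp: moebius_conjugate_def intro: is_moebius_comp)
  have "((m \<circ> r \<circ> m') ^^ j = id) = (r ^^ j = id)" for j
    by (subst id) (simp only: funpow_conjugate[OF assms(1)] conjugate_eq_iff[OF assms(1)])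
  moreover have "((m \<circ> t \<circ> m') \<circ> (m \<circ> t \<circ> m') = id) = (t \<circ> t = id)"
    by (subst id) (simp only: comp conjugate_eq_iff[OF assms(1)])
  moreover have "(m \<circ> t \<circ> m' = (m \<circ> r \<circ> m') ^^ j) = (t = r ^^ j)" for j
    by (simp only: funpow_conjugate[OF assms(1)] conjugate_eq_iff[OF assms(1)])
  moreover have "((m \<circ> r \<circ> m') \<circ> (m \<circ> t \<circ> m') \<circ> (m \<circ> r \<circ> m') = m \<circ> t \<circ> m') = (r \<circ> t \<circ> r = t)"
    by (simp only: comp conjugate_eq_iff[OF assms(1)])
  ultimately show ?thesis using assms(2) moeb unfolding dihedral_pair_def by auto
qed

lemma moebius_fixed_point:
  assumes "is_moebius r"
  obtains p where "r p = p"
proof -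
  obtain a b c d where r: "r = moebius a b c d" "a * d - b * c = 1"
    using assms by (rule is_moebiusE)
  show ?thesis
  proof (cases "c = 0")
    case True
    then have "r None = None" by (simp add: r(1) moebius_def)
    then show ?thesis by (rule that)
  next
    case False
    \<comment> \<open>the finite fixed points are the roots of a quadratic equation\<close>
    define s where "s = csqrt ((a - d)\<^sup>2 + 4 * b * c)"
    define z where "z = (a - d + s) / (2 * c)"
    have "s\<^sup>2 = (a - d)\<^sup>2 + 4 * b * c" by (simp add: s_def)
    moreover have "s = 2 * c * z - (a - d)" using False by (simp add: z_def)
    ultimately have "(2 * c * z - (a - d))\<^sup>2 = (a - d)\<^sup>2 + 4 * b * c" by simp
    then have "4 * c * (z * (c * z + d)) = 4 * c * (a * z + b)"
      by (simp add: power2_eq_square algebra_simps)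
    then have eq: "z * (c * z + d) = a * z + b" using False by simp
    have "c * z + d \<noteq> 0"
    proof
      assume "c * z + d = 0"
      moreover from this have "a * z + b = 0" using eq by simp
      ultimately show False using nonsingular_apply[of a d b c z 1] r(2) by simp
    qed
    then have "r (Some z) = Some z" using eq[symmetric] by (simp add: r(1) moebius_def)
    then show ?thesis by (rule that)
  qed
qed

text \<open>Sending a fixed point to infinity makes the map affine. It is not a translation, because a nontrivial
  translation has infinite order, so it has a second fixed point, which is moved to 0.\<close>

lemma finite_order_conjugate_to_rotation:
  assumes r: "is_moebius r" "r \<noteq> id" "r ^^ n = id" and n: "n \<ge> 1"
  obtains m m' w where "moebius_conjugate m m'" "w \<noteq> 0" "m \<circ> r \<circ> m' = rot w"
proof -
  obtain p where p: "r p = p" using moebius_fixed_point[OF r(1)] .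
  have "\<exists>m. is_moebius m \<and> m p = None"
  proof (cases p)
    case None
    then show ?thesis by (intro exI[of _ id]) simp
  next
    case (Some z)
    then show ?thesis by (intro exI[of _ "moebius 0 1 1 (- z)"]) (auto simp: moebius_def intro!: is_moebiusI)
  qed
  then obtain m m' where m: "moebius_conjugate m m'" "m p = None" using moebius_conjugateI by blast
  define q where "q = m \<circ> r \<circ> m'"
  have q: "is_moebius q" "q None = None" "q \<noteq> id" "q ^^ n = id"
  proof -
    have id: "id = m \<circ> id \<circ> m'" using m(1) by (simp add: moebius_conjugate_def)
    show "is_moebius q" using m(1) r(1) by (auto simp: q_def moebius_conjugate_def intro: is_moebius_comp)
    have "m' None = p" using m moebius_conjugate_apply[OF m(1)] by metis
    then show "q None = None" by (simp add: q_def p m(2))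
    show "q \<noteq> id" using r(2) conjugate_eq_iff[OF m(1), of r id] id by (simp add: q_def)
    show "q ^^ n = id" using r(3) id by (simp add: q_def funpow_conjugate[OF m(1)])
  qed
  obtain a b c d where abcd: "q = moebius a b c d" "a * d - b * c = 1" using q(1) by (rule is_moebiusE)
  have c: "c = 0" using q(2) by (auto simp: abcd(1) moebius_def split: if_splits)
  then have ad: "a \<noteq> 0" "d \<noteq> 0" using abcd(2) by auto
  define w e where "w = a / d" and "e = b / d"
  have q_eq: "q = moebius w e 0 1"
    using moebius_scale[of "inverse d" a b c d] ad c by (simp add: abcd(1) w_def e_def field_simps)
  have w0: "w \<noteq> 0" using ad by (simp add: w_def)
  have q_Some: "q (Some z) = Some (w * z + e)" for z by (simp add: q_eq moebius_def)
  have "w \<noteq> 1"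
  proof
    assume w: "w = 1"
    have "(q ^^ k) (Some 0) = Some (of_nat k * e)" for k
      by (induction k) (auto simp: q_Some w algebra_simps)
    then have "of_nat n * e = 0" using q(4) by (metis id_apply option.inject)
    then have "e = 0" using n by simp
    then show False using q(3) w by (simp add: q_eq moebius_one)
  qed
  define f where "f = e / (1 - w)"
  have f: "w * f + e = f" using \<open>w \<noteq> 1\<close> by (simp add: f_def field_simps)
  define k k' where "k = moebius 1 (- f) 0 1" and "k' = moebius 1 f 0 1"
  have kk: "moebius_conjugate k k'"
    using moebius_inverse[of 1 1 f 0] by (auto simp: moebius_conjugate_def k_def k'_def intro!: is_moebiusI)
  have "k \<circ> q \<circ> k' = rot w"
  proof
    fix p
    show "(k \<circ> q \<circ> k') p = rot w p"
    proof (cases p)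
      case None
      then show ?thesis by (simp add: k_def k'_def q_eq moebius_def)
    next
      case (Some z)
      have "w * (z + f) + e - f = w * z" using f by (simp add: algebra_simps)
      then show ?thesis by (simp add: Some k_def k'_def q_eq moebius_def)
    qed
  qed
  then have "(k \<circ> m) \<circ> r \<circ> (m' \<circ> k') = rot w" by (simp add: q_def comp_assoc)
  then show ?thesis using that moebius_conjugate_comp[OF m(1) kk] w0 by blast
qed

text \<open>From \<open>r t r = t\<close> the involution \<open>t\<close> preserves the fixed points 0 and infinity of \<open>r\<close>. If it fixed both
  of them, it would be \<open>z \<mapsto> v z\<close> with \<open>v\<^sup>2 = 1\<close> and commute with \<open>r\<close>; then \<open>w = -1\<close>, and \<open>t\<close> would be a
  power of \<open>r\<close>.\<close>

lemma reflection_of_rotation: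
  assumes n: "n \<ge> 2" and pair: "dihedral_pair n (rot w) t" and w0: "w \<noteq> 0"
  obtains v where "v \<noteq> 0" "t = flip v"
proof -
  have t: "is_moebius t" "t \<circ> t = id" "\<And>j. t \<noteq> rot w ^^ j" "rot w \<circ> t \<circ> rot w = t"
    using pair by (auto simp: dihedral_pair_def)
  have "rot w ^^ 1 \<noteq> id" using pair n by (auto simp: dihedral_pair_def)
  then have w1: "w \<noteq> 1" by (auto simp: rot_one)
  have V: "t p \<in> V_orbit" if "p \<in> V_orbit" for p
  proof -
    have "rot w p = p" using that by (auto simp: V_orbit_def rot_flip_apply)
    then have "rot w (t p) = t p" using t(4) by (metis comp_apply)
    then show ?thesis using w1 by (cases "t p") (auto simp: rot_flip_apply V_orbit_def)
  qed
  obtain a b c d where abcd: "t = moebius a b c d" "a * d - b * c = 1" using t(1) by (rule is_moebiusE)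
  have "b = 0 \<and> c = 0 \<or> a = 0 \<and> d = 0"
    using V[of None] V[of "Some 0"] abcd(2)
    by (auto simp: abcd(1) moebius_def V_orbit_def split: if_splits)
  then show ?thesis
  proof
    assume bc: "b = 0 \<and> c = 0"
    then have ad: "a \<noteq> 0" "d \<noteq> 0" using abcd(2) by auto
    define v where "v = a / d"
    have v: "v \<noteq> 0" "t = rot v"
      using moebius_scale[of "inverse d" a b c d] ad bc by (auto simp: abcd(1) v_def field_simps)
    have "v\<^sup>2 = 1" using t(2) v unfolding rot_one[symmetric]
      by (simp add: rot_flip_comp rot_flip_eq_iff power2_eq_square)
    have "w * v * w = v" using t(4) v w0 by (simp add: rot_flip_comp rot_flip_eq_iff)
    then have "w\<^sup>2 = 1" using v(1) by (simp add: power2_eq_square mult_ac)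
    then have "w = -1" using w1 by (auto simp: power2_eq_1_iff)
    then have "v = w ^ 0 \<or> v = w ^ 1" using \<open>v\<^sup>2 = 1\<close> by (auto simp: power2_eq_1_iff)
    then show ?thesis using t(3) v(2) rot_funpow[OF w0] by metis
  next
    assume ad: "a = 0 \<and> d = 0"
    then have bc: "b \<noteq> 0" "c \<noteq> 0" using abcd(2) by auto
    have "t = flip (b / c)"
      using moebius_scale[of "inverse c" a b c d] ad bc by (simp add: abcd(1) field_simps)
    then show ?thesis using that[of "b / c"] bc by simp
  qed
qed

text \<open>After 0 and infinity are the fixed points of \<open>r\<close>, the involution is \<open>z \<mapsto> v/z\<close>, and scaling by a square
  root of \<open>v\<close> turns it into the inversion without changing \<open>r\<close>.\<close>

lemma dihedral_pair_standard_position: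
  assumes n: "n \<ge> 2" and pair: "dihedral_pair n r t"
  obtains m m' w where "moebius_conjugate m m'" "w \<noteq> 0" "m \<circ> r \<circ> m' = rot w" "m \<circ> t \<circ> m' = inversion"
proof -
  have r: "is_moebius r" "r ^^ n = id" "r ^^ 1 \<noteq> id" using pair n by (auto simp: dihedral_pair_def)
  obtain m m' w where m: "moebius_conjugate m m'" "w \<noteq> 0" "m \<circ> r \<circ> m' = rot w"
    by (rule finite_order_conjugate_to_rotation[of r n]) (use r n in auto)
  have "dihedral_pair n (rot w) (m \<circ> t \<circ> m')"
    using dihedral_pair_conjugate[OF m(1) pair] m(3) by simp
  then obtain v where v: "v \<noteq> 0" "m \<circ> t \<circ> m' = flip v" using reflection_of_rotation[OF n _ m(2)] by metis
  define s where "s = csqrt v"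
  have s: "s \<noteq> 0" "s * s = v" using v(1) by (auto simp: s_def simp flip: power2_eq_square)
  have k: "moebius_conjugate (rot (inverse s)) (rot s)"
    using s by (auto simp: moebius_conjugate_def rot_flip_comp rot_one intro!: is_moebius_rot_flip)
  have "(rot (inverse s) \<circ> m) \<circ> r \<circ> (m' \<circ> rot s) = rot (inverse s) \<circ> (m \<circ> r \<circ> m') \<circ> rot s"
    by (simp add: comp_assoc)
  also have "\<dots> = rot (inverse s * w * s)" using s m(2) by (simp add: m(3) rot_flip_comp)
  also have "inverse s * w * s = w" using s by simp
  finally have 1: "(rot (inverse s) \<circ> m) \<circ> r \<circ> (m' \<circ> rot s) = rot w" .
  have "(rot (inverse s) \<circ> m) \<circ> t \<circ> (m' \<circ> rot s) = rot (inverse s) \<circ> (m \<circ> t \<circ> m') \<circ> rot s"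
    by (simp add: comp_assoc)
  also have "\<dots> = flip (inverse s * v / s)" using s v by (simp add: v(2) rot_flip_comp)
  also have "inverse s * v / s = 1" using s by (simp add: s(2)[symmetric])
  finally have 2: "(rot (inverse s) \<circ> m) \<circ> t \<circ> (m' \<circ> rot s) = inversion" by (simp only: inversion_eq)
  show ?thesis using that[OF moebius_conjugate_comp[OF m(1) k] m(2) 1 2] .
qed

lemma conjugate_symmetry:
  assumes "moebius_conjugate m m'" "f \<in> carrier (symmetry_group \<alpha>)"
  shows "m \<circ> f \<circ> m' \<in> carrier (symmetry_group (m ` \<alpha>))"
proof -
  have "(m \<circ> f \<circ> m') ` (m ` \<alpha>) = m ` f ` ((m' \<circ> m) ` \<alpha>)"
    by (simp add: image_comp o_assoc)
  also have "\<dots> = m ` \<alpha>" using assms by (simp add: moebius_conjugate_def carrier_symmetry_group)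
  finally show ?thesis
    using assms by (auto simp: moebius_conjugate_def carrier_symmetry_group intro: is_moebius_comp)
qed

lemma symmetry_group_conjugate_iso:
  assumes m: "moebius_conjugate m m'"
  shows "symmetry_group \<alpha> \<cong> symmetry_group (m ` \<alpha>)"
proof -
  let ?h = "\<lambda>f. m \<circ> f \<circ> m'"
  have m': "moebius_conjugate m' m" using m by (auto simp: moebius_conjugate_def)
  have undo: "m' ` m ` \<alpha> = \<alpha>" using m by (simp add: image_comp moebius_conjugate_def)
  have "?h \<in> hom (symmetry_group \<alpha>) (symmetry_group (m ` \<alpha>))"
  proof (rule homI)
    fix f g
    show "m \<circ> f \<circ> m' \<in> carrier (symmetry_group (m ` \<alpha>))" if "f \<in> carrier (symmetry_group \<alpha>)"
      using conjugate_symmetry[OF m that] .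
    show "m \<circ> (f \<otimes>\<^bsub>symmetry_group \<alpha>\<^esub> g) \<circ> m'
        = (m \<circ> f \<circ> m') \<otimes>\<^bsub>symmetry_group (m ` \<alpha>)\<^esub> (m \<circ> g \<circ> m')"
      by (simp add: fun_eq_iff moebius_conjugate_apply[OF m])
  qed
  moreover have "bij_betw ?h (carrier (symmetry_group \<alpha>)) (carrier (symmetry_group (m ` \<alpha>)))"
  proof (rule bij_betw_byWitness[where f' = "\<lambda>f. m' \<circ> f \<circ> m"])
    show "\<forall>f\<in>carrier (symmetry_group \<alpha>). m' \<circ> (m \<circ> f \<circ> m') \<circ> m = f"
      "\<forall>f\<in>carrier (symmetry_group (m ` \<alpha>)). m \<circ> (m' \<circ> f \<circ> m) \<circ> m' = f"
      by (auto simp: fun_eq_iff moebius_conjugate_apply[OF m])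
    show "?h ` carrier (symmetry_group \<alpha>) \<subseteq> carrier (symmetry_group (m ` \<alpha>))"
      using conjugate_symmetry[OF m] by blast
    show "(\<lambda>f. m' \<circ> f \<circ> m) ` carrier (symmetry_group (m ` \<alpha>)) \<subseteq> carrier (symmetry_group \<alpha>)"
      using conjugate_symmetry[OF m', of _ "m ` \<alpha>"] unfolding undo by blast
  qed
  ultimately show ?thesis unfolding is_iso_def iso_def by blast
qed

text \<open>The multiplier of the rotation has exact order \<open>n\<close>, so its powers are all \<open>n\<close>-th roots of unity. The
  conjugated set is thus invariant under the whole of \<open>G\<close> and is a union of its orbits.\<close>

lemma dihedral_normal_form:
  assumes n: "n \<ge> 2" and fin: "finite \<alpha>" and dihedral: "symmetry_group \<alpha> \<cong> dihedral_group n"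
  obtains \<beta> where "finite \<beta>" "card \<beta> = card \<alpha>" "symmetry_group \<beta> \<cong> dihedral_group n"
    "finite_union_of_orbits n \<beta>"
proof -
  have n1: "n \<ge> 1" using n by simp
  obtain r t where rt: "r \<in> carrier (symmetry_group \<alpha>)" "t \<in> carrier (symmetry_group \<alpha>)" "dihedral_pair n r t"
    using dihedral_group_generators[OF n dihedral] .
  obtain m m' w where m: "moebius_conjugate m m'" "w \<noteq> 0" "m \<circ> r \<circ> m' = rot w" "m \<circ> t \<circ> m' = inversion"
    using dihedral_pair_standard_position[OF n rt(3)] .
  define \<beta> where "\<beta> = m ` \<alpha>"
  have sym: "rot w \<in> carrier (symmetry_group \<beta>)" "inversion \<in> carrier (symmetry_group \<beta>)"
    using conjugate_symmetry[OF m(1) rt(1)] conjugate_symmetry[OF m(1) rt(2)] by (simp_all add: m \<beta>_def)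
  have "dihedral_pair n (rot w) inversion" using dihedral_pair_conjugate[OF m(1) rt(3)] by (simp add: m)
  then have order: "rot w ^^ n = id" "\<And>j. 0 < j \<Longrightarrow> j < n \<Longrightarrow> rot w ^^ j \<noteq> id"
    by (auto simp: dihedral_pair_def)
  have wn: "w ^ n = 1" using order(1) unfolding rot_funpow[OF m(2)] rot_one[symmetric] rot_flip_eq_iff .
  have wj: "w ^ j \<noteq> 1" if "0 < j" "j < n" for j using order(2)[OF that] by (auto simp: rot_funpow[OF m(2)] rot_one)
  have inj: "inj_on ((^) w) {..<n}"
  proof (rule linorder_inj_onI)
    fix i j assume ij: "i < j" "i \<in> {..<n}" "j \<in> {..<n}"
    show "w ^ i \<noteq> w ^ j"
    proof
      assume "w ^ i = w ^ j"
      also have "w ^ j = w ^ i * w ^ (j - i)" using ij(1) by (simp flip: power_add)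
      finally have "w ^ (j - i) = 1" using m(2) by simp
      then show False using wj[of "j - i"] ij less_imp_diff_less[of j n i] by simp
    qed
  qed auto
  have powers: "(^) w ` {..<n} = {z. z ^ n = 1}"
  proof (rule card_subset_eq)
    show "finite {z::complex. z ^ n = 1}" using n1 by (intro finite_nth_roots) simp
    show "(^) w ` {..<n} \<subseteq> {z. z ^ n = 1}" using wn by (auto, metis mult.commute power_mult power_one)
    show "card ((^) w ` {..<n}) = card {z::complex. z ^ n = 1}"
      using inj n1 by (simp add: card_image card_roots_unity_eq)
  qed
  have rots: "rot z \<in> carrier (symmetry_group \<beta>)" if z: "z ^ n = 1" for z
  proof -
    obtain j where "z = w ^ j" using powers z by blast
    then show ?thesis using funpow_symmetry[OF sym(1), of j] by (simp add: rot_funpow[OF m(2)])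
  qed
  have "f ` \<beta> \<subseteq> \<beta>" if f: "f \<in> dihedral_maps n" for f
  proof -
    interpret S: group "symmetry_group \<beta>" by (rule group_symmetry)
    have "f \<in> carrier (symmetry_group \<beta>)"
      using f unfolding dihedral_maps_def
    proof (elim UnE CollectE exE conjE)
      fix z assume z: "f = flip z" "z ^ n = 1"
      then have "f = rot z \<circ> inversion"
        using root_of_unity_nonzero[OF n1] by (simp add: inversion_eq rot_flip_comp)
      then show ?thesis using S.m_closed[OF rots[OF z(2)] sym(2)] by simp
    qed (use rots in simp)
    then show ?thesis by (simp add: carrier_symmetry_group)
  qed
  moreover have "finite \<beta>" using fin by (simp add: \<beta>_def)
  ultimately have "finite_union_of_orbits n \<beta>" by (intro invariant_finite_union_of_orbits[OF n1])
  moreover have "card \<beta> = card \<alpha>"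
    unfolding \<beta>_def using m(1) is_moebius_inj[of m]
    by (intro card_image) (auto simp: moebius_conjugate_def intro: inj_on_subset)
  moreover have "symmetry_group \<beta> \<cong> dihedral_group n"
    unfolding \<beta>_def
    using group.iso_sym[OF group_symmetry symmetry_group_conjugate_iso[OF m(1)]] dihedral iso_trans by blast
  ultimately show ?thesis using that \<open>finite \<beta>\<close> by blast
qed

section \<open>Cardinalities and indices\<close>

lemma dihedral_sets_iff:
  assumes "n \<ge> 1"
  shows "\<alpha> \<in> dihedral_sets n (\<nu>, \<epsilon>, k) \<longleftrightarrow>
    symmetry_group \<alpha> \<cong> dihedral_group n \<and>
    (\<exists>\<B> \<C>. \<B> \<subseteq> {V_orbit, A_orbit n, B_orbit n} \<and> \<C> \<subseteq> C_orbits n \<and> finite \<C> \<and> \<alpha> = \<Union>(\<B> \<union> \<C>) \<and>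
      card (\<B> \<inter> {V_orbit}) = \<nu> \<and> card (\<B> \<inter> {A_orbit n, B_orbit n}) = \<epsilon> \<and> card \<C> = k)"
    (is "_ \<longleftrightarrow> ?S \<and> ?R")
proof (intro iffI conjI; (elim conjE exE)?)
  assume a: "\<alpha> \<in> dihedral_sets n (\<nu>, \<epsilon>, k)"
  then show ?S by (simp add: dihedral_sets_def)
  obtain \<B> \<C> where BC: "\<B> \<subseteq> {V_orbit, A_orbit n, B_orbit n}" "\<C> \<subseteq> C_orbits n" "finite \<C>"
    "\<alpha> = \<Union>(\<B> \<union> \<C>)"
    using finite_union_of_orbitsE[OF assms] a unfolding dihedral_sets_def by blast
  have "dihedral_index n \<alpha> = (\<nu>, \<epsilon>, k)" using a by (simp add: dihedral_sets_def)
  then have "card (\<B> \<inter> {V_orbit}) = \<nu> \<and> card (\<B> \<inter> {A_orbit n, B_orbit n}) = \<epsilon> \<and> card \<C> = k"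
    unfolding BC(4) dihedral_index_union[OF assms BC(1,2)] by simp
  with BC show ?R by (intro exI[of _ \<B>] exI[of _ \<C>] conjI) auto
next
  fix \<B> \<C>
  assume S: ?S and BC: "\<B> \<subseteq> {V_orbit, A_orbit n, B_orbit n}" "\<C> \<subseteq> C_orbits n" "finite \<C>" "\<alpha> = \<Union>(\<B> \<union> \<C>)"
    and index: "card (\<B> \<inter> {V_orbit}) = \<nu>" "card (\<B> \<inter> {A_orbit n, B_orbit n}) = \<epsilon>" "card \<C> = k"
  have sub: "\<B> \<union> \<C> \<subseteq> G_orbits n" using BC G_orbits_split[OF assms] by blast
  have fin: "finite (\<B> \<union> \<C>)" using BC finite_subset by blast
  then have "finite \<alpha>" unfolding BC(4) using finite_orbit[OF assms] sub by (intro finite_Union) auto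
  moreover have "finite_union_of_orbits n \<alpha>"
    unfolding finite_union_of_orbits_def using sub fin BC(4) by blast
  moreover have "dihedral_index n \<alpha> = (\<nu>, \<epsilon>, k)"
    unfolding BC(4) using dihedral_index_union[OF assms BC(1,2)] index by simp
  ultimately show "\<alpha> \<in> dihedral_sets n (\<nu>, \<epsilon>, k)" using S by (simp add: dihedral_sets_def)
qed

lemma card_split:
  assumes "n \<ge> 1" "\<B> \<subseteq> {V_orbit, A_orbit n, B_orbit n}"
  shows "card \<B> = card (\<B> \<inter> {V_orbit}) + card (\<B> \<inter> {A_orbit n, B_orbit n})"
    and "card (\<B> \<inter> {V_orbit}) \<le> 1" and "card (\<B> \<inter> {A_orbit n, B_orbit n}) \<le> 2"
proof -
  have "\<B> = (\<B> \<inter> {V_orbit}) \<union> (\<B> \<inter> {A_orbit n, B_orbit n})" using assms(2) by blast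
  then have "card \<B> = card ((\<B> \<inter> {V_orbit}) \<union> (\<B> \<inter> {A_orbit n, B_orbit n}))" by simp
  also have "\<dots> = card (\<B> \<inter> {V_orbit}) + card (\<B> \<inter> {A_orbit n, B_orbit n})"
    by (rule card_Un_disjoint) (use orbits_distinct[OF assms(1)] in auto)
  finally show "card \<B> = card (\<B> \<inter> {V_orbit}) + card (\<B> \<inter> {A_orbit n, B_orbit n})" .
  show "card (\<B> \<inter> {V_orbit}) \<le> 1" using card_mono[of "{V_orbit}" "\<B> \<inter> {V_orbit}"] by simp
  show "card (\<B> \<inter> {A_orbit n, B_orbit n}) \<le> 2"
    using card_mono[of "{A_orbit n, B_orbit n}" "\<B> \<inter> {A_orbit n, B_orbit n}"] orbits_distinct[OF assms(1)]
    by simp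
qed

text \<open>For \<open>n = 2\<close> the orbits \<open>V\<close>, \<open>A\<^sub>2\<close> and \<open>B\<^sub>2\<close> all have two points; the coarser index adds the first two
  entries of the general one, and everything known for general \<open>n \<ge> 2\<close> carries over.\<close>

lemma dihedral_sets_2_iff:
  "\<alpha> \<in> dihedral_sets_2 (\<nu>, k) \<longleftrightarrow> (\<exists>\<mu> \<epsilon>. \<nu> = \<mu> + \<epsilon> \<and> \<alpha> \<in> dihedral_sets 2 (\<mu>, \<epsilon>, k))"
proof
  assume a: "\<alpha> \<in> dihedral_sets_2 (\<nu>, k)"
  then have fu: "finite_union_of_orbits 2 \<alpha>" and ind: "dihedral_index_2 \<alpha> = (\<nu>, k)"
    and S: "symmetry_group \<alpha> \<cong> dihedral_group 2" by (auto simp: dihedral_sets_2_def)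
  obtain \<B> \<C> where BC: "\<B> \<subseteq> {V_orbit, A_orbit 2, B_orbit 2}" "\<C> \<subseteq> C_orbits 2" "finite \<C>"
    "\<alpha> = \<Union>(\<B> \<union> \<C>)"
    using finite_union_of_orbitsE[OF _ fu] by auto
  then have "card \<B> = \<nu>" "card \<C> = k" using dihedral_index_2_union[OF BC(1,2)] ind by auto
  then show "\<exists>\<mu> \<epsilon>. \<nu> = \<mu> + \<epsilon> \<and> \<alpha> \<in> dihedral_sets 2 (\<mu>, \<epsilon>, k)"
    using BC S card_split(1)[OF _ BC(1)] by (subst dihedral_sets_iff) auto
next
  assume "\<exists>\<mu> \<epsilon>. \<nu> = \<mu> + \<epsilon> \<and> \<alpha> \<in> dihedral_sets 2 (\<mu>, \<epsilon>, k)"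
  then obtain \<mu> \<epsilon> where a: "\<nu> = \<mu> + \<epsilon>" "\<alpha> \<in> dihedral_sets 2 (\<mu>, \<epsilon>, k)" by blast
  then obtain \<B> \<C> where BC: "\<B> \<subseteq> {V_orbit, A_orbit 2, B_orbit 2}" "\<C> \<subseteq> C_orbits 2" "finite \<C>"
    "\<alpha> = \<Union>(\<B> \<union> \<C>)" "card (\<B> \<inter> {V_orbit}) = \<mu>" "card (\<B> \<inter> {A_orbit 2, B_orbit 2}) = \<epsilon>" "card \<C> = k"
    using iffD1[OF dihedral_sets_iff[OF one_le_numeral] a(2)] by (elim conjE exE)
  then have "dihedral_index_2 \<alpha> = (\<nu>, k)"
    using dihedral_index_2_union[OF BC(1,2)] card_split(1)[OF _ BC(1)] a(1) by simp
  then show "\<alpha> \<in> dihedral_sets_2 (\<nu>, k)" using a(2) by (simp add: dihedral_sets_2_def dihedral_sets_def)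
qed

lemma card_dihedral_sets:
  assumes "n \<ge> 1" "\<alpha> \<in> dihedral_sets n (\<nu>, \<epsilon>, k)"
  shows "card \<alpha> = 2 * \<nu> + n * (\<epsilon> + 2 * k)" and "\<nu> \<le> 1" and "\<epsilon> \<le> 2"
proof -
  obtain \<B> \<C> where BC: "\<B> \<subseteq> {V_orbit, A_orbit n, B_orbit n}" "\<C> \<subseteq> C_orbits n" "finite \<C>"
    "\<alpha> = \<Union>(\<B> \<union> \<C>)" "card (\<B> \<inter> {V_orbit}) = \<nu>" "card (\<B> \<inter> {A_orbit n, B_orbit n}) = \<epsilon>" "card \<C> = k"
    using assms(2)[unfolded dihedral_sets_iff[OF assms(1)]] by (elim conjE exE)
  show "card \<alpha> = 2 * \<nu> + n * (\<epsilon> + 2 * k)" using card_union_of_orbits[OF assms(1) BC(1-3)] BC by simp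
  show "\<nu> \<le> 1" "\<epsilon> \<le> 2" using card_split(2,3)[OF assms(1) BC(1)] BC by auto
qed

lemma dihedral_sets_no_generic_orbit:
  assumes "n \<ge> 2" "\<alpha> \<in> dihedral_sets n (\<nu>, \<epsilon>, 0)"
  shows "\<epsilon> = 1" "n \<noteq> 2" "n = 4 \<Longrightarrow> \<nu> = 0"
proof -
  have n1: "n \<ge> 1" using assms(1) by simp
  obtain \<B> \<C> where BC: "\<B> \<subseteq> {V_orbit, A_orbit n, B_orbit n}" "finite \<C>"
    "\<alpha> = \<Union>(\<B> \<union> \<C>)" "card (\<B> \<inter> {V_orbit}) = \<nu>" "card (\<B> \<inter> {A_orbit n, B_orbit n}) = \<epsilon>" "card \<C> = 0"
    and S: "symmetry_group \<alpha> \<cong> dihedral_group n"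
    using assms(2)[unfolded dihedral_sets_iff[OF n1]] by (elim conjE exE)
  then have "\<alpha> = \<Union>\<B>" by simp
  then have *: "symmetry_group (\<Union>\<B>) \<cong> dihedral_group n" using S by simp
  show "\<epsilon> = 1" "n \<noteq> 2" using no_generic_orbit_dihedral[OF assms(1) BC(1) *] BC(5) by auto
  show "\<nu> = 0" if "n = 4"
    using no_generic_orbit_dihedral(3)[OF assms(1) BC(1) * that] BC(4) by auto
qed

lemma dihedral_sets_nonempty:
  assumes "n \<ge> 2" "k \<ge> 1" "\<nu> \<le> 1" "\<epsilon> \<le> 2"
  shows "dihedral_sets n (\<nu>, \<epsilon>, k) \<noteq> {}"
proof -
  have n1: "n \<ge> 1" using assms(1) by simp
  note distinct = orbits_distinct(1-3)[OF n1] orbits_distinct(1-3)[OF n1, symmetric]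
  define \<V> where "\<V> = (if \<nu> = 0 then {} else {V_orbit})"
  define \<A> where "\<A> = (if \<epsilon> = 0 then {} else if \<epsilon> = 1 then {A_orbit n} else {A_orbit n, B_orbit n})"
  define \<B> where "\<B> = \<V> \<union> \<A>"
  have B: "\<B> \<subseteq> {V_orbit, A_orbit n, B_orbit n}" by (auto simp: \<B>_def \<V>_def \<A>_def)
  have "\<B> \<inter> {V_orbit} = \<V>" "\<B> \<inter> {A_orbit n, B_orbit n} = \<A>"
    using distinct by (auto simp: \<B>_def \<V>_def \<A>_def split: if_splits)
  moreover have "card \<V> = \<nu>" "card \<A> = \<epsilon>"
    using assms(3,4) distinct by (auto simp: \<V>_def \<A>_def)
  ultimately have index: "card (\<B> \<inter> {V_orbit}) = \<nu>" "card (\<B> \<inter> {A_orbit n, B_orbit n}) = \<epsilon>" by simp_all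
  obtain \<C> where C: "\<C> \<subseteq> C_orbits n" "finite \<C>" "card \<C> = k"
    "carrier (symmetry_group (\<Union>(\<B> \<union> \<C>))) = dihedral_maps n"
    using exists_exactly_dihedral[OF assms(1) B assms(2)] .
  have "\<Union>(\<B> \<union> \<C>) \<in> dihedral_sets n (\<nu>, \<epsilon>, k)"
    unfolding dihedral_sets_iff[OF n1]
    using symmetry_group_dihedralI[OF n1 C(4)] B C(1-3) index
    by (intro conjI exI[of _ \<B>] exI[of _ \<C>]) auto
  then show ?thesis by blast
qed

lemma dihedral_sets_polygon:
  assumes "n \<ge> 3"
  shows "dihedral_sets n (0, 1, 0) \<noteq> {}" and "n \<noteq> 4 \<Longrightarrow> dihedral_sets n (1, 1, 0) \<noteq> {}"
proof -
  have n1: "n \<ge> 1" using assms by simp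
  note distinct = orbits_distinct[OF n1]
  have *: "\<Union>\<B> \<in> dihedral_sets n (card (\<B> \<inter> {V_orbit}), card (\<B> \<inter> {A_orbit n, B_orbit n}), 0)"
    if "\<B> \<subseteq> {V_orbit, A_orbit n, B_orbit n}" "carrier (symmetry_group (\<Union>\<B>)) = dihedral_maps n" for \<B>
    unfolding dihedral_sets_iff[OF n1]
    using symmetry_group_dihedralI[OF n1 that(2)] that(1)
    by (intro conjI exI[of _ \<B>] exI[of _ "{}"]) auto
  have eqs: "{A_orbit n} \<inter> {V_orbit} = {}" "{A_orbit n} \<inter> {A_orbit n, B_orbit n} = {A_orbit n}"
    "{V_orbit, A_orbit n} \<inter> {V_orbit} = {V_orbit}" "{V_orbit, A_orbit n} \<inter> {A_orbit n, B_orbit n} = {A_orbit n}"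
    using distinct by auto
  have sub: "{A_orbit n} \<subseteq> {V_orbit, A_orbit n, B_orbit n}"
    "{V_orbit, A_orbit n} \<subseteq> {V_orbit, A_orbit n, B_orbit n}" by auto
  have card: "card {A_orbit n} = 1" "card {V_orbit} = 1" "card ({} :: sphere set set) = 0" by simp_all
  show "dihedral_sets n (0, 1, 0) \<noteq> {}"
    using *[OF sub(1) symmetry_A_orbit[OF assms]] unfolding eqs card by blast
  show "dihedral_sets n (1, 1, 0) \<noteq> {}" if "n \<noteq> 4"
    using *[OF sub(2) symmetry_bipyramid[OF assms that]] unfolding eqs card by blast
qed

text \<open>Since every set with dihedral symmetry can be moved into standard position, the possible
  cardinalities are those of the indices that occur.\<close>

lemma dihedral_cardinalities:
  assumes "n \<ge> 2"
  shows "{card \<alpha> | \<alpha>. finite \<alpha> \<and> symmetry_group \<alpha> \<cong> dihedral_group n}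
    = {2 * \<nu> + n * (\<epsilon> + 2 * k) | \<nu> \<epsilon> k. dihedral_sets n (\<nu>, \<epsilon>, k) \<noteq> {}}"
proof (intro equalityI subsetI)
  have n1: "n \<ge> 1" using assms by simp
  fix c assume "c \<in> {card \<alpha> | \<alpha>. finite \<alpha> \<and> symmetry_group \<alpha> \<cong> dihedral_group n}"
  then obtain \<alpha> where \<alpha>: "c = card \<alpha>" "finite \<alpha>" "symmetry_group \<alpha> \<cong> dihedral_group n" by blast
  obtain \<beta> where \<beta>: "finite \<beta>" "card \<beta> = card \<alpha>" "symmetry_group \<beta> \<cong> dihedral_group n"
    "finite_union_of_orbits n \<beta>"
    using dihedral_normal_form[OF assms \<alpha>(2,3)] .
  obtain \<nu> \<epsilon> k where index: "dihedral_index n \<beta> = (\<nu>, \<epsilon>, k)" by (cases "dihedral_index n \<beta>")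
  then have in_sets: "\<beta> \<in> dihedral_sets n (\<nu>, \<epsilon>, k)" using \<beta> by (simp add: dihedral_sets_def)
  then have "c = 2 * \<nu> + n * (\<epsilon> + 2 * k)" using card_dihedral_sets(1)[OF n1 in_sets] \<alpha>(1) \<beta>(2) by simp
  then show "c \<in> {2 * \<nu> + n * (\<epsilon> + 2 * k) | \<nu> \<epsilon> k. dihedral_sets n (\<nu>, \<epsilon>, k) \<noteq> {}}"
    using in_sets by blast
next
  have n1: "n \<ge> 1" using assms by simp
  fix c assume "c \<in> {2 * \<nu> + n * (\<epsilon> + 2 * k) | \<nu> \<epsilon> k. dihedral_sets n (\<nu>, \<epsilon>, k) \<noteq> {}}"
  then obtain \<nu> \<epsilon> k \<alpha> where c: "c = 2 * \<nu> + n * (\<epsilon> + 2 * k)" "\<alpha> \<in> dihedral_sets n (\<nu>, \<epsilon>, k)" by blast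
  then have "c = card \<alpha>" using card_dihedral_sets(1)[OF n1 c(2)] by simp
  then show "c \<in> {card \<alpha> | \<alpha>. finite \<alpha> \<and> symmetry_group \<alpha> \<cong> dihedral_group n}"
    using c(2) by (auto simp: dihedral_sets_def)
qed

text \<open>Writing \<open>j = \<epsilon> + 2k\<close> with \<open>\<epsilon> = j mod 2\<close> leaves \<open>k \<ge> 1\<close>, so an index with a generic orbit realises it.\<close>

lemma cardinality_in_index_form:
  assumes "n \<ge> 2" "j \<ge> 2" "\<nu> \<le> 1"
  shows "2 * \<nu> + n * j \<in> {2 * \<nu> + n * (\<epsilon> + 2 * k) | \<nu> \<epsilon> k. dihedral_sets n (\<nu>, \<epsilon>, k) \<noteq> {}}"
proof -
  define \<epsilon> k where "\<epsilon> = j mod 2" and "k = j div 2"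
  have "j = \<epsilon> + 2 * k" unfolding \<epsilon>_def k_def by (rule mod_mult_div_eq[symmetric])
  moreover have "\<epsilon> \<le> 2" unfolding \<epsilon>_def by (rule less_imp_le) simp
  moreover have "k \<ge> 1" using assms(2) div_le_mono[of 2 j 2] by (simp add: k_def)
  moreover have "dihedral_sets n (\<nu>, \<epsilon>, k) \<noteq> {}" if "k \<ge> 1" "\<epsilon> \<le> 2"
    using dihedral_sets_nonempty[OF assms(1) that(1) assms(3) that(2)] .
  ultimately show ?thesis by blast
qed

lemma cardinalities_generic:
  assumes n: "n \<ge> 3" "n \<noteq> 4"
  shows "{card \<alpha> | \<alpha>. finite \<alpha> \<and> symmetry_group \<alpha> \<cong> dihedral_group n}
    = {x + n * k | x k. x \<in> {0, 2} \<and> k \<ge> 1}"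
proof -
  have n2: "n \<ge> 2" and n1: "n \<ge> 1" using n by auto
  show ?thesis
    unfolding dihedral_cardinalities[OF n2]
  proof (intro equalityI subsetI)
    fix c assume "c \<in> {2 * \<nu> + n * (\<epsilon> + 2 * k) | \<nu> \<epsilon> k. dihedral_sets n (\<nu>, \<epsilon>, k) \<noteq> {}}"
    then obtain \<nu> \<epsilon> k \<alpha> where c: "c = 2 * \<nu> + n * (\<epsilon> + 2 * k)" "\<alpha> \<in> dihedral_sets n (\<nu>, \<epsilon>, k)" by blast
    have "2 * \<nu> \<in> {0, 2}" using card_dihedral_sets(2)[OF n1 c(2)] by auto
    moreover have "\<epsilon> + 2 * k \<ge> 1"
      using dihedral_sets_no_generic_orbit(1)[OF n2, of \<alpha> \<nu> \<epsilon>] c(2) by (cases k) auto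
    ultimately show "c \<in> {x + n * k | x k. x \<in> {0, 2} \<and> k \<ge> 1}" using c(1) by blast
  next
    fix c assume "c \<in> {x + n * k | x k. x \<in> {0, 2} \<and> k \<ge> 1}"
    then obtain x j where "c = x + n * j" "x \<in> {0, 2}" "j \<ge> 1" by blast
    then obtain \<nu> where c: "c = 2 * \<nu> + n * j" "\<nu> \<le> 1" "j \<ge> 1"
      by (metis empty_iff insert_iff le_numeral_extra(4) mult.right_neutral mult_zero_right zero_le_one)
    show "c \<in> {2 * \<nu> + n * (\<epsilon> + 2 * k) | \<nu> \<epsilon> k. dihedral_sets n (\<nu>, \<epsilon>, k) \<noteq> {}}"
    proof (cases "j = 1")
      case True
      have "dihedral_sets n (\<nu>, 1, 0) \<noteq> {}"
        using dihedral_sets_polygon[OF n(1)] n(2) c(2) by (cases "\<nu> = 0") (auto simp: le_Suc_eq)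
      then show ?thesis
        using c(1) True by (intro CollectI exI[of _ \<nu>] exI[of _ "1"] exI[of _ "0"]) auto
    next
      case False
      then show ?thesis using cardinality_in_index_form[OF n2 _ c(2), of j] c by simp
    qed
  qed
qed

lemma cardinalities_four:
  "{card \<alpha> | \<alpha>. finite \<alpha> \<and> symmetry_group \<alpha> \<cong> dihedral_group 4}
    = {x + 4 * k | x k. x \<in> {0, 2} \<and> k \<ge> 2} \<union> {4}"
proof -
  have n: "(4::nat) \<ge> 2" "(4::nat) \<ge> 1" "(4::nat) \<ge> 3" by auto
  show ?thesis
    unfolding dihedral_cardinalities[OF n(1)]
  proof (intro equalityI subsetI)
    fix c assume "c \<in> {2 * \<nu> + 4 * (\<epsilon> + 2 * k) | \<nu> \<epsilon> k. dihedral_sets 4 (\<nu>, \<epsilon>, k) \<noteq> {}}"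
    then obtain \<nu> \<epsilon> k \<alpha> where c: "c = 2 * \<nu> + 4 * (\<epsilon> + 2 * k)" "\<alpha> \<in> dihedral_sets 4 (\<nu>, \<epsilon>, k)" by blast
    show "c \<in> {x + 4 * k | x k. x \<in> {0, 2} \<and> k \<ge> 2} \<union> {4}"
    proof (cases "k = 0")
      case True
      then have "\<epsilon> = 1" "\<nu> = 0" using dihedral_sets_no_generic_orbit[OF n(1), of \<alpha> \<nu> \<epsilon>] c(2) by auto
      then show ?thesis using c(1) True by simp
    next
      case False
      have "2 * \<nu> \<in> {0, 2}" using card_dihedral_sets(2)[OF n(2) c(2)] by auto
      moreover have "\<epsilon> + 2 * k \<ge> 2" using False by simp
      ultimately show ?thesis using c(1) by blast
    qed
  next
    fix c :: nat assume "c \<in> {x + 4 * k | x k. x \<in> {0, 2} \<and> k \<ge> 2} \<union> {4}"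
    then consider "c = 4" | x j where "c = x + 4 * j" "x \<in> {0, 2}" "j \<ge> 2" by blast
    then show "c \<in> {2 * \<nu> + 4 * (\<epsilon> + 2 * k) | \<nu> \<epsilon> k. dihedral_sets 4 (\<nu>, \<epsilon>, k) \<noteq> {}}"
    proof cases
      case 1
      then show ?thesis
        using dihedral_sets_polygon(1)[OF n(3)]
        by (intro CollectI exI[of _ 0] exI[of _ "1"] exI[of _ "0"]) auto
    next
      case 2
      then show ?thesis
        using cardinality_in_index_form[OF n(1) 2(3), of 0] cardinality_in_index_form[OF n(1) 2(3), of 1] by auto
    qed
  qed
qed

lemma cardinalities_two:
  "{card \<alpha> | \<alpha>. finite \<alpha> \<and> symmetry_group \<alpha> \<cong> dihedral_group 2} = {2 * k | k. k \<ge> 2}"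
proof -
  have n: "(2::nat) \<ge> 2" "(2::nat) \<ge> 1" by auto
  show ?thesis
    unfolding dihedral_cardinalities[OF n(1)]
  proof (intro equalityI subsetI)
    fix c assume "c \<in> {2 * \<nu> + 2 * (\<epsilon> + 2 * k) | \<nu> \<epsilon> k. dihedral_sets 2 (\<nu>, \<epsilon>, k) \<noteq> {}}"
    then obtain \<nu> \<epsilon> k \<alpha> where c: "c = 2 * \<nu> + 2 * (\<epsilon> + 2 * k)" "\<alpha> \<in> dihedral_sets 2 (\<nu>, \<epsilon>, k)" by blast
    have "k \<noteq> 0" using dihedral_sets_no_generic_orbit(2)[OF n(1), of \<alpha> \<nu> \<epsilon>] c(2) by (intro notI) simp
    then have "c = 2 * (\<nu> + \<epsilon> + 2 * k)" "\<nu> + \<epsilon> + 2 * k \<ge> 2" using c(1) by auto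
    then show "c \<in> {2 * k | k. k \<ge> 2}" by blast
  next
    fix c :: nat assume "c \<in> {2 * k | k. k \<ge> 2}"
    then obtain j where j: "c = 2 * j" "j \<ge> 2" by blast
    then show "c \<in> {2 * \<nu> + 2 * (\<epsilon> + 2 * k) | \<nu> \<epsilon> k. dihedral_sets 2 (\<nu>, \<epsilon>, k) \<noteq> {}}"
      using cardinality_in_index_form[OF n(1) j(2), of 0] unfolding j(1)
      by (simp only: mult_0_right add_0 le0 simp_thms)
  qed
qed

lemma dihedral_sets_2_generic:
  assumes "\<nu> \<le> 3" "k \<ge> 1"
  shows "dihedral_sets_2 (\<nu>, k) \<noteq> {}" and "\<alpha> \<in> dihedral_sets_2 (\<nu>, k) \<Longrightarrow> card \<alpha> = 2 * \<nu> + 4 * k"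
proof -
  define \<mu> where "\<mu> = min \<nu> 1"
  have "\<nu> = \<mu> + (\<nu> - \<mu>)" "\<mu> \<le> 1" "\<nu> - \<mu> \<le> 2" using assms(1) by (auto simp: \<mu>_def)
  then show "dihedral_sets_2 (\<nu>, k) \<noteq> {}"
    using dihedral_sets_nonempty[of 2 k \<mu> "\<nu> - \<mu>"] assms(2) dihedral_sets_2_iff by blast
  show "card \<alpha> = 2 * \<nu> + 4 * k" if "\<alpha> \<in> dihedral_sets_2 (\<nu>, k)"
    using that card_dihedral_sets(1)[of 2 \<alpha>] unfolding dihedral_sets_2_iff by fastforce
qed

lemma dihedral_sets_2_no_generic_orbit: "dihedral_sets_2 (\<nu>, 0) = {}"
  using dihedral_sets_no_generic_orbit(2)[of 2] dihedral_sets_2_iff by blast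

theorem theorem11:
  shows
    "(\<forall>n\<ge>3. n \<noteq> 4 \<longrightarrow>
        (dihedral_sets n (0, 1, 0) \<noteq> {} \<and> (\<forall>\<alpha>\<in>dihedral_sets n (0, 1, 0). card \<alpha> = n)) \<and>
        (dihedral_sets n (1, 1, 0) \<noteq> {} \<and> (\<forall>\<alpha>\<in>dihedral_sets n (1, 1, 0). card \<alpha> = n + 2)) \<and>
        (\<forall>\<nu>\<in>{0, 1}. \<forall>\<epsilon>\<in>{0, 1, 2}. \<forall>k\<ge>1.
           dihedral_sets n (\<nu>, \<epsilon>, k) \<noteq> {} \<and>
           (\<forall>\<alpha>\<in>dihedral_sets n (\<nu>, \<epsilon>, k). card \<alpha> = 2 * \<nu> + n * (\<epsilon> + 2 * k))) \<and>
        dihedral_sets n (0, 2, 0) = {} \<and>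
        dihedral_sets n (1, 2, 0) = {})
   \<and> ((dihedral_sets 4 (0, 1, 0) \<noteq> {} \<and> (\<forall>\<alpha>\<in>dihedral_sets 4 (0, 1, 0). card \<alpha> = 4)) \<and>
      (\<forall>\<nu>\<in>{0, 1}. \<forall>\<epsilon>\<in>{0, 1, 2}. \<forall>k\<ge>1.
         dihedral_sets 4 (\<nu>, \<epsilon>, k) \<noteq> {} \<and>
         (\<forall>\<alpha>\<in>dihedral_sets 4 (\<nu>, \<epsilon>, k). card \<alpha> = 2 * \<nu> + 4 * (\<epsilon> + 2 * k))) \<and>
      dihedral_sets 4 (1, 1, 0) = {} \<and>
      dihedral_sets 4 (0, 2, 0) = {} \<and>
      dihedral_sets 4 (1, 2, 0) = {})
   \<and> ((\<forall>\<nu>\<in>{0, 1, 2, 3}. \<forall>k\<ge>1.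
         dihedral_sets_2 (\<nu>, k) \<noteq> {} \<and>
         (\<forall>\<alpha>\<in>dihedral_sets_2 (\<nu>, k). card \<alpha> = 2 * \<nu> + 4 * k)) \<and>
      dihedral_sets_2 (1, 0) = {} \<and>
      dihedral_sets_2 (2, 0) = {} \<and>
      dihedral_sets_2 (3, 0) = {})
   \<and> (\<forall>n\<ge>3. n \<noteq> 4 \<longrightarrow>
        {card \<alpha> | \<alpha>. finite \<alpha> \<and> symmetry_group \<alpha> \<cong> dihedral_group n}
          = {x + n * k | x k. x \<in> {0, 2} \<and> k \<ge> 1})
   \<and> {card \<alpha> | \<alpha>. finite \<alpha> \<and> symmetry_group \<alpha> \<cong> dihedral_group 4}
       = {x + 4 * k | x k. x \<in> {0, 2} \<and> k \<ge> 2} \<union> {4}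
   \<and> {card \<alpha> | \<alpha>. finite \<alpha> \<and> symmetry_group \<alpha> \<cong> dihedral_group 2}
       = {2 * k | k. k \<ge> 2}"
proof (intro conjI allI ballI impI)
  fix n :: nat assume n: "n \<ge> 3" "n \<noteq> 4"
  then have n2: "n \<ge> 2" and n1: "n \<ge> 1" by auto
  note card = card_dihedral_sets(1)[OF n1]
  show "dihedral_sets n (0, 1, 0) \<noteq> {}" "dihedral_sets n (1, 1, 0) \<noteq> {}"
    using dihedral_sets_polygon[OF n(1)] n(2) by auto
  show "card \<alpha> = n" if "\<alpha> \<in> dihedral_sets n (0, 1, 0)" for \<alpha> using card[OF that] by simp
  show "card \<alpha> = n + 2" if "\<alpha> \<in> dihedral_sets n (1, 1, 0)" for \<alpha> using card[OF that] by simp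
  show "dihedral_sets n (\<nu>, \<epsilon>, k) \<noteq> {}" if "\<nu> \<in> {0, 1}" "\<epsilon> \<in> {0, 1, 2}" "k \<ge> 1" for \<nu> \<epsilon> k
    using that by (intro dihedral_sets_nonempty[OF n2]) auto
  show "card \<alpha> = 2 * \<nu> + n * (\<epsilon> + 2 * k)" if "\<alpha> \<in> dihedral_sets n (\<nu>, \<epsilon>, k)" for \<nu> \<epsilon> k \<alpha>
    using card[OF that] .
  show "dihedral_sets n (0, 2, 0) = {}" "dihedral_sets n (1, 2, 0) = {}"
    using dihedral_sets_no_generic_orbit(1)[OF n2] by fastforce+
  show "{card \<alpha> | \<alpha>. finite \<alpha> \<and> symmetry_group \<alpha> \<cong> dihedral_group n}
      = {x + n * k | x k. x \<in> {0, 2} \<and> k \<ge> 1}"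
    by (rule cardinalities_generic[OF n])
next
  have n: "(4::nat) \<ge> 2" "(4::nat) \<ge> 1" "(4::nat) \<ge> 3" by auto
  note card = card_dihedral_sets(1)[OF n(2)]
  show "dihedral_sets 4 (0, 1, 0) \<noteq> {}" by (rule dihedral_sets_polygon(1)[OF n(3)])
  show "card \<alpha> = 4" if "\<alpha> \<in> dihedral_sets 4 (0, 1, 0)" for \<alpha> using card[OF that] by simp
  show "dihedral_sets 4 (\<nu>, \<epsilon>, k) \<noteq> {}" if "\<nu> \<in> {0, 1}" "\<epsilon> \<in> {0, 1, 2}" "k \<ge> 1" for \<nu> \<epsilon> k
    using that by (intro dihedral_sets_nonempty[OF n(1)]) auto
  show "card \<alpha> = 2 * \<nu> + 4 * (\<epsilon> + 2 * k)" if "\<alpha> \<in> dihedral_sets 4 (\<nu>, \<epsilon>, k)" for \<nu> \<epsilon> k \<alpha>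
    using card[OF that] .
  show "dihedral_sets 4 (1, 1, 0) = {}" "dihedral_sets 4 (0, 2, 0) = {}" "dihedral_sets 4 (1, 2, 0) = {}"
    using dihedral_sets_no_generic_orbit[OF n(1)] by fastforce+
next
  show "dihedral_sets_2 (\<nu>, k) \<noteq> {}" if "\<nu> \<in> {0, 1, 2, 3}" "k \<ge> 1" for \<nu> k
    using that by (intro dihedral_sets_2_generic(1)) auto
  show "card \<alpha> = 2 * \<nu> + 4 * k" if "\<nu> \<in> {0, 1, 2, 3}" "k \<ge> 1" "\<alpha> \<in> dihedral_sets_2 (\<nu>, k)" for \<nu> k \<alpha>
    using that by (intro dihedral_sets_2_generic(2)) auto
qed (rule dihedral_sets_2_no_generic_orbit cardinalities_four cardinalities_two)+

end
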